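(* Let $\mathcal{P}\subset\mathbb{R}^2$ be the union of the open disks (including open half-planes) of the Boyd/Mallows (separation-3) packing, let $\mathcal{R}=\mathbb{R}^2\setminus\mathcal{P}$ be its residual set, and let $\delta$ be the Hausdorff dimension of $\mathcal{R}$. Then $$1.327266<\delta<1.348771 .$$
   Context: Circle coordinates. To an open disk in $\mathbb{R}^2$ with center $(x,y)$, radius $r$ and curvature $\kappa=1/r$ associate the vector $(\kappa,\kappa x,\kappa y,\kappa(x^2+y^2)-1/\kappa)\in\mathbb{R}^4$; to the open half-plane $\{p: p\cdot u>h\}$ ($u=(u_1,u_2)$ a unit vector) associate $(0,u_1,u_2,2h)$ (the limit of disks). The separation of two disks with radii $r_1,r_2$ and distance $s$ between centers is $\frac{s^2-r_1^2-r_2^2}{2r_1r_2}$ (extended to half-planes by limits); it is a bilinear function of the two associated vectors, equal to $1$ for externally tangent disks. Lorentz form. On $\mathbb{R}^4$ with standard basis $\vec e_1,\dots,\vec e_4$ let $\vec x\circ\vec y=\vec x^{\,t}J\vec y$ with $$J=-\begin{pmatrix}-1&3&1&1\\3&-1&1&1\\1&1&-1&1\\1&1&1&-1\end{pmatrix},$$ and for $\vec n$ with $\vec n\circ\vec n\neq0$ let $R_{\vec n}(\vec x)=\vec x-2\frac{\vec x\circ\vec n}{\vec n\circ\vec n}\vec n$. Boyd/Mallows packing. Let $\Gamma=\langle R_{\vec n_1},\dots,R_{\vec n_5}\rangle$ with $\vec n_1=(-1,1,2,2)$, $\vec n_2=(1,-1,2,2)$, $\vec n_3=(1,1,-2,0)$,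 $\vec n_4=(3,1,2,-2)$, $\vec n_5=(1,3,2,-2)$. The packing is the set of disks represented by the vectors in the $\Gamma$-orbit of $\{\vec e_1,\vec e_2,\vec e_3,\vec e_4,\vec e_1+\vec e_2-\vec e_4\}$. Here $\vec e_1,\vec e_2$ represent the disks of radius $1/2$ centered at $(0,0)$ and $(\sqrt2,0)$, $\vec e_3$ the half-plane $y>1/2$, $\vec e_4$ the half-plane $y<-1/2$ (so that $-\vec e_i\circ\vec e_j$ is the separation of the corresponding disks), and $\sum v_i\vec e_i$ represents the disk whose associated vector in circle coordinates is $\sum v_i$ times that of the disk of $\vec e_i$. The disks of the packing are pairwise disjoint. *)

theory Defs
  imports "HOL-Analysis.Analysis" "HOL-Algebra.Bij" "HOL-Algebra.Generated_Groups"
begin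

section \<open>Hausdorff dimension\<close>

text \<open>
  The contribution of one covering set, \<open>diam(U)\<^sup>s\<close>, with the conventions that the empty
  set contributes \<open>0\<close> and that \<open>0\<^sup>0 = 1\<close> (whereas \<open>0 powr 0 = 0\<close>). It is only applied to
  bounded sets, since \<open>diameter\<close> is unspecified on unbounded ones.
\<close>

definition hausdorff_gauge :: "real \<Rightarrow> 'a::metric_space set \<Rightarrow> ennreal" where
  "hausdorff_gauge s U =
     (if U = {} then 0 else if s = 0 then 1 else ennreal (diameter U powr s))"

definition hausdorff_premeasure ::
    "real \<Rightarrow> real \<Rightarrow> 'a::metric_space set \<Rightarrow> ennreal" where
  "hausdorff_premeasure s d A =
     (INF U \<in> {U :: nat \<Rightarrow> 'a set. A \<subseteq> (\<Union>n. U n) \<and> (\<forall>n. bounded (U n) \<and> diameter (U n) \<le> d)}.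
        \<Sum>n. hausdorff_gauge s (U n))"

definition hausdorff_measure :: "real \<Rightarrow> 'a::metric_space set \<Rightarrow> ennreal" where
  "hausdorff_measure s A = (SUP d \<in> {0<..}. hausdorff_premeasure s d A)"

definition hausdorff_dim :: "'a::metric_space set \<Rightarrow> ereal" where
  "hausdorff_dim A = (INF s \<in> {s. 0 \<le> s \<and> hausdorff_measure s A = 0}. ereal s)"

section \<open>Circle coordinates\<close>

definition disk_coords :: "real^2 \<Rightarrow> real \<Rightarrow> real^4" where
  "disk_coords c r =
     (let k = 1 / r in vector [k, k * c$1, k * c$2, k * ((c$1)\<^sup>2 + (c$2)\<^sup>2) - 1 / k])"

definition halfplane :: "real^2 \<Rightarrow> real \<Rightarrow> (real^2) set" where
  "halfplane u h = {p. p \<bullet> u > h}"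

definition halfplane_coords :: "real^2 \<Rightarrow> real \<Rightarrow> real^4" where
  "halfplane_coords u h = vector [0, u$1, u$2, 2 * h]"

definition has_circle_coords :: "(real^2) set \<Rightarrow> real^4 \<Rightarrow> bool" where
  "has_circle_coords D v \<longleftrightarrow>
     (\<exists>c r. r > 0 \<and> D = ball c r \<and> v = disk_coords c r) \<or>
     (\<exists>u h. norm u = 1 \<and> D = halfplane u h \<and> v = halfplane_coords u h)"

section \<open>The Lorentz form and its reflections\<close>

definition lorentz_matrix :: "real^4^4" where
  "lorentz_matrix = - vector [vector [-1,  3,  1,  1],
                              vector [ 3, -1,  1,  1],
                              vector [ 1,  1, -1,  1],
                              vector [ 1,  1,  1, -1]]"

definition lorentz :: "real^4 \<Rightarrow> real^4 \<Rightarrow> real" where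
  "lorentz x y = x \<bullet> (lorentz_matrix *v y)"

definition lorentz_reflection :: "real^4 \<Rightarrow> real^4 \<Rightarrow> real^4" where
  "lorentz_reflection n x = x - (2 * (lorentz x n / lorentz n n)) *\<^sub>R n"

section \<open>The Boyd/Mallows packing\<close>

definition mallows_normals :: "(real^4) set" where
  "mallows_normals =
     {vector [-1, 1, 2, 2], vector [1, -1, 2, 2], vector [1, 1, -2, 0],
      vector [3, 1, 2, -2], vector [1, 3, 2, -2]}"

definition mallows_group :: "(real^4 \<Rightarrow> real^4) set" where
  "mallows_group = generate (BijGroup UNIV) (lorentz_reflection ` mallows_normals)"

definition mallows_seeds :: "(real^4) set" where
  "mallows_seeds =
     {axis 1 1, axis 2 1, axis 3 1, axis 4 1, axis 1 1 + axis 2 1 - axis 4 1}"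

definition mallows_orbit :: "(real^4) set" where
  "mallows_orbit = {g x | g x. g \<in> mallows_group \<and> x \<in> mallows_seeds}"

text \<open>
  The linear map sending the basis vectors to the circle coordinates of the two disks of
  radius \<open>1/2\<close> centred at \<open>(0,0)\<close> and \<open>(sqrt 2,0)\<close> and of the half-planes \<open>y > 1/2\<close>
  and \<open>y < -1/2\<close>; the last one is \<open>{p. p \<bullet> (0,-1) > 1/2}\<close>.
\<close>

definition mallows_circle_coords :: "real^4 \<Rightarrow> real^4" where
  "mallows_circle_coords v =
     v$1 *\<^sub>R disk_coords (vector [0, 0]) (1/2) +
     v$2 *\<^sub>R disk_coords (vector [sqrt 2, 0]) (1/2) +
     v$3 *\<^sub>R halfplane_coords (vector [0, 1]) (1/2) +
     v$4 *\<^sub>R halfplane_coords (vector [0, -1]) (1/2)"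

definition mallows_packing :: "(real^2) set set" where
  "mallows_packing = {D. \<exists>v \<in> mallows_orbit. has_circle_coords D (mallows_circle_coords v)}"

definition mallows_residual :: "(real^2) set" where
  "mallows_residual = - \<Union> mallows_packing"

section \<open>Consistency checks\<close>

lemma vector_4:
  "(vector [a, b, c, d] :: 'a::zero^4) $ 1 = a"
  "(vector [a, b, c, d] :: 'a::zero^4) $ 2 = b"
  "(vector [a, b, c, d] :: 'a::zero^4) $ 3 = c"
  "(vector [a, b, c, d] :: 'a::zero^4) $ 4 = d"
  by (simp_all add: vector_def)

text \<open>The separation as a bilinear function of circle coordinates.\<close>

definition separation_form :: "real^4 \<Rightarrow> real^4 \<Rightarrow> real" where
  "separation_form a b = (a$1 * b$4 + a$4 * b$1) / 2 - a$2 * b$2 - a$3 * b$3"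

lemma separation_form_disks:
  assumes "r1 > 0" "r2 > 0"
  shows "separation_form (disk_coords c1 r1) (disk_coords c2 r2) =
           ((dist c1 c2)\<^sup>2 - r1\<^sup>2 - r2\<^sup>2) / (2 * r1 * r2)"
proof -
  have "(dist c1 c2)\<^sup>2 = (c1$1 - c2$1)\<^sup>2 + (c1$2 - c2$2)\<^sup>2"
    by (simp add: dist_norm norm_eq_sqrt_inner inner_vec_def sum_2 power2_eq_square)
  moreover have "separation_form (disk_coords c1 r1) (disk_coords c2 r2) =
      ((c1$1 - c2$1)\<^sup>2 + (c1$2 - c2$2)\<^sup>2 - r1\<^sup>2 - r2\<^sup>2) / (2 * r1 * r2)"
    using assms
    by (simp add: separation_form_def disk_coords_def Let_def vector_4 divide_simps
        power2_eq_square) (simp add: algebra_simps)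
  ultimately show ?thesis
    by simp
qed

lemma separation_form_mallows_circle_coords:
  "separation_form (mallows_circle_coords v) (mallows_circle_coords w) = - lorentz v w"
proof -
  have "sqrt 2 * (sqrt 2 * x) = 2 * x" for x :: real
    by (simp flip: mult.assoc)
  then show ?thesis
    by (simp add: separation_form_def mallows_circle_coords_def disk_coords_def
        halfplane_coords_def Let_def vector_4 lorentz_def lorentz_matrix_def inner_vec_def
        matrix_vector_mult_def sum_4 power2_eq_square algebra_simps) (simp add: field_simps)
qed

lemma lorentz_mallows_normals: "n \<in> mallows_normals \<Longrightarrow> lorentz n n = 8"
  by (auto simp: mallows_normals_def vector_4 lorentz_def lorentz_matrix_def inner_vec_def
      matrix_vector_mult_def sum_4)

lemma lorentz_reflection_involution:
  assumes "lorentz n n \<noteq> 0"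
  shows "lorentz_reflection n (lorentz_reflection n x) = x"
proof -
  have *: "lorentz (y - c *\<^sub>R n) n = lorentz y n - c * lorentz n n" for y c
    by (simp add: lorentz_def inner_diff_left)
  have "lorentz (lorentz_reflection n x) n = - lorentz x n"
    using assms by (simp add: lorentz_reflection_def *)
  then show ?thesis
    unfolding lorentz_reflection_def[of n "lorentz_reflection n x"]
    by (simp add: lorentz_reflection_def)
qed

text \<open>The generators lie in the carrier of \<open>BijGroup UNIV\<close>, so \<open>mallows_group\<close> is
  the subgroup they generate.\<close>

lemma mallows_generators_in_carrier:
  "lorentz_reflection ` mallows_normals \<subseteq> carrier (BijGroup UNIV)"
proof -
  have "bij (lorentz_reflection n)" if "n \<in> mallows_normals" for n
    using lorentz_reflection_involution[of n] lorentz_mallows_normals[OF that]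
    by (intro o_bij[where g = "lorentz_reflection n"]) auto
  then show ?thesis
    by (auto simp: BijGroup_def Bij_def)
qed

end

theory Submission
  imports Defs "HOL-Library.Product_Plus" "HOL-Library.Sublist" "HOL-Real_Asymp.Real_Asymp"
begin

text \<open>
  A reduced word in the five reflections carries the image \<open>p\<close> of infinity, a light vector
  whose pairing with the normal of the last letter is minus the curvature of one of the
  boundary circles of a nested family of discs shrinking to the residual set. To each word
  one attaches a vector \<open>z\<close> depending only on the last three letters and on the
  length of the final alternating run, and the weight \<open>mpair p z powr (- s)\<close>.

  Upper bound, \<open>s = 31/23\<close>: the weights of the children of a word add up to at most its own
  weight, so the covers by the discs of all words of a given length have bounded
  \<open>s\<close>-dimensional size. By convexity this is tested on the vertices of the cone containing all
  possible \<open>p\<close>; long alternating runs are parabolic cusps and are treated by a midpoint estimate.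

  Lower bound, \<open>s = 73/55\<close>: among words with runs of length at most \<open>36\<close> the weights of the children
  add up to at least the weight of the parent. By the reverse Minkowski inequality this follows from
  \<open>z - (\<Sum>x. \<lambda> x powr (1 + 1/s) * mirror x (z' x))\<close> lying in the light cone for
  some \<open>\<lambda>\<close> summing to \<open>1\<close>. A cover with small \<open>s\<close>-dimensional size stops finitely many words
  per covering set, and mass remains for an infinite branch that is never stopped; its
  discs shrink to an uncovered residual point.
\<close>

text \<open>The walls form a square pyramid: \<open>N1\<close>, \<open>N2\<close>,
  \<open>N4\<close>, \<open>N5\<close> are tangent in cyclic order, \<open>opp\<close> marks the two
  disjoint diagonal pairs, and the apex \<open>N3\<close> touches the other four. Infinity is the
  tangency point of \<open>N1\<close> and \<open>N2\<close>, which fix it; so no word ends in these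
  letters, and the plane is reached from one strip through countably many words \<open>u\<close> in
  \<open>N1\<close> and \<open>N2\<close>. The obstacle is tangency. Two tangent walls generate a
  parabolic map, along which curvatures grow only linearly, so a disc can be arbitrarily large
  compared with the discs leaving a long run. The upper bound must pay for all of these exits and
  needs an estimate uniform in the run length. The lower bound may discard them: cutting the runs
  keeps curvature ratios of consecutive discs below 433, and then an area count controls how many
  discs of a given size one covering set can meet. Both exponents lie strictly inside the claimed
  interval, and as fractions with small terms they turn every comparison of powers into one between
  integers. The eight symmetries of the pyramid reduce the tables to one entry per type of letter
  triple.\<close>

datatype letter = N1 | N2 | N3 | N4 | N5

type_synonym 'a v4 = "'a \<times> 'a \<times> 'a \<times> 'a"

section \<open>The form, the walls and their reflections\<close>

text \<open>This is \<open>- lorentz\<close>, so that it extends the separation: seeds have square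
  \<open>-1\<close>, wall normals \<open>-8\<close>, light vectors \<open>0\<close>.\<close>

fun mpair :: "('a::comm_ring_1) v4 \<Rightarrow> 'a v4 \<Rightarrow> 'a" where
  "mpair (a, b, c, d) (a', b', c', d') =
     3 * (a * b' + b * a') + (a + b) * (c' + d') + (c + d) * (a' + b') + c * d' + d * c'
     - a * a' - b * b' - c * c' - d * d'"

fun kf :: "letter \<Rightarrow> ('a::comm_ring_1) v4 \<Rightarrow> 'a" where
  "kf N1 (a, b, c, d) = 8 * a"
| "kf N2 (a, b, c, d) = 8 * b"
| "kf N3 (a, b, c, d) = 4 * c"
| "kf N4 (a, b, c, d) = 8 * (b + d)"
| "kf N5 (a, b, c, d) = 8 * (a + d)"

fun nrm :: "letter \<Rightarrow> ('a::comm_ring_1) v4" where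
  "nrm N1 = (- 1, 1, 2, 2)"
| "nrm N2 = (1, - 1, 2, 2)"
| "nrm N3 = (1, 1, - 2, 0)"
| "nrm N4 = (3, 1, 2, - 2)"
| "nrm N5 = (1, 3, 2, - 2)"

fun mirror :: "letter \<Rightarrow> ('a::comm_ring_1) v4 \<Rightarrow> 'a v4" where
  "mirror N1 (a, b, c, d) = (- a, b + 2 * a, c + 4 * a, d + 4 * a)"
| "mirror N2 (a, b, c, d) = (a + 2 * b, - b, c + 4 * b, d + 4 * b)"
| "mirror N3 (a, b, c, d) = (a + c, b + c, - c, d)"
| "mirror N4 (a, b, c, d) = (let m = 2 * (b + d) in (a + 3 * m, b + m, c + 2 * m, d - 2 * m))"
| "mirror N5 (a, b, c, d) = (let m = 2 * (a + d) in (a + m, b + 3 * m, c + 2 * m, d - 2 * m))"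

text \<open>After division by 8, two distinct walls have separation 1, hence are tangent, except for
  these pairs, which have separation 3. This is the source of the factors 2 and 6 in
  \<open>kf_mirror\<close>.\<close>

fun opp :: "letter \<Rightarrow> letter \<Rightarrow> bool" where
  "opp N1 N4 = True" | "opp N4 N1 = True" | "opp N2 N5 = True" | "opp N5 N2 = True"
| "opp _ _ = False"

lemma mpair_nrm: "mpair v (nrm l) = kf l v"
  by (cases l; cases v) (auto simp: algebra_simps)

lemma mpair_comm: "mpair x y = mpair y x"
  by (cases x; cases y) (auto simp: algebra_simps)

lemma mpair_add: "mpair x (y + y') = mpair x y + mpair x y'"
  by (cases x; cases y; cases y') (auto simp: algebra_simps)

lemma mpair_add_left: "mpair (y + y') x = mpair y x + mpair y' x"
  by (cases x; cases y; cases y') (auto simp: algebra_simps)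

lemma mpair_diff: "mpair x (y - y') = mpair x y - mpair x y'"
  by (cases x; cases y; cases y') (auto simp: algebra_simps)

lemma mpair_diff_left: "mpair (y - y') x = mpair y x - mpair y' x"
  by (cases x; cases y; cases y') (auto simp: algebra_simps)

lemma mpair_scale: "mpair x (t *\<^sub>R y) = t * mpair x y" for x :: "real v4"
  by (cases x; cases y) (auto simp: algebra_simps)

lemma mpair_scale_left: "mpair (t *\<^sub>R x) y = t * mpair x y" for x :: "real v4"
  by (cases x; cases y) (auto simp: algebra_simps)

lemma kf_add: "kf l (x + y) = kf l x + kf l y"
  by (cases l; cases x; cases y) (auto simp: algebra_simps)

lemma kf_scale: "kf l (t *\<^sub>R x) = t * kf l x" for x :: "real v4"
  by (cases l; cases x) (auto simp: algebra_simps)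

lemma mirror_add: "mirror l (x + y) = mirror l x + mirror l y"
  by (cases l; cases x; cases y) (auto simp: algebra_simps Let_def)

lemma mirror_scale: "mirror l (t *\<^sub>R x) = t *\<^sub>R mirror l x" for x :: "real v4"
  by (cases l; cases x) (auto simp: algebra_simps Let_def)

lemma mirror_mirror [simp]: "mirror l (mirror l x) = x"
  by (cases l; cases x) (auto simp: algebra_simps Let_def)

lemma mpair_mirror: "mpair (mirror l x) y = mpair x (mirror l y)"
  by (cases l; cases x; cases y) (simp_all add: algebra_simps Let_def)

lemma mpair_mirror_mirror [simp]: "mpair (mirror l x) (mirror l y) = mpair x y"
  by (simp add: mpair_mirror)

lemma mirror_nrm [simp]: "mirror l (nrm l) = - nrm l"
  by (cases l) (auto simp: Let_def)

lemma kf_mirror_same [simp]: "kf l (mirror l x) = - kf l x"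
  by (cases l; cases x) (auto simp: Let_def algebra_simps)

lemma kf_mirror: "i \<noteq> x \<Longrightarrow> kf i (mirror x p) = kf i p + (if opp i x then 6 else 2) * kf x p"
  by (cases i; cases x; cases p) (simp_all add: Let_def algebra_simps)

lemma opp_sym: "opp i j \<longleftrightarrow> opp j i"
  by (cases i; cases j) auto

lemma UNIV_letter: "(UNIV :: letter set) = {N1, N2, N3, N4, N5}"
proof -
  have "l \<in> {N1, N2, N3, N4, N5}" for l by (cases l) auto
  then show ?thesis by auto
qed

instance letter :: finite
  by standard (simp add: UNIV_letter)

section \<open>Words\<close>

abbreviation infty :: "('a::comm_ring_1) v4" where "infty \<equiv> (0, 0, 1, 1)"

definition act :: "letter list \<Rightarrow> ('a::comm_ring_1) v4 \<Rightarrow> 'a v4" where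
  "act ws v = foldr mirror ws v"

abbreviation pt :: "letter list \<Rightarrow> ('a::comm_ring_1) v4" where
  "pt ws \<equiv> act ws infty"

lemma act_simps [simp]: "act [] v = v" "act (x # ws) v = mirror x (act ws v)"
  by (simp_all add: act_def)

lemma act_append: "act (us @ ws) v = act us (act ws v)"
  by (simp add: act_def)

lemma act_add: "act ws (x + y) = act ws x + act ws y"
  by (induction ws) (simp_all add: mirror_add)

lemma act_scale: "act ws (t *\<^sub>R x) = t *\<^sub>R act ws x" for x :: "real v4"
  by (induction ws) (simp_all add: mirror_scale)

lemma mpair_act_act [simp]: "mpair (act ws x) (act ws y) = mpair x y"
  by (induction ws) simp_all

lemma mpair_act: "mpair (act ws x) y = mpair x (act (rev ws) y)"
  by (induction ws arbitrary: y) (simp_all add: mpair_mirror act_append)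

text \<open>The head is the outermost reflection. The innermost one is not \<open>N1\<close> or
  \<open>N2\<close>, since these fix \<open>infty\<close>.\<close>

fun valid :: "letter list \<Rightarrow> bool" where
  "valid [] = True"
| "valid [x] = (x \<notin> {N1, N2})"
| "valid (x # y # ws) = (x \<noteq> y \<and> valid (y # ws))"

lemma valid_tl: "valid (x # ws) \<Longrightarrow> valid ws"
  by (cases ws) auto

text \<open>Two letters always alternate, so 2 is the least value; it also serves as default for
  shorter words.\<close>

fun run :: "letter list \<Rightarrow> nat" where
  "run (x # y # z # ws) = (if x = z then Suc (run (y # z # ws)) else 2)"
| "run _ = 2"

lemma run_ge: "run ws \<ge> 2"
  by (induction ws rule: run.induct) auto

lemma run_Cons: "run (x # c # d # us) = (if x = d then Suc (run (c # d # us)) else 2)"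
  by simp

text \<open>The curvature of the \<open>c\<close>-circle is the only negative one, and it decreases by at least
  \<open>4\<close> with each letter.\<close>

lemma pt_kf:
  assumes "valid (c # us)"
  shows "(\<forall>x. x \<noteq> c \<longrightarrow> kf x (pt (c # us)) + kf c (pt (c # us)) \<ge> (4 :: real)) \<and>
         kf c (pt (c # us) :: real v4) \<le> - 4 * real (length (c # us))"
  using assms
proof (induction us arbitrary: c)
  case Nil
  have "\<forall>x. x \<noteq> c \<longrightarrow> kf x (pt [c]) + kf c (pt [c]) \<ge> (4 :: real)"
  proof (intro allI impI)
    fix x assume "x \<noteq> c" with Nil show "kf x (pt [c]) + kf c (pt [c]) \<ge> (4 :: real)"
      by (cases c; cases x) (simp_all add: Let_def)
  qed
  moreover have "kf c (pt [c] :: real v4) \<le> - 4"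
    using Nil by (cases c) (simp_all add: Let_def)
  ultimately show ?case by simp
next
  case (Cons d us)
  let ?p = "pt (d # us) :: real v4"
  have v: "valid (d # us)" and cd: "c \<noteq> d" using Cons.prems by auto
  note IH = Cons.IH[OF v]
  have K: "kf d ?p \<le> - 4 * real (length (d # us))" using IH by blast
  have sum: "kf x ?p + kf d ?p \<ge> 4" if "x \<noteq> d" for x using IH that by blast
  have pos: "kf x ?p \<ge> 4 + 4 * real (length (d # us))" if "x \<noteq> d" for x
    using sum[OF that] K by linarith
  have posc: "kf c ?p \<ge> 4 + 4 * real (length (d # us))" using pos cd by auto
  have "kf x (mirror c ?p) + kf c (mirror c ?p) \<ge> 4" if "x \<noteq> c" for x
  proof -
    have "kf x (mirror c ?p) \<ge> kf x ?p + 2 * kf c ?p"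
      using posc by (simp add: kf_mirror[OF that])
    moreover have "kf x ?p + kf c ?p \<ge> 4"
    proof (cases "x = d")
      case True then show ?thesis using sum[OF cd] by simp
    next
      case False then show ?thesis using pos[OF False] posc by linarith
    qed
    ultimately show ?thesis by simp
  qed
  moreover have "kf c (mirror c ?p) \<le> - 4 * real (length (c # d # us))"
    using posc by simp
  ultimately show ?case by simp
qed

lemma pt_light [simp]: "mpair (pt ws) (pt ws) = 0"
  by simp

section \<open>Circle coordinates and the light vector of a point\<close>

definition kap :: "real v4 \<Rightarrow> real" where "kap v = mpair infty v"

lemma kap_eq: "kap (a, b, c, d) = 2 * (a + b)"
  by (simp add: kap_def algebra_simps)

text \<open>The light vector of the point \<open>X\<close> in the basis of seeds, scaled to pair to
  2 with \<open>infty\<close>. Its pairing with \<open>v\<close> is the equation of the circle of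
  \<open>v\<close>, negative inside.\<close>

definition lift :: "real^2 \<Rightarrow> real v4" where
  "lift X = (let n = (X$1)\<^sup>2 + (X$2)\<^sup>2 - sqrt 2 * X$1 + 1/4
             in (1 - sqrt 2 / 2 * X$1, sqrt 2 / 2 * X$1, n + X$2, n - X$2))"

definition ccx :: "real v4 \<Rightarrow> real" where "ccx v = (case v of (a, b, c, d) \<Rightarrow> 2 * sqrt 2 * b)"
definition ccy :: "real v4 \<Rightarrow> real" where "ccy v = (case v of (a, b, c, d) \<Rightarrow> c - d)"
definition ccm :: "real v4 \<Rightarrow> real" where "ccm v = (case v of (a, b, c, d) \<Rightarrow> 7/2 * b - a / 2 + c + d)"

lemma sqrt2_sq: "sqrt 2 * (sqrt 2 * x) = 2 * x" for x :: real
  by (simp flip: mult.assoc)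

lemma mpair_lift:
  "mpair (lift X) v = kap v * ((X$1)\<^sup>2 + (X$2)\<^sup>2) - 2 * (ccx v * X$1 + ccy v * X$2) + ccm v"
  by (cases v) (simp add: lift_def kap_eq ccx_def ccy_def ccm_def Let_def power2_eq_square
      field_simps sqrt2_sq)

lemma mpair_circle: "mpair v v = kap v * ccm v - (ccx v)\<^sup>2 - (ccy v)\<^sup>2"
  by (cases v) (simp add: kap_eq ccx_def ccy_def ccm_def power2_eq_square algebra_simps sqrt2_sq)

lemma mpair_circle2:
  "mpair v w = (kap v * ccm w + kap w * ccm v) / 2 - ccx v * ccx w - ccy v * ccy w"
  by (cases v; cases w) (simp add: kap_eq ccx_def ccy_def ccm_def field_simps sqrt2_sq)

lemma kap_mpair_lift:
  "kap v * mpair (lift X) v = (kap v * X$1 - ccx v)\<^sup>2 + (kap v * X$2 - ccy v)\<^sup>2 + mpair v v"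
  unfolding mpair_lift mpair_circle by (simp add: power2_eq_square algebra_simps)

lemma lift_light [simp]: "mpair (lift X) (lift X) = 0"
  by (simp add: lift_def Let_def power2_eq_square algebra_simps sqrt2_sq)

lemma lift_infty [simp]: "mpair infty (lift X) = 2"
  by (simp add: lift_def Let_def)

text \<open>Future-directed causal vectors pair nonnegatively.\<close>

lemma mpair_causal_nonneg:
  assumes x: "kap x > 0" "mpair x x \<ge> 0" and y: "kap y > 0" "mpair y y \<ge> 0"
  shows "mpair x y \<ge> 0"
proof -
  have mx: "kap x * ccm x \<ge> (ccx x)\<^sup>2 + (ccy x)\<^sup>2" using x(2) by (simp add: mpair_circle)
  have my: "kap y * ccm y \<ge> (ccx y)\<^sup>2 + (ccy y)\<^sup>2" using y(2) by (simp add: mpair_circle)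
  have "kap x * kap y * (2 * mpair x y) =
      (kap x)\<^sup>2 * (kap y * ccm y) + (kap y)\<^sup>2 * (kap x * ccm x)
      - 2 * kap x * kap y * (ccx x * ccx y + ccy x * ccy y)"
    by (simp add: mpair_circle2 power2_eq_square field_simps)
  also have "\<dots> \<ge> (kap x)\<^sup>2 * ((ccx y)\<^sup>2 + (ccy y)\<^sup>2) + (kap y)\<^sup>2 * ((ccx x)\<^sup>2 + (ccy x)\<^sup>2)
      - 2 * kap x * kap y * (ccx x * ccx y + ccy x * ccy y)"
    using mult_left_mono[OF my, of "(kap x)\<^sup>2"] mult_left_mono[OF mx, of "(kap y)\<^sup>2"] by simp
  also have "(kap x)\<^sup>2 * ((ccx y)\<^sup>2 + (ccy y)\<^sup>2) + (kap y)\<^sup>2 * ((ccx x)\<^sup>2 + (ccy x)\<^sup>2)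
      - 2 * kap x * kap y * (ccx x * ccx y + ccy x * ccy y) =
      (kap x * ccx y - kap y * ccx x)\<^sup>2 + (kap x * ccy y - kap y * ccy x)\<^sup>2"
    by (simp add: power2_eq_square algebra_simps)
  finally have "kap x * kap y * (2 * mpair x y) \<ge> 0"
    by (smt (verit) zero_le_power2)
  moreover have "kap x * kap y > 0" using x(1) y(1) by simp
  ultimately show ?thesis
    by (simp only: zero_le_mult_iff) linarith
qed

section \<open>Covering\<close>

abbreviation "s1 \<equiv> (1, 0, 0, 0) :: real v4"
abbreviation "s2 \<equiv> (0, 1, 0, 0) :: real v4"
abbreviation "s3 \<equiv> (0, 0, 1, 0) :: real v4"
abbreviation "s4 \<equiv> (0, 0, 0, 1) :: real v4"
abbreviation "s5 \<equiv> (1, 1, 0, - 1) :: real v4"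

text \<open>The square of a vector is the sum of its coordinates times its pairings with the basis
  seeds. For a light vector with nonnegative coordinates and pairings each product vanishes, and
  each of the three possible supports then contradicts the strictness assumptions.\<close>

lemma covering_aux:
  fixes a b c d :: real
  assumes light: "mpair (a, b, c, d) (a, b, c, d) = 0"
    and y: "- a + 3 * b + c + d \<ge> 0" "3 * a - b + c + d \<ge> 0"
      "a + b - c + d \<ge> 0" "a + b + c - d \<ge> 0"
    and nn: "a \<ge> 0" "b \<ge> 0" "c \<ge> 0" "d \<ge> 0"
    and one: "a > 0 \<or> b > 0" "a > 0 \<or> c > 0" "b > 0 \<or> c > 0"
      "a > 0 \<or> a + d > 0" "b > 0 \<or> b + d > 0"
  shows False
proof -
  have sum: "a * (- a + 3 * b + c + d) + b * (3 * a - b + c + d) + c * (a + b - c + d)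
      + d * (a + b + c - d) = 0"
    using light by (simp add: algebra_simps)
  have n: "a * (- a + 3 * b + c + d) \<ge> 0" "b * (3 * a - b + c + d) \<ge> 0"
      "c * (a + b - c + d) \<ge> 0" "d * (a + b + c - d) \<ge> 0"
    using y nn by (simp_all add: mult_nonneg_nonneg)
  have z: "a * (- a + 3 * b + c + d) = 0" "b * (3 * a - b + c + d) = 0"
      "c * (a + b - c + d) = 0" "d * (a + b + c - d) = 0"
    using sum n by linarith+
  consider "a > 0" "b > 0" | "a = 0" "b > 0" "c > 0" | "b = 0" "a > 0" "c > 0"
    using nn one by linarith
  then show False
  proof cases
    case 1
    then have "- a + 3 * b + c + d = 0" "3 * a - b + c + d = 0" using z by auto
    then show False using 1 nn by linarith
  next
    case 2
    then have "- b + c + d = 0" "b - c + d = 0" using z by auto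
    then show False using 2 one by linarith
  next
    case 3
    then have "- a + c + d = 0" "a - c + d = 0" using z by auto
    then show False using 3 one by linarith
  qed
qed

text \<open>Geometrically: a point outside the circles of all walls is inside an open seed disc,
  unless two walls meet there. This is why residual points can be coded by words.\<close>

lemma covering:
  fixes v :: "real v4"
  assumes light: "mpair v v = 0"
    and s: "mpair v s1 \<ge> 0" "mpair v s2 \<ge> 0" "mpair v s3 \<ge> 0" "mpair v s4 \<ge> 0" "mpair v s5 \<ge> 0"
    and nn: "\<And>l. kf l v \<ge> 0"
    and one: "\<And>l l'. l \<noteq> l' \<Longrightarrow> kf l v > 0 \<or> kf l' v > 0"
  shows False
proof -
  obtain a b c d where v: "v = (a, b, c, d)" by (cases v)
  have k: "a \<ge> 0" "b \<ge> 0" "c \<ge> 0" "b + d \<ge> 0" "a + d \<ge> 0"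
    using nn[of N1] nn[of N2] nn[of N3] nn[of N4] nn[of N5] by (auto simp: v)
  have y: "- a + 3 * b + c + d \<ge> 0" "3 * a - b + c + d \<ge> 0"
      "a + b - c + d \<ge> 0" "a + b + c - d \<ge> 0" "a + b + c + 3 * d \<ge> 0"
    using s by (auto simp: v algebra_simps)
  have pos8: "0 < 8 * x + 8 * y \<longleftrightarrow> 0 < x + y" for x y :: real by linarith
  have two: "a > 0 \<or> b > 0" "a > 0 \<or> c > 0" "b > 0 \<or> c > 0" "a > 0 \<or> a + d > 0"
      "b > 0 \<or> b + d > 0" "b + d > 0 \<or> a + d > 0" "b + d > 0 \<or> c > 0" "a + d > 0 \<or> c > 0"
    using one[of N1 N2, simplified v] one[of N1 N3, simplified v] one[of N2 N3, simplified v]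
      one[of N1 N5, simplified v] one[of N2 N4, simplified v] one[of N4 N5, simplified v]
      one[of N4 N3, simplified v] one[of N5 N3, simplified v] by (simp_all add: pos8)
  show False
  proof (cases "d \<ge> 0")
    case True
    then show False
      by (intro covering_aux[of a b c d]) (use light k y two in \<open>simp_all add: v\<close>)
  next
    \<comment> \<open>Since \<open>s4 = s1 + s2 - s5\<close>, these are the coordinates of
      \<open>v\<close> in the basis \<open>s1, s2, s3, s5\<close>, which has the same Gram
      matrix.\<close>
    case False
    have l: "mpair (a + d, b + d, c, - d) (a + d, b + d, c, - d) = 0"
      using light by (simp add: v algebra_simps)
    show False
    proof (rule covering_aux[OF l])
      show "- (a + d) + 3 * (b + d) + c + - d \<ge> 0" "3 * (a + d) - (b + d) + c + - d \<ge> 0"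
        "a + d + (b + d) - c + - d \<ge> 0" "a + d + (b + d) + c - - d \<ge> 0"
        using y by simp_all
      show "a + d \<ge> 0" "b + d \<ge> 0" "c \<ge> 0" "- d \<ge> 0"
        using k False by simp_all
      show "a + d > 0 \<or> b + d > 0" "a + d > 0 \<or> c > 0" "b + d > 0 \<or> c > 0"
        "a + d > 0 \<or> a + d + - d > 0" "b + d > 0 \<or> b + d + - d > 0"
        using two by auto
    qed
  qed
qed

section \<open>Certificate tables\<close>

datatype pairing = Fromapex | Toapex | Adjacent | Opposite

text \<open>Indexed by the position of the two outer letters and by the third letter, after a
  symmetry has brought the outer letters to a standard place. A third letter that would continue a
  tangent run is left to \<open>upper_run\<close>.\<close>

fun upper_start :: "pairing \<Rightarrow> letter \<Rightarrow> int v4" where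
  "upper_start Fromapex N2 = (- 7053, - 8253, 15786, - 3803)"
| "upper_start Fromapex N4 = (- 3860, - 3338, 11847, 522)"
| "upper_start Fromapex N5 = (- 7053, - 10856, 15786, - 1200)"
| "upper_start Toapex N2 = (7371, - 5308, - 12385, - 14019)"
| "upper_start Toapex N4 = (7353, - 5420, - 12717, - 12773)"
| "upper_start Toapex N5 = (7371, - 6648, - 12385, - 12679)"
| "upper_start Adjacent N3 = (7602, - 5283, - 14075, - 14160)"
| "upper_start Adjacent N4 = (10916, - 11109, - 33227, - 28748)"
| "upper_start Adjacent N5 = (10938, - 10647, - 34616, - 31061)"
| "upper_start Opposite N1 = (9536, - 10147, - 25850, - 19683)"
| "upper_start Opposite N2 = (10588, - 12124, - 30831, - 23914)"
| "upper_start Opposite N3 = (6060, - 1775, - 8845, - 7835)"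
| "upper_start Opposite N5 = (10588, - 13326, - 30831, - 22712)"
| "upper_start _ _ = (0, 0, 0, 0)"

text \<open>Entry \<open>n\<close> belongs to run length \<open>n + 3\<close>; the last one serves
  all lengths from 8 on and has the special shape required in \<open>checkLR\<close>.\<close>

fun upper_run :: "pairing \<Rightarrow> (int v4) list" where
  "upper_run Fromapex =
    [(- 4361, - 3373, 12263, 988), (- 4893, - 409, 12488, 4484), (- 6721, - 6355, 15264, 366),
     (- 7624, - 6753, 16534, 871), (- 9844, - 20118, 20301, - 10274),
     (- 12176, - 35718, 24352, - 23542)]"
| "upper_run Toapex =
    [(5793, 581, - 8134, - 5212), (6814, - 2606, - 11141, - 9420), (7141, - 861, - 12388, - 8002),
     (8691, - 9629, - 16204, - 18320), (9957, - 16311, - 19290, - 26268),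
     (12176, - 35718, - 24352, - 47894)]"
| "upper_run Adjacent =
    [(8018, - 6249, - 14164, - 13430), (9070, - 7860, - 18815, - 18217),
     (10108, - 9274, - 25569, - 25105), (11281, - 10746, - 36656, - 36334),
     (12722, - 12458, - 55241, - 55071), (14562, - 14562, - 85436, - 85436)]"
| "upper_run _ = []"

text \<open>Beside each vector stand the codes of the multipliers \<lambda> of its children, in the
  order of the local letters; 0 fills the place of a letter that is no child.\<close>

fun lower_start :: "pairing \<Rightarrow> letter \<Rightarrow> int v4 \<times> int list" where
  "lower_start Fromapex N2 = ((4087, 12844, 13738, 11854), [44, 32, 0, 49, 55])"
| "lower_start Fromapex N4 = ((3561, 14672, 13861, 11111), [45, 59, 0, 48, 59])"
| "lower_start Fromapex N5 = ((4087, 15941, 13738, 8757), [44, 55, 0, 49, 32])"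
| "lower_start Toapex N2 = ((8325, 12863, 3785, 8901), [0, 33, 47, 68, 54])"
| "lower_start Toapex N4 = ((8138, 14396, 4972, 6258), [0, 62, 45, 68, 62])"
| "lower_start Toapex N5 = ((8325, 17226, 3785, 4538), [0, 54, 47, 68, 33])"
| "lower_start Adjacent N3 = ((8708, 4524, 17696, 18003), [0, 44, 38, 68, 50])"
| "lower_start Adjacent N4 = ((8480, 5762, 16670, 15105), [0, 42, 37, 70, 55])"
| "lower_start Adjacent N5 = ((8874, 3602, 20702, 19677), [0, 46, 35, 70, 51])"
| "lower_start Opposite N1 = ((8673, 13932, 10514, 5260), [0, 35, 42, 0, 35])"
| "lower_start Opposite N2 = ((8418, 10385, 10301, 5973), [0, 36, 39, 70, 63])"
| "lower_start Opposite N3 = ((8425, 12229, 9232, 3804), [0, 33, 40, 72, 33])"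
| "lower_start Opposite N5 = ((8418, 14391, 10301, 1967), [0, 63, 39, 70, 36])"
| "lower_start _ _ = ((0, 0, 0, 0), [])"

text \<open>The 34 entries belong to run lengths 3 to 36.\<close>

fun lower_run :: "pairing \<Rightarrow> (int v4 \<times> int list) list" where
  "lower_run Fromapex =
    [((593, 20389, 15129, 19796), [18, 54, 0, 72, 54]),
     ((- 2037, 30104, 16820, 32141), [21, 49, 0, 68, 49]),
     ((- 3094, 38201, 17525, 41295), [22, 48, 0, 64, 48]),
     ((- 4877, 47752, 19454, 52629), [24, 74, 0, 88, 74]),
     ((- 6102, 59724, 20826, 65826), [25, 71, 0, 84, 71]),
     ((- 6186, 63993, 20842, 70179), [25, 71, 0, 84, 71]),
     ((- 7230, 74713, 22245, 81942), [26, 67, 0, 84, 67]),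
     ((- 7751, 83095, 22953, 90846), [26, 67, 0, 84, 67]),
     ((- 8832, 93730, 24612, 102562), [27, 64, 0, 80, 64]),
     ((- 9239, 99998, 25259, 109238), [27, 64, 0, 80, 64]),
     ((- 9897, 107389, 26388, 117286), [27, 65, 0, 105, 65]),
     ((- 10938, 115493, 28167, 126432), [28, 90, 0, 104, 90]),
     ((- 11124, 116771, 28578, 127895), [28, 90, 0, 104, 90]),
     ((- 11320, 117894, 29015, 129214), [28, 90, 0, 104, 90]),
     ((- 11554, 118808, 29546, 130362), [28, 90, 0, 104, 90]),
     ((- 11795, 119420, 30099, 131215), [28, 90, 0, 104, 90]),
     ((- 12068, 119485, 30746, 131554), [28, 90, 0, 104, 90]),
     ((- 12336, 119044, 31397, 131381), [28, 90, 0, 104, 90]),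
     ((- 12614, 117559, 32112, 130173), [28, 90, 0, 104, 90]),
     ((- 12858, 115330, 32783, 128188), [28, 90, 0, 104, 90]),
     ((- 13047, 111441, 33416, 124488), [28, 90, 0, 104, 90]),
     ((- 13142, 106627, 33898, 119769), [28, 90, 0, 104, 90]),
     ((- 13040, 99616, 34100, 112656), [28, 90, 0, 104, 90]),
     ((- 12722, 91802, 33932, 104525), [28, 90, 0, 104, 90]),
     ((- 11915, 81911, 32963, 93826), [27, 65, 0, 104, 65]),
     ((- 12011, 76234, 33713, 88244), [27, 64, 0, 80, 64]),
     ((- 11529, 67598, 33575, 79127), [27, 64, 0, 80, 64]),
     ((- 10643, 57728, 32863, 68371), [26, 68, 0, 80, 68]),
     ((- 9632, 49376, 32206, 59009), [25, 71, 0, 84, 71]),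
     ((- 8002, 38295, 30805, 46297), [24, 74, 0, 88, 74]),
     ((- 6787, 31241, 30924, 38028), [23, 77, 0, 92, 77]),
     ((- 3890, 21494, 29246, 25383), [21, 50, 0, 64, 50]),
     ((1419, 15952, 26295, 14533), [47, 59, 0, 72, 59]),
     ((15865, 14702, 17289, - 1163), [0, 42, 0, 56, 42])]"
| "lower_run Toapex =
    [((8448, 22063, - 1620, 13615), [0, 54, 19, 64, 54]),
     ((8759, 29110, - 4470, 20351), [0, 51, 21, 88, 51]),
     ((9509, 39364, - 8259, 29855), [0, 78, 23, 88, 78]),
     ((9973, 50049, - 10401, 40076), [0, 75, 24, 84, 75]),
     ((10381, 56129, - 11844, 45748), [0, 71, 25, 84, 71]),
     ((11095, 68235, - 14165, 57139), [0, 68, 26, 80, 68]),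
     ((11225, 74555, - 14657, 63330), [0, 68, 26, 80, 68]),
     ((11626, 83102, - 15810, 71476), [0, 68, 26, 80, 68]),
     ((12377, 93658, - 17794, 81281), [0, 65, 27, 105, 65]),
     ((12720, 99983, - 18637, 87263), [0, 65, 27, 104, 65]),
     ((13268, 107325, - 19959, 94057), [0, 65, 27, 104, 65]),
     ((14147, 115475, - 22002, 101328), [0, 90, 28, 104, 90]),
     ((14339, 116710, - 22348, 102372), [0, 90, 28, 104, 90]),
     ((14573, 117854, - 22768, 103281), [0, 90, 28, 104, 90]),
     ((14821, 118777, - 23206, 103956), [0, 90, 28, 104, 90]),
     ((15116, 119341, - 23718, 104224), [0, 90, 28, 104, 90]),
     ((15420, 119507, - 24234, 104087), [0, 90, 28, 104, 90]),
     ((15766, 118897, - 24800, 103131), [0, 90, 28, 104, 90]),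
     ((16104, 117664, - 25331, 101559), [0, 90, 28, 104, 90]),
     ((16455, 115086, - 25832, 98630), [0, 90, 28, 104, 90]),
     ((16762, 111656, - 26214, 94894), [0, 90, 28, 104, 90]),
     ((17002, 106264, - 26373, 89262), [0, 90, 28, 104, 90]),
     ((17121, 99946, - 26241, 82824), [0, 90, 28, 104, 90]),
     ((16993, 91347, - 25474, 74354), [0, 90, 28, 104, 90]),
     ((16592, 82281, - 24079, 65690), [0, 65, 27, 104, 65]),
     ((16854, 75767, - 23972, 58913), [0, 65, 27, 105, 65]),
     ((16999, 67872, - 23500, 50874), [0, 64, 27, 80, 64]),
     ((16350, 57545, - 21090, 41195), [0, 68, 26, 80, 68]),
     ((16509, 48866, - 20116, 32357), [0, 68, 26, 80, 68]),
     ((16535, 41414, - 18388, 24880), [0, 71, 25, 84, 71]),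
     ((15554, 30130, - 13750, 14576), [0, 78, 23, 88, 78]),
     ((15174, 22544, - 8867, 7370), [0, 50, 21, 64, 50]),
     ((13224, 13756, 2689, 532), [0, 59, 47, 72, 59]),
     ((12588, 15170, 23947, 2582), [0, 42, 0, 56, 42])]"
| "lower_run Adjacent =
    [((9286, 466, 38153, 37755), [0, 18, 32, 67, 77]),
     ((10237, - 2610, 62626, 62569), [0, 21, 58, 94, 69]),
     ((11125, - 4678, 86291, 86185), [0, 23, 53, 90, 65]),
     ((11699, - 5888, 106912, 106824), [0, 24, 51, 87, 93]),
     ((12266, - 6936, 127817, 127631), [0, 25, 48, 86, 90]),
     ((12519, - 7458, 146713, 146567), [0, 25, 48, 86, 90]),
     ((13323, - 8678, 172608, 172523), [0, 26, 76, 83, 85]),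
     ((13775, - 9337, 193105, 193013), [0, 26, 76, 83, 85]),
     ((14722, - 10581, 218796, 218695), [0, 27, 71, 80, 82]),
     ((15125, - 11074, 233987, 233904), [0, 27, 71, 80, 82]),
     ((15789, - 11861, 251779, 251721), [0, 27, 71, 80, 82]),
     ((16848, - 13086, 271493, 271468), [0, 28, 66, 107, 109]),
     ((17081, - 13297, 274526, 274557), [0, 28, 67, 105, 107]),
     ((17351, - 13539, 277320, 277347), [0, 28, 67, 105, 107]),
     ((17657, - 13809, 279626, 279648), [0, 28, 67, 105, 107]),
     ((17999, - 14107, 281170, 281186), [0, 28, 67, 105, 107]),
     ((18375, - 14427, 281618, 281625), [0, 28, 67, 105, 107]),
     ((18779, - 14760, 280569, 280565), [0, 28, 67, 105, 107]),
     ((19199, - 15091, 277560, 277544), [0, 28, 67, 105, 107]),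
     ((19618, - 15396, 272087, 272054), [0, 28, 67, 105, 107]),
     ((20003, - 15640, 263631, 263577), [0, 28, 67, 105, 107]),
     ((20311, - 15767, 251721, 251641), [0, 28, 67, 105, 107]),
     ((20471, - 15700, 236036, 235922), [0, 28, 67, 105, 107]),
     ((20387, - 15329, 216563, 216406), [0, 28, 66, 107, 109]),
     ((19914, - 14492, 193816, 193682), [0, 27, 71, 81, 81]),
     ((20374, - 14598, 179366, 179237), [0, 27, 71, 81, 81]),
     ((20516, - 14264, 159345, 159222), [0, 27, 71, 81, 81]),
     ((20066, - 13173, 134191, 134077), [0, 26, 76, 84, 84]),
     ((20220, - 12547, 112072, 111936), [0, 26, 76, 84, 84]),
     ((19319, - 10524, 83862, 83695), [0, 25, 48, 87, 89]),
     ((18020, - 7615, 56993, 56870), [0, 23, 53, 93, 95]),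
     ((16827, - 3930, 34183, 34039), [0, 20, 60, 68, 68]),
     ((15755, 1662, 14577, 14399), [0, 47, 35, 76, 76]),
     ((12630, 16717, 273, 667), [0, 0, 19, 58, 58])]"
| "lower_run _ = []"

text \<open>An upper bound for \<open>16384 * (k / 32) powr (31 / 23)\<close> and its increment to
  the next node. The balanced conditional keeps lookups short under symbolic evaluation.\<close>

definition pow_table :: "int \<Rightarrow> int \<times> int" where
  "pow_table k = (
    if k < 16 then (if k < 8 then (if k < 4 then (if k < 2 then (if k < 1 then (0, 154) else (154, 237))
       else if k < 3 then (391, 284) else (675, 319))
      else if k < 6 then (if k < 5 then (994, 349) else (1343, 374))
       else if k < 7 then (1717, 396) else (2113, 416))
     else if k < 12 then (if k < 10 then (if k < 9 then (2529, 436) else (2965, 452))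
       else if k < 11 then (3417, 468) else (3885, 484))
      else if k < 14 then (if k < 13 then (4369, 497) else (4866, 511))
       else if k < 15 then (5377, 524) else (5901, 537))
    else if k < 24 then (if k < 20 then (if k < 18 then (if k < 17 then (6438, 548) else (6986, 559))
       else if k < 19 then (7545, 570) else (8115, 581))
      else if k < 22 then (if k < 21 then (8696, 591) else (9287, 601))
       else if k < 23 then (9888, 611) else (10499, 619))
     else if k < 28 then (if k < 26 then (if k < 25 then (11118, 629) else (11747, 638))
       else if k < 27 then (12385, 646) else (13031, 655))
      else if k < 30 then (if k < 29 then (13686, 663) else (14349, 671))
       else if k < 31 then ((15020, 678))
        else if k < 32 then (15698, 686) else (16384, 0))"

text \<open>Code \<open>16 * j + i\<close> stands for \<lambda> =
  \<open>(1 + i / 16) / 2 ^ j\<close>, scaled by \<open>2 ^ 16\<close>, beside an upper bound for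
  \<open>\<lambda> powr (128 / 73)\<close>, scaled by \<open>2 ^ 20\<close>. Every argument lands on
  a sound pair, so soundness does not depend on the code that is looked up.\<close>

definition weight :: "int \<Rightarrow> int \<times> int" where
  "weight n = (
    if n < 62 then (if n < 39 then (if n < 26 then (if n < 22 then (if n < 20 then (if n < 19 then (36864, 382350) else (38912, 420371))
        else if n < 21 then (40960, 459930) else (43008, 501012))
       else if n < 24 then (if n < 23 then (45056, 543589) else (47104, 587656))
        else if n < 25 then (49152, 633185) else (51200, 680171))
      else if n < 33 then (if n < 28 then (if n < 27 then (53248, 728590) else (55296, 778437))
        else if n < 32 then (57344, 829694) else (16384, 92244))
       else if n < 36 then (if n < 35 then (17408, 102590) else (19456, 124681))
        else if n < 37 then ((20480, 136414))
         else if n < 38 then (21504, 148599) else (22528, 161227))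
     else if n < 50 then (if n < 45 then (if n < 42 then (if n < 40 then (23552, 174297) else (24576, 187801))
        else if n < 44 then (26624, 216098) else (28672, 246085))
       else if n < 47 then (if n < 46 then (29696, 261701) else (30720, 277730))
        else if n < 48 then ((31744, 294166))
         else if n < 49 then (8192, 27360) else (8704, 30428))
      else if n < 55 then (if n < 53 then (if n < 51 then (9216, 33636) else (9728, 36980))
        else if n < 54 then (10752, 44074) else (11264, 47820))
       else if n < 58 then (if n < 56 then (11776, 51696) else (12288, 55702))
        else if n < 59 then ((13312, 64094))
         else if n < 60 then (13824, 68479) else (14336, 72988))
    else if n < 81 then (if n < 70 then (if n < 66 then (if n < 64 then (if n < 63 then (15360, 82374) else (15872, 87249))
        else if n < 65 then (4096, 8115) else (4352, 9025))
       else if n < 68 then (if n < 67 then (4608, 9977) else (4864, 10969))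
        else if n < 69 then (5120, 12001) else (5376, 13073))
      else if n < 75 then (if n < 72 then (if n < 71 then (5632, 14184) else (5888, 15333))
        else if n < 74 then (6144, 16521) else (6656, 19011))
       else if n < 77 then (if n < 76 then (6912, 20311) else (7168, 21649))
        else if n < 78 then ((7424, 23022))
         else if n < 80 then (7680, 24432) else (2048, 2407))
     else if n < 90 then (if n < 85 then (if n < 83 then (if n < 82 then (2176, 2677) else (2304, 2959))
        else if n < 84 then (2432, 3254) else (2560, 3560))
       else if n < 87 then (if n < 86 then (2688, 3878) else (2816, 4207))
        else if n < 88 then ((2944, 4548))
         else if n < 89 then (3072, 4901) else (3200, 5264))
      else if n < 95 then (if n < 93 then (if n < 92 then (3328, 5639) else (3584, 6421))
        else if n < 94 then (3712, 6829) else (3840, 7247))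
       else if n < 105 then (if n < 104 then (3968, 7676) else (1536, 1454))
        else if n < 107 then ((1600, 1562))
         else if n < 109 then (1728, 1787) else (1856, 2026))"

section \<open>Symmetries of the pyramid\<close>

fun kind :: "letter \<Rightarrow> letter \<Rightarrow> pairing" where
  "kind c d = (if c = N3 then Fromapex else if d = N3 then Toapex
     else if opp c d then Opposite else Adjacent)"

fun prev :: "letter \<Rightarrow> letter" where
  "prev N1 = N5" | "prev N5 = N4" | "prev N4 = N2" | "prev N2 = N1" | "prev N3 = N3"

fun unturn :: "letter \<Rightarrow> letter \<Rightarrow> letter" where
  "unturn N1 l = l" | "unturn N2 l = prev l" | "unturn N4 l = prev (prev l)"
| "unturn N5 l = prev (prev (prev l))" | "unturn N3 l = l"

fun swap25 :: "letter \<Rightarrow> letter" where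
  "swap25 N2 = N5" | "swap25 N5 = N2" | "swap25 l = l"

text \<open>The letter that is rotated to \<open>N1\<close>. Rotations fix the apex, so if the first
  letter is \<open>N3\<close> the second one is used.\<close>

definition base :: "letter \<Rightarrow> letter \<Rightarrow> letter" where "base c d = (if c = N3 then d else c)"

definition flip :: "letter \<Rightarrow> letter \<Rightarrow> bool" where "flip c d = (unturn (base c d) d = N5)"

definition local :: "letter \<Rightarrow> letter \<Rightarrow> letter \<Rightarrow> letter" where
  "local c d l = (if flip c d then swap25 (unturn (base c d) l) else unturn (base c d) l)"

text \<open>\<open>turn\<close> permutes the normals along the cycle \<open>N1\<close>,
  \<open>N2\<close>, \<open>N4\<close>, \<open>N5\<close> and fixes that of \<open>N3\<close>;
  \<open>swap\<close> below exchanges those of \<open>N2\<close> and \<open>N5\<close> and fixes the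
  rest. Together they give the eight symmetries.\<close>

fun turn :: "int v4 \<Rightarrow> int v4" where "turn (a, b, c, d) = (a + d, a, c, b - a)"

fun turnby :: "letter \<Rightarrow> int v4 \<Rightarrow> int v4" where
  "turnby N1 z = z" | "turnby N2 z = turn z" | "turnby N4 z = turn (turn z)"
| "turnby N5 z = turn (turn (turn z))" | "turnby N3 z = z"

fun swap :: "int v4 \<Rightarrow> int v4" where "swap (a, b, c, d) = (a, a + d, c, b - a)"

text \<open>All checks are run on the oriented vectors of every letter triple, so the symmetries
  compress the data without entering the soundness argument.\<close>

definition orient :: "letter \<Rightarrow> letter \<Rightarrow> int v4 \<Rightarrow> int v4" where
  "orient c d z = turnby (base c d) (if flip c d then swap z else z)"

text \<open>The chord of the table above \<open>16384 * (b / a) powr (31 / 23)\<close>, for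
  \<open>0 < b\<close> and \<open>b <= a\<close>; the final \<open>1\<close> absorbs the integer
  division.\<close>

definition powbound :: "int \<Rightarrow> int \<Rightarrow> int" where
  "powbound b a = (let k = 32 * b div a; (t, s) = pow_table k in t + s * (32 * b mod a) div a + 1)"

section \<open>Checks of the upper certificate\<close>

definition letters :: "letter list" where "letters = [N1, N2, N3, N4, N5]"

lemma set_letters [simp]: "set letters = UNIV"
  by (simp add: letters_def UNIV_letter)

fun covec :: "int v4 \<Rightarrow> int v4" where
  "covec (a, b, c, d) = (3 * b - a + (c + d), 3 * a - b + (c + d), a + b + d - c, a + b + c - d)"

fun dot :: "int v4 \<Rightarrow> int v4 \<Rightarrow> int" where
  "dot (a, b, c, d) (a', b', c', d') = a * a' + b * b' + c * c' + d * d'"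

text \<open>At one vertex: if \<open>b\<close> is the parent's pairing and \<open>a\<close> runs
  over those of the children, the powers of \<open>b / a\<close> sum to at most 1. The factor 12600
  compares the pairing with the curvature, so that the weight later controls the diameter.\<close>

definition checkU2 :: "letter \<Rightarrow> int v4 \<Rightarrow> int v4 list \<Rightarrow> int v4 \<Rightarrow> bool" where
  "checkU2 c w ws v = (let b = dot v w; as = map (dot v) ws in
     0 < b \<and> b \<le> - 12600 * kf c v \<and> list_all (\<lambda>a. b \<le> a) as \<and>
     sum_list (map (powbound b) as) \<le> 16384)"

definition checkU1 :: "letter \<Rightarrow> int v4 \<Rightarrow> (letter \<times> int v4) list \<Rightarrow> int v4 list \<Rightarrow> bool" where
  "checkU1 c z zs vs =
     list_all (checkU2 c (covec z) (map (\<lambda>(x, z'). covec (mirror x z')) zs)) vs"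

text \<open>Generators of a cone containing \<open>pt us\<close> for words not beginning with
  \<open>c\<close>: the other normals and the tangency points of their circles with the
  \<open>c\<close>-circle, which are light vectors.\<close>

definition capV :: "letter \<Rightarrow> ('a::comm_ring_1) v4 list" where
  "capV c = map nrm (filter (\<lambda>l. l \<noteq> c) letters) @
            map (\<lambda>l. nrm l + nrm c) (filter (\<lambda>l. l \<noteq> c \<and> \<not> opp l c) letters)"

text \<open>The analogue for words beginning with neither \<open>c\<close> nor \<open>d\<close>,
  that is, for the part of a word below an alternating run of these two letters.\<close>

definition exitV :: "letter \<Rightarrow> letter \<Rightarrow> ('a::comm_ring_1) v4 list" where
  "exitV c d = concat (map (\<lambda>l. nrm l # (if opp l c then [] else [nrm l + nrm c])
       @ (if opp l d then [] else [nrm l + nrm d])) (filter (\<lambda>l. l \<noteq> c \<and> l \<noteq> d) letters))"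

fun altern :: "letter \<Rightarrow> letter \<Rightarrow> nat \<Rightarrow> ('a::comm_ring_1) v4 \<Rightarrow> 'a v4" where
  "altern c d 0 v = v"
| "altern c d (Suc n) v = mirror c (altern d c n v)"

definition startU :: "letter \<Rightarrow> letter \<Rightarrow> letter \<Rightarrow> int v4" where
  "startU c d y = orient c d (upper_start (kind c d) (local c d y))"

definition runU :: "letter \<Rightarrow> letter \<Rightarrow> int v4 list" where
  "runU c d = map (orient c d) (upper_run (kind c d))"

definition exitsU :: "letter \<Rightarrow> letter \<Rightarrow> (letter \<times> int v4) list" where
  "exitsU c d = map (\<lambda>x. (x, startU x c d)) (filter (\<lambda>x. x \<noteq> c \<and> x \<noteq> d) letters)"

text \<open>Three known letters confine the point to the image of the cone of \<open>capV y\<close>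
  under three reflections.\<close>

definition checkU_start :: "letter \<Rightarrow> letter \<Rightarrow> letter \<Rightarrow> bool" where
  "checkU_start c d y = checkU1 c (startU c d y)
     ((d, if opp c d then startU d c d else hd (runU d c)) # exitsU c d)
     (map (\<lambda>v. mirror c (mirror d (mirror y v))) (capV y))"

text \<open>\<open>vs\<close> and \<open>vs'\<close> hold the vertices for the runs headed by
  \<open>c\<close> and by \<open>d\<close>. Lengthening a run puts a reflection on the run headed by
  the other letter, so the lists trade places.\<close>

fun checkU_run :: "letter \<Rightarrow> letter \<Rightarrow> (letter \<times> int v4) list \<Rightarrow> int v4 list \<Rightarrow> int v4 list \<Rightarrow>
    int v4 list \<Rightarrow> int v4 list \<Rightarrow> bool" where
  "checkU_run c d ex zs (z' # zs') vs vs' =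
     (checkU1 c (hd zs) ((d, z') # ex) vs \<and>
      checkU_run c d ex (tl zs) zs' (map (mirror c) vs') (map (mirror d) vs))"
| "checkU_run c d ex zs [] vs vs' = True"

definition checkU_runs :: "letter \<Rightarrow> letter \<Rightarrow> bool" where
  "checkU_runs c d = checkU_run c d (exitsU c d) (runU c d) (tl (runU d c))
     (map (altern c d 3) (exitV c d)) (map (altern d c 3) (exitV c d))"

section \<open>Checks of the lower certificate\<close>

fun smul :: "int \<Rightarrow> int v4 \<Rightarrow> int v4" where
  "smul t (a, b, c, d) = (t * a, t * b, t * c, t * d)"

text \<open>The square \<open>mpair v v\<close>, regrouped to save multiplications.\<close>

fun qform :: "'a::comm_ring_1 v4 \<Rightarrow> 'a" where
  "qform (a, b, c, d) = 8 * (a * b) + (a + b) * (2 * (c + d) - (a + b)) - (c - d) * (c - d)"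

fun causal :: "int v4 \<Rightarrow> bool" where
  "causal (a, b, c, d) = (0 < a + b \<and> 0 \<le> qform (a, b, c, d))"

definition startL :: "letter \<Rightarrow> letter \<Rightarrow> letter \<Rightarrow> int v4" where
  "startL c d y = orient c d (fst (lower_start (kind c d) (local c d y)))"

definition exitsL :: "letter \<Rightarrow> letter \<Rightarrow> (letter \<times> int v4) list" where
  "exitsL c d = map (\<lambda>x. (x, startL x c d)) (filter (\<lambda>x. x \<noteq> c \<and> x \<noteq> d) letters)"

fun pick :: "int list \<Rightarrow> letter \<Rightarrow> int" where
  "pick [n1, n2, n3, n4, n5] l =
     (case l of N1 \<Rightarrow> n1 | N2 \<Rightarrow> n2 | N3 \<Rightarrow> n3 | N4 \<Rightarrow> n4 | N5 \<Rightarrow> n5)"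
| "pick _ l = 0"

text \<open>The \<lambda> sum to at least 1 in scale \<open>2 ^ 16\<close>. As
  \<open>(5, 5, 6, 0)\<close> is the sum of the normals, the second clause bounds the pairing below
  by \<open>total\<close>. The third is the light cone condition in scale
  \<open>2 ^ 20\<close>.\<close>

definition checkL1 :: "letter \<Rightarrow> letter \<Rightarrow> int v4 \<times> int list \<Rightarrow> (letter \<times> int v4) list \<Rightarrow> bool" where
  "checkL1 c d e xs = (let z = orient c d (fst e);
       ys = map (\<lambda>(x, z'). (weight (pick (snd e) (local c d x)), mirror x z')) xs in
     65536 \<le> sum_list (map (\<lambda>(n, w). fst n) ys) \<and>
     causal (z - (5, 5, 6, 0)) \<and>
     causal (foldr (\<lambda>(n, w) v. v - smul (snd n) w) ys (smul 1048576 z)))"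

text \<open>Runs of opposite letters are cut at length 3, so with \<open>y = c\<close> the child
  \<open>d\<close> is missing.\<close>

definition checkL_start :: "letter \<Rightarrow> letter \<Rightarrow> letter \<Rightarrow> bool" where
  "checkL_start c d y = checkL1 c d (lower_start (kind c d) (local c d y))
     ((if opp c d then (if y = c then [] else [(d, startL d c d)])
       else [(d, orient d c (fst (hd (lower_run (kind d c)))))]) @ exitsL c d)"

text \<open>The singleton case is the maximal run length, where only the exits remain as
  children.\<close>

fun checkL_run :: "letter \<Rightarrow> letter \<Rightarrow> (letter \<times> int v4) list \<Rightarrow> (int v4 \<times> int list) list \<Rightarrow>
    (int v4 \<times> int list) list \<Rightarrow> bool" where
  "checkL_run c d ex [] bs = True"
| "checkL_run c d ex [a] bs = checkL1 c d a ex"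
| "checkL_run c d ex (a # a' # as) (b # bs) =
     (checkL1 c d a ((d, orient d c (fst b)) # ex) \<and> checkL_run c d ex (a' # as) bs)"
| "checkL_run c d ex (a # a' # as) [] = False"

definition checkL_runs :: "letter \<Rightarrow> letter \<Rightarrow> bool" where
  "checkL_runs c d = checkL_run c d (exitsL c d) (lower_run (kind c d)) (tl (lower_run (kind d c)))"

section \<open>The packing in coordinates\<close>

definition tup :: "real^4 \<Rightarrow> real v4" where "tup v = (v $ 1, v $ 2, v $ 3, v $ 4)"

lemma inj_tup: "tup v = tup w \<longleftrightarrow> v = w"
  by (auto simp: tup_def vec_eq_iff forall_4)

lemma lorentz_tup: "lorentz x y = - mpair (tup x) (tup y)"
  by (simp add: lorentz_def lorentz_matrix_def inner_vec_def matrix_vector_mult_def sum_4 vector_4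
      tup_def algebra_simps)

definition vnrm :: "letter \<Rightarrow> real^4" where
  "vnrm l = (case nrm l of (a, b, c, d) \<Rightarrow> vector [a, b, c, d])"

lemma tup_vnrm: "tup (vnrm l) = nrm l"
  by (cases l) (simp_all add: vnrm_def tup_def vector_4)

lemma mallows_normals_eq: "mallows_normals = range vnrm"
  unfolding mallows_normals_def UNIV_letter by (auto simp: vnrm_def)

lemma mpair_nrm_nrm: "mpair (nrm l) (nrm l) = - (8 :: real)"
  by (cases l) simp_all

lemma mirror_eq: "mirror l v = v + (kf l v / 4) *\<^sub>R nrm l" for v :: "real v4"
  by (cases l; cases v) (simp_all add: Let_def field_simps)

lemma tup_reflection: "tup (lorentz_reflection (vnrm l) x) = mirror l (tup x)"
proof -
  have "lorentz x (vnrm l) = - kf l (tup x)" "lorentz (vnrm l) (vnrm l) = 8"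
    by (simp_all add: lorentz_tup tup_vnrm mpair_nrm mpair_nrm_nrm[unfolded mpair_nrm])
  then have *: "lorentz_reflection (vnrm l) x = x + (kf l (tup x) / 4) *\<^sub>R vnrm l"
    by (simp add: lorentz_reflection_def)
  have "tup (x + t *\<^sub>R vnrm l) = tup x + t *\<^sub>R nrm l" for t
    by (simp add: tup_vnrm[symmetric]) (simp add: tup_def)
  then show ?thesis
    by (simp add: * mirror_eq)
qed

lemma mallows_group_act:
  assumes "g \<in> mallows_group"
  shows "\<exists>us. \<forall>x. tup (g x) = act us (tup x)"
  using assms unfolding mallows_group_def
proof (induction rule: generate.induct)
  case one
  show ?case by (rule exI[of _ "[]"]) (simp add: BijGroup_def)
next
  case (incl h)
  then obtain l where "h = lorentz_reflection (vnrm l)" by (auto simp: mallows_normals_eq)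
  then show ?case by (intro exI[of _ "[l]"]) (simp add: tup_reflection)
next
  case (inv h)
  then obtain l where h: "h = lorentz_reflection (vnrm l)" by (auto simp: mallows_normals_eq)
  have hh: "h (h x) = x" for x
    unfolding inj_tup[symmetric] by (simp add: h tup_reflection)
  have hC: "h \<in> carrier (BijGroup UNIV)" using inv mallows_generators_in_carrier by blast
  have "inv\<^bsub>BijGroup UNIV\<^esub> h = h"
  proof (rule group.inv_equality[OF group_BijGroup])
    show "h \<otimes>\<^bsub>BijGroup UNIV\<^esub> h = \<one>\<^bsub>BijGroup UNIV\<^esub>"
      using hC hh by (auto simp: BijGroup_def compose_def fun_eq_iff)
  qed (use hC in auto)
  then show ?case by (intro exI[of _ "[l]"]) (simp add: h tup_reflection)
next
  case (eng h1 h2)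
  then obtain us vs where u: "\<forall>x. tup (h1 x) = act us (tup x)" "\<forall>x. tup (h2 x) = act vs (tup x)"
    by blast
  have C: "h1 \<in> carrier (BijGroup UNIV)" "h2 \<in> carrier (BijGroup UNIV)"
    using eng group.generate_in_carrier[OF group_BijGroup mallows_generators_in_carrier] by auto
  then have "h1 \<otimes>\<^bsub>BijGroup UNIV\<^esub> h2 = (\<lambda>x. h1 (h2 x))"
    by (auto simp: BijGroup_def compose_def fun_eq_iff)
  then show ?case by (intro exI[of _ "us @ vs"]) (simp add: u act_append)
qed

lemma act_mallows_group: "\<exists>g\<in>mallows_group. \<forall>x. tup (g x) = act us (tup x)"
proof (induction us)
  case Nil
  have "\<one>\<^bsub>BijGroup UNIV\<^esub> \<in> mallows_group"
    unfolding mallows_group_def by (rule generate.one)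
  then show ?case by (intro bexI) (auto simp: BijGroup_def)
next
  case (Cons l us)
  then obtain g where g: "g \<in> mallows_group" "\<forall>x. tup (g x) = act us (tup x)" by blast
  let ?h = "lorentz_reflection (vnrm l)"
  have h: "?h \<in> mallows_group"
    unfolding mallows_group_def by (intro generate.incl) (auto simp: mallows_normals_eq)
  have C: "g \<in> carrier (BijGroup UNIV)" "?h \<in> carrier (BijGroup UNIV)"
    using g h group.generate_in_carrier[OF group_BijGroup mallows_generators_in_carrier]
    by (auto simp: mallows_group_def)
  have "?h \<otimes>\<^bsub>BijGroup UNIV\<^esub> g \<in> mallows_group"
    using g h unfolding mallows_group_def by (intro generate.eng)
  moreover have "?h \<otimes>\<^bsub>BijGroup UNIV\<^esub> g = (\<lambda>x. ?h (g x))"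
    using C by (auto simp: BijGroup_def compose_def fun_eq_iff)
  ultimately show ?case
    by (intro bexI[of _ "\<lambda>x. ?h (g x)"]) (auto simp: g tup_reflection)
qed

definition seeds :: "real v4 set" where "seeds = {s1, s2, s3, s4, s5}"

lemma tup_mallows_seeds: "tup ` mallows_seeds = seeds"
  by (auto simp: mallows_seeds_def seeds_def tup_def axis_def)

lemma tup_mallows_orbit: "tup ` mallows_orbit = {act us e | us e. e \<in> seeds}"
proof (intro equalityI subsetI)
  fix t assume "t \<in> tup ` mallows_orbit"
  then obtain g x where gx: "g \<in> mallows_group" "x \<in> mallows_seeds" "t = tup (g x)"
    by (auto simp: mallows_orbit_def)
  then show "t \<in> {act us e | us e. e \<in> seeds}"
    using mallows_group_act[OF gx(1)] tup_mallows_seeds by blast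
next
  fix t assume "t \<in> {act us e | us e. e \<in> seeds}"
  then obtain us x where x: "x \<in> mallows_seeds" "t = act us (tup x)"
    unfolding tup_mallows_seeds[symmetric] by blast
  obtain g where "g \<in> mallows_group" "\<forall>x. tup (g x) = act us (tup x)"
    using act_mallows_group by blast
  then show "t \<in> tup ` mallows_orbit"
    using x by (auto simp: mallows_orbit_def intro!: image_eqI[of _ _ "g x"])
qed

lemma mallows_circle_coords_tup:
  "mallows_circle_coords v = vector [kap (tup v), ccx (tup v), ccy (tup v), ccm (tup v)]"
  by (simp add: vec_eq_iff forall_4 vector_4 mallows_circle_coords_def disk_coords_def
      halfplane_coords_def Let_def tup_def kap_eq ccx_def ccy_def ccm_def power2_eq_square field_simps)

lemma norm_2: "norm (x :: real^2) = sqrt ((x $ 1)\<^sup>2 + (x $ 2)\<^sup>2)"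
  by (simp add: norm_eq_sqrt_inner inner_vec_def sum_2 power2_eq_square)

lemma vector_2_simps [simp]: "(vector [a, b] :: real^2) $ 1 = a" "(vector [a, b] :: real^2) $ 2 = b"
  by (simp_all add: vector_def)

lemma has_circle_coords_disk:
  assumes "has_circle_coords D (mallows_circle_coords v)"
  shows "D = {X. mpair (lift X) (tup v) < 0}"
  using assms unfolding has_circle_coords_def
proof (elim disjE exE conjE)
  fix c r assume r: "r > 0" and D: "D = ball c r" and v: "mallows_circle_coords v = disk_coords c r"
  have e: "kap (tup v) = 1 / r" "ccx (tup v) = c $ 1 / r" "ccy (tup v) = c $ 2 / r"
    "ccm (tup v) = ((c $ 1)\<^sup>2 + (c $ 2)\<^sup>2) / r - r"
    using v unfolding mallows_circle_coords_tup
    by (auto simp: disk_coords_def Let_def vec_eq_iff forall_4 vector_4)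
  have d2: "(dist c X)\<^sup>2 = (c $ 1 - X $ 1)\<^sup>2 + (c $ 2 - X $ 2)\<^sup>2" for X
    by (simp add: dist_norm norm_2)
  have "mpair (lift X) (tup v) = ((dist c X)\<^sup>2 - r\<^sup>2) / r" for X
    using r unfolding mpair_lift e d2 by (simp add: power2_eq_square field_simps)
  moreover have "dist c X < r \<longleftrightarrow> (dist c X)\<^sup>2 < r\<^sup>2" for X
    using r by (auto intro: power_strict_mono dest: power2_less_imp_less)
  ultimately show ?thesis
    using r by (auto simp: D divide_less_0_iff)
next
  fix u h assume u: "norm u = 1" and D: "D = halfplane u h"
    and v: "mallows_circle_coords v = halfplane_coords u h"
  have e: "kap (tup v) = 0" "ccx (tup v) = u $ 1" "ccy (tup v) = u $ 2" "ccm (tup v) = 2 * h"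
    using v unfolding mallows_circle_coords_tup
    by (auto simp: halfplane_coords_def vec_eq_iff forall_4 vector_4)
  show ?thesis
    by (auto simp: D mpair_lift e halfplane_def inner_vec_def sum_2 algebra_simps)
qed

text \<open>A vector of negative curvature would describe the exterior of a circle, which
  \<open>has_circle_coords\<close> does not admit; hence the condition on
  \<open>kap\<close>.\<close>

lemma has_circle_coords_ex:
  assumes "mpair (tup v) (tup v) = - 1" "kap (tup v) \<ge> 0"
  shows "\<exists>D. has_circle_coords D (mallows_circle_coords v)"
proof (cases "kap (tup v) = 0")
  case True
  let ?u = "vector [ccx (tup v), ccy (tup v)] :: real^2"
  have "norm ?u = 1" using assms True by (simp add: norm_2 mpair_circle)
  moreover have "mallows_circle_coords v = halfplane_coords ?u (ccm (tup v) / 2)"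
    using True by (simp add: mallows_circle_coords_tup halfplane_coords_def)
  ultimately show ?thesis unfolding has_circle_coords_def by blast
next
  case False
  then have k: "kap (tup v) > 0" using assms by simp
  let ?k = "kap (tup v)"
  let ?c = "vector [ccx (tup v) / ?k, ccy (tup v) / ?k] :: real^2"
  have "ccm (tup v) = ((ccx (tup v))\<^sup>2 + (ccy (tup v))\<^sup>2 - 1) / ?k"
    using assms(1) k unfolding mpair_circle by (simp add: field_simps)
  also have "\<dots> = ?k * ((ccx (tup v) / ?k)\<^sup>2 + (ccy (tup v) / ?k)\<^sup>2) - 1 / ?k"
    using k by (simp add: divide_simps) (simp add: power2_eq_square algebra_simps)
  finally have "ccm (tup v) = ?k * ((ccx (tup v) / ?k)\<^sup>2 + (ccy (tup v) / ?k)\<^sup>2) - 1 / ?k" .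
  then have "mallows_circle_coords v = disk_coords ?c (1 / ?k)"
    using k by (simp add: mallows_circle_coords_tup disk_coords_def Let_def)
  then show ?thesis unfolding has_circle_coords_def using k by (metis zero_less_divide_1_iff)
qed

section \<open>Cones containing the orbit of infinity\<close>

text \<open>Coefficients are positive and combinations nonempty, so strict inequalities pass from
  the generators to the cone.\<close>

inductive_set ccone :: "real v4 set \<Rightarrow> real v4 set" for P where
  base: "v \<in> P \<Longrightarrow> t > 0 \<Longrightarrow> t *\<^sub>R v \<in> ccone P"
| add: "x \<in> ccone P \<Longrightarrow> y \<in> ccone P \<Longrightarrow> x + y \<in> ccone P"

lemma ccone_1: "v \<in> P \<Longrightarrow> v \<in> ccone P"
  using ccone.base[of v P 1] by simp

lemma ccone_scale: "x \<in> ccone P \<Longrightarrow> t > 0 \<Longrightarrow> t *\<^sub>R x \<in> ccone P"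
proof (induction rule: ccone.induct)
  case (base v s) then show ?case using ccone.base[of v P "t * s"] by simp
next
  case (add x y) then show ?case by (simp add: scaleR_add_right ccone.add)
qed

lemma ccone_map:
  assumes "x \<in> ccone P" "\<And>v. v \<in> P \<Longrightarrow> f v \<in> ccone Q"
    "\<And>x y. f (x + y) = f x + f y" "\<And>t x. f (t *\<^sub>R x) = t *\<^sub>R f x"
  shows "f x \<in> ccone Q"
  using assms(1)
  by (induction rule: ccone.induct) (auto simp: assms ccone_scale ccone.add)

lemma ccone_image:
  assumes "x \<in> ccone P" "\<And>x y. f (x + y) = f x + f y" "\<And>t x. f (t *\<^sub>R x) = t *\<^sub>R f x"
  shows "f x \<in> ccone (f ` P)"
  by (rule ccone_map[OF assms(1) _ assms(2,3)]) (auto intro: ccone_1)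

lemma ccone_nonneg:
  assumes "x \<in> ccone P" "\<And>v. v \<in> P \<Longrightarrow> mpair v w \<ge> 0"
  shows "mpair x w \<ge> 0"
  using assms(1)
  by (induction rule: ccone.induct) (auto simp: assms mpair_scale_left mpair_add_left)

lemma capV_iff:
  "v \<in> set (capV c) \<longleftrightarrow> (\<exists>i. i \<noteq> c \<and> (v = nrm i \<or> \<not> opp i c \<and> v = nrm i + nrm c))"
  by (auto simp: capV_def)

lemma exitV_iff:
  "v \<in> set (exitV c d) \<longleftrightarrow> (\<exists>i. i \<noteq> c \<and> i \<noteq> d \<and>
     (v = nrm i \<or> \<not> opp i c \<and> v = nrm i + nrm c \<or> \<not> opp i d \<and> v = nrm i + nrm d))"
  by (auto simp: exitV_def split: if_split)

lemma nrm_capV: "i \<noteq> c \<Longrightarrow> nrm i \<in> set (capV c)"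
  by (auto simp: capV_iff)

lemma tangent_capV: "i \<noteq> c \<Longrightarrow> \<not> opp i c \<Longrightarrow> nrm i + nrm c \<in> set (capV c)"
  by (auto simp: capV_iff)

lemma capV_cases:
  assumes "v \<in> set (capV c)"
  obtains i where "i \<noteq> c" "v = nrm i" | i where "i \<noteq> c" "\<not> opp i c" "v = nrm i + nrm c"
  using assms unfolding capV_iff by blast

lemma nrm_exitV: "i \<noteq> c \<Longrightarrow> i \<noteq> d \<Longrightarrow> nrm i \<in> set (exitV c d)"
  by (auto simp: exitV_iff)

lemma tangent_exitV: "i \<noteq> c \<Longrightarrow> i \<noteq> d \<Longrightarrow> \<not> opp i c \<Longrightarrow> nrm i + nrm c \<in> set (exitV c d)"
  by (auto simp: exitV_iff)

lemma tangent_exitV': "i \<noteq> c \<Longrightarrow> i \<noteq> d \<Longrightarrow> \<not> opp i d \<Longrightarrow> nrm i + nrm d \<in> set (exitV c d)"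
  by (auto simp: exitV_iff)

lemma mirror_nrm_tangent: "i \<noteq> b \<Longrightarrow> \<not> opp i b \<Longrightarrow> mirror b (nrm i) = nrm i + nrm b + nrm b"
  by (cases i; cases b) (simp_all add: Let_def)

text \<open>Five normals in four dimensions satisfy
  \<open>nrm N1 + nrm N4 = nrm N2 + nrm N5\<close>. This trades the normal \<open>i\<close>, which
  the target cone may lack, for its two neighbours on the base.\<close>

lemma mirror_nrm_opp:
  assumes "opp i b"
  obtains u w where "u \<notin> {N3, i, b, w}" "w \<notin> {N3, i, b}" "\<not> opp u b" "\<not> opp w b"
    "mirror b (nrm i) = nrm u + nrm w + 5 *\<^sub>R (nrm b :: real v4)"
proof (cases "b \<in> {N1, N4}")
  case True
  then show ?thesis using assms that[of N2 N5] by (cases i; cases b) (auto simp: Let_def)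
next
  case False
  then show ?thesis using assms that[of N1 N4] by (cases i; cases b) (auto simp: Let_def)
qed

lemma five: "5 *\<^sub>R y = y + y + 3 *\<^sub>R y" for y :: "real v4"
  by (cases y) simp

text \<open>Reflection in \<open>b\<close> fixes the tangency points on the \<open>b\<close>-circle
  and adds \<open>2 nrm b\<close> to a tangent normal. Only the normal opposite to \<open>b\<close>
  has to be examined for each target cone \<open>Q\<close>.\<close>

lemma mirror_capV_gen:
  assumes Q: "nrm b \<in> ccone Q" "\<And>i. i \<noteq> b \<Longrightarrow> \<not> opp i b \<Longrightarrow> nrm i + nrm b \<in> ccone Q"
    and O: "\<And>i. opp i b \<Longrightarrow> mirror b (nrm i) \<in> ccone Q"
    and v: "v \<in> set (capV b)"
  shows "mirror b v \<in> ccone Q"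
  using v
proof (cases rule: capV_cases)
  case (1 i)
  then show ?thesis
    using Q O[of i] by (cases "opp i b") (auto simp: mirror_nrm_tangent intro: ccone.add)
next
  case (2 i)
  then show ?thesis
    using Q(2)[of i] by (simp add: mirror_add mirror_nrm_tangent)
qed

text \<open>The induction step of \<open>pt_capV\<close>. The delicate case is \<open>a\<close>
  opposite to \<open>b\<close>: its normal is no generator of the target and is replaced through
  \<open>mirror_nrm_opp\<close>.\<close>

lemma mirror_capV:
  assumes ab: "a \<noteq> b" and v: "v \<in> set (capV b)"
  shows "mirror b v \<in> ccone (set (capV a))"
proof (rule mirror_capV_gen[OF _ _ _ v])
  show nb: "nrm b \<in> ccone (set (capV a))" using ab by (intro ccone_1 nrm_capV) auto
  show "nrm i + nrm b \<in> ccone (set (capV a))" if "i \<noteq> b" "\<not> opp i b" for i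
  proof (cases "i = a")
    case True
    then show ?thesis
      using that tangent_capV[of b a] by (auto simp: add.commute opp_sym intro: ccone_1)
  next
    case False
    then have "nrm i \<in> ccone (set (capV a))" by (intro ccone_1 nrm_capV)
    then show ?thesis using nb by (rule ccone.add)
  qed
  show "mirror b (nrm i) \<in> ccone (set (capV a))" if o: "opp i b" for i
  proof (cases "i = a")
    case True
    obtain u w where uw: "u \<notin> {N3, i, b, w}" "w \<notin> {N3, i, b}"
      "mirror b (nrm i) = nrm u + nrm w + 5 *\<^sub>R (nrm b :: real v4)"
      using mirror_nrm_opp[OF o] by metis
    then have "nrm u \<in> ccone (set (capV a))" "nrm w \<in> ccone (set (capV a))"
      using True by (auto intro!: ccone_1 nrm_capV)
    then show ?thesis
      unfolding uw(3) using nb by (intro ccone.add ccone_scale) auto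
  next
    case False
    have "mirror b (nrm i) = nrm i + 6 *\<^sub>R (nrm b :: real v4)"
      using o by (cases i; cases b) (auto simp: Let_def)
    moreover have "nrm i \<in> ccone (set (capV a))"
      using False by (intro ccone_1 nrm_capV)
    ultimately show ?thesis
      using nb by (simp add: ccone.add ccone_scale)
  qed
qed

lemma mirror_capV_exitV:
  assumes y: "y \<noteq> a" "y \<noteq> b" and ab: "a \<noteq> b" and v: "v \<in> set (capV y)"
  shows "mirror y v \<in> ccone (set (exitV a b))"
proof (rule mirror_capV_gen[OF _ _ _ v])
  show ny: "nrm y \<in> ccone (set (exitV a b))" using y by (intro ccone_1 nrm_exitV) auto
  show t: "nrm i + nrm y \<in> ccone (set (exitV a b))" if "i \<noteq> y" "\<not> opp i y" for i
  proof (cases "i = a \<or> i = b")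
    case True
    then show ?thesis
      using that y tangent_exitV[of y a b] tangent_exitV'[of y a b]
      by (auto simp: add.commute opp_sym intro: ccone_1)
  next
    case False
    then have "nrm i \<in> ccone (set (exitV a b))" by (intro ccone_1 nrm_exitV) auto
    then show ?thesis using ny by (rule ccone.add)
  qed
  show "mirror y (nrm i) \<in> ccone (set (exitV a b))" if o: "opp i y" for i
  proof (cases "i = a \<or> i = b")
    case True
    obtain u w where uw: "u \<notin> {N3, i, y, w}" "w \<notin> {N3, i, y}" "\<not> opp u y" "\<not> opp w y"
      "mirror y (nrm i) = nrm u + nrm w + 5 *\<^sub>R (nrm y :: real v4)"
      using mirror_nrm_opp[OF o] .
    have tu: "nrm u + nrm y \<in> ccone (set (exitV a b))" "nrm w + nrm y \<in> ccone (set (exitV a b))"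
      using t[of u] t[of w] uw by auto
    \<comment> \<open>One of the neighbours may itself be \<open>a\<close> or \<open>b\<close>,
      whose normal alone is no generator; each neighbour therefore takes one of the five copies of
      \<open>nrm y\<close> to form a tangency point.\<close>
    have "mirror y (nrm i) = (nrm u + nrm y) + (nrm w + nrm y) + 3 *\<^sub>R (nrm y :: real v4)"
      by (simp only: uw(5) five ac_simps)
    then show ?thesis
      using tu ny by (simp add: ccone.add ccone_scale)
  next
    case False
    have "mirror y (nrm i) = nrm i + 6 *\<^sub>R (nrm y :: real v4)"
      using o by (cases i; cases y) (auto simp: Let_def)
    moreover have "nrm i \<in> ccone (set (exitV a b))"
      using False by (intro ccone_1 nrm_exitV) auto
    ultimately show ?thesis
      using ny by (simp add: ccone.add ccone_scale)
  qed
qed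

text \<open>Infinity as the point where the parallel lines \<open>N1\<close> and \<open>N2\<close>
  touch.\<close>

lemma infty_eq: "infty = (1/4) *\<^sub>R (nrm N1 + nrm N2 :: real v4)"
  by simp

lemma infty_capV: "c \<notin> {N1, N2} \<Longrightarrow> infty \<in> ccone (set (capV c))"
  unfolding infty_eq by (intro ccone_scale ccone.add ccone_1 nrm_capV) auto

lemma infty_exitV: "c \<noteq> d \<Longrightarrow> c \<notin> {N1, N2} \<or> d \<notin> {N1, N2} \<Longrightarrow> infty \<in> ccone (set (exitV c d))"
proof -
  assume cd: "c \<noteq> d" "c \<notin> {N1, N2} \<or> d \<notin> {N1, N2}"
  have "nrm N1 + nrm N2 \<in> ccone (set (exitV c d))"
  proof (cases "c \<in> {N1, N2} \<or> d \<in> {N1, N2}")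
    case False
    then show ?thesis by (intro ccone.add ccone_1 nrm_exitV) auto
  next
    case True
    then consider "c = N1" "d \<noteq> N2" | "c = N2" "d \<noteq> N1" | "d = N1" "c \<noteq> N2" | "d = N2" "c \<noteq> N1"
      using cd by auto
    then have "nrm N1 + nrm N2 \<in> set (exitV c d)"
      using cd tangent_exitV[of N2 c d] tangent_exitV[of N1 c d] tangent_exitV'[of N1 c d]
        tangent_exitV'[of N2 c d]
      by cases auto
    then show ?thesis by (rule ccone_1)
  qed
  then show ?thesis unfolding infty_eq by (intro ccone_scale) auto
qed

lemma pt_capV: "valid ws \<Longrightarrow> a \<notin> {N1, N2} \<or> ws \<noteq> [] \<Longrightarrow> ws = [] \<or> a \<noteq> hd ws \<Longrightarrow>
   pt ws \<in> ccone (set (capV a))"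
proof (induction ws arbitrary: a)
  case Nil
  then show ?case using infty_capV by auto
next
  case (Cons b ws)
  have "pt ws \<in> ccone (set (capV b))"
    by (rule Cons.IH) (use Cons.prems in \<open>cases ws; auto\<close>)+
  then have "mirror b (pt ws) \<in> ccone (set (capV a))"
    by (rule ccone_map) (use Cons.prems in \<open>auto simp: mirror_capV mirror_add mirror_scale\<close>)
  then show ?case by simp
qed

lemma pt_capV_tl: "valid (c # ws) \<Longrightarrow> pt ws \<in> ccone (set (capV c))"
  by (rule pt_capV) (cases ws; auto)+

lemma pt_exitV:
  assumes "valid ws" "c \<noteq> d" "if ws = [] then c \<notin> {N1, N2} \<or> d \<notin> {N1, N2} else hd ws \<notin> {c, d}"
  shows "pt ws \<in> ccone (set (exitV c d))"
proof (cases ws)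
  case Nil
  then show ?thesis using assms infty_exitV by simp
next
  case (Cons y us)
  have "pt us \<in> ccone (set (capV y))" using assms Cons by (intro pt_capV_tl) simp
  then have "mirror y (pt us) \<in> ccone (set (exitV c d))"
    by (rule ccone_map) (use assms Cons in \<open>auto simp: mirror_capV_exitV mirror_add mirror_scale\<close>)
  then show ?thesis by (simp add: Cons)
qed

section \<open>Points below an alternating run\<close>

lemma altern_add: "altern c d n (x + y) = altern c d n x + altern c d n y"
  by (induction c d n x rule: altern.induct) (simp_all add: mirror_add)

lemma altern_scale: "altern c d n (t *\<^sub>R x) = t *\<^sub>R altern c d n x" for x :: "real v4"
  by (induction c d n x rule: altern.induct) (simp_all add: mirror_scale)

lemma exitV_commute: "set (exitV c d) = set (exitV d c)"
  by (auto simp: exitV_iff)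

text \<open>Undoing the whole leading run leaves a word beginning with neither of its letters, or
  \<open>infty\<close> itself if the word is a single run.\<close>

lemma pt_altern:
  assumes "valid (c # d # us)"
  shows "\<exists>p\<in>ccone (set (exitV c d)). pt (c # d # us) = altern c d (run (c # d # us)) p"
  using assms
proof (induction us arbitrary: c d)
  case Nil
  then have "infty \<in> ccone (set (exitV c d))" by (intro infty_exitV) auto
  then show ?case by (intro bexI[of _ infty]) (simp_all add: eval_nat_numeral)
next
  case (Cons y us)
  show ?case
  proof (cases "y = c")
    case True
    have "valid (d # c # us)" using Cons.prems True by simp
    from Cons.IH[OF this] obtain p where p: "p \<in> ccone (set (exitV d c))"
      "pt (d # c # us) = altern d c (run (d # c # us)) p" by blast
    moreover have "p \<in> ccone (set (exitV c d))"
      using p(1) by (simp only: exitV_commute[of d c])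
    ultimately show ?thesis
      using True by (intro bexI[of _ p]) auto
  next
    case False
    then have "pt (y # us) \<in> ccone (set (exitV c d))"
      using Cons.prems by (intro pt_exitV) auto
    then show ?thesis
      using False by (intro bexI[of _ "pt (y # us)"]) (simp_all add: eval_nat_numeral)
  qed
qed

section \<open>The residual set\<close>

text \<open>Cancelling equal neighbours and deleting innermost letters \<open>N1\<close> and
  \<open>N2\<close> does not change the image of \<open>infty\<close>.\<close>

lemma valid_rep: "\<exists>ws. valid ws \<and> pt us = (pt ws :: real v4)"
proof (induction us)
  case Nil
  show ?case by (rule exI[of _ "[]"]) simp
next
  case (Cons l us)
  then obtain ws where ws: "valid ws" "pt us = (pt ws :: real v4)" by blast
  show ?case
  proof (cases ws)
    case Nil
    show ?thesis
    proof (cases "l \<in> {N1, N2}")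
      case True
      then have "pt (l # us) = (pt [] :: real v4)" using ws Nil by auto
      then show ?thesis by (intro exI[of _ "[]"]) simp
    next
      case False
      then show ?thesis using ws Nil by (intro exI[of _ "[l]"]) simp
    qed
  next
    case (Cons y vs)
    show ?thesis
    proof (cases "y = l")
      case True
      then show ?thesis using ws Cons by (intro exI[of _ vs]) (auto dest: valid_tl)
    next
      case False
      then show ?thesis using ws Cons by (intro exI[of _ "l # ws"]) simp
    qed
  qed
qed

text \<open>Seeds pair nonnegatively with all normals, hence with the cones that contain the orbit
  of \<open>infty\<close>. By self-adjointness all vectors in the orbit of the seeds have
  nonnegative curvature.\<close>

lemma seed_nonneg:
  assumes "e \<in> seeds" shows "mpair (pt us) e \<ge> 0"
proof -
  have n: "mpair (nrm l) e \<ge> 0" for l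
    using assms by (cases l) (auto simp: seeds_def)
  obtain ws where ws: "valid ws" "pt us = (pt ws :: real v4)" using valid_rep by blast
  obtain a where a: "a \<notin> {N1, N2}" "ws = [] \<or> a \<noteq> hd ws"
    by (cases "ws = [] \<or> N3 \<noteq> hd ws") auto
  have "pt ws \<in> ccone (set (capV a))" using ws a by (intro pt_capV) auto
  then have "mpair (pt ws) e \<ge> 0"
    by (rule ccone_nonneg) (auto elim!: capV_cases simp: n mpair_add_left)
  then show ?thesis by (simp add: ws)
qed

lemma kap_orbit: "e \<in> seeds \<Longrightarrow> kap (act us e) \<ge> 0"
  using seed_nonneg[of e "rev us"] by (simp add: kap_def mpair_act)

lemma residual_iff:
  "X \<in> mallows_residual \<longleftrightarrow> (\<forall>us. \<forall>e\<in>seeds. mpair (act us (lift X)) e \<ge> 0)"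
proof -
  have seed: "mpair e e = - 1" if "e \<in> seeds" for e
    using that by (auto simp: seeds_def)
  have "X \<in> \<Union> mallows_packing \<longleftrightarrow> (\<exists>us. \<exists>e\<in>seeds. mpair (lift X) (act us e) < 0)"
  proof
    assume "X \<in> \<Union> mallows_packing"
    then obtain D v where D: "X \<in> D" "v \<in> mallows_orbit"
      "has_circle_coords D (mallows_circle_coords v)"
      by (auto simp: mallows_packing_def)
    then have "mpair (lift X) (tup v) < 0" using has_circle_coords_disk by blast
    moreover obtain us e where "tup v = act us e" "e \<in> seeds"
      using D(2) tup_mallows_orbit by (smt (verit) image_eqI mem_Collect_eq)
    ultimately show "\<exists>us. \<exists>e\<in>seeds. mpair (lift X) (act us e) < 0" by metis
  next
    assume "\<exists>us. \<exists>e\<in>seeds. mpair (lift X) (act us e) < 0"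
    then obtain us e where ue: "e \<in> seeds" "mpair (lift X) (act us e) < 0" by blast
    then obtain v where v: "v \<in> mallows_orbit" "tup v = act us e"
      using tup_mallows_orbit by (smt (verit) imageE mem_Collect_eq)
    obtain D where D: "has_circle_coords D (mallows_circle_coords v)"
      using has_circle_coords_ex[of v] ue(1) by (auto simp: v seed kap_orbit)
    then have "X \<in> D" using has_circle_coords_disk[OF D] ue v by auto
    then show "X \<in> \<Union> mallows_packing" using D v by (auto simp: mallows_packing_def)
  qed
  then have "X \<in> mallows_residual \<longleftrightarrow> (\<forall>us. \<forall>e\<in>seeds. mpair (lift X) (act us e) \<ge> 0)"
    by (auto simp: mallows_residual_def not_less)
  also have "\<dots> \<longleftrightarrow> (\<forall>us. \<forall>e\<in>seeds. mpair (act us (lift X)) e \<ge> 0)"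
    by (auto simp: mpair_act) (metis rev_rev_ident)
  finally show ?thesis .
qed

section \<open>Inequalities for powers\<close>

text \<open>The perspective \<open>a * f (b / a)\<close> of the convex function
  \<open>f x = x powr (s + 1)\<close> is homogeneous and convex, hence subadditive. This carries the
  upper inequality from vertices to cones.\<close>

lemma powr_ratio_add:
  fixes s :: real
  assumes "s \<ge> 0" and p: "a > 0" "a' > 0" "b > 0" "b' > 0"
  shows "(b + b') * ((b + b') / (a + a')) powr s \<le> b * (b / a) powr s + b' * (b' / a') powr s"
proof -
  let ?f = "\<lambda>x::real. x powr (s + 1)"
  have f: "?f x = x * x powr s" if "x > 0" for x
    using that by (simp add: powr_add)
  let ?u = "a / (a + a')" and ?v = "a' / (a + a')"
  have uv: "?u + ?v = 1" using p by (simp add: add_divide_distrib[symmetric])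
  have eq: "?u * (b / a) + ?v * (b' / a') = (b + b') / (a + a')"
    using p by (simp add: add_divide_distrib)
  have "?f (?u *\<^sub>R (b / a) + ?v *\<^sub>R (b' / a')) \<le> ?u * ?f (b / a) + ?v * ?f (b' / a')"
    using powr_convex[of "s + 1", unfolded convex_on_def, THEN conjunct2, rule_format,
        of "b / a" "b' / a'" ?u ?v] assms uv by auto
  then have "?f ((b + b') / (a + a')) \<le> ?u * ?f (b / a) + ?v * ?f (b' / a')"
    using eq by simp
  then have "(a + a') * ?f ((b + b') / (a + a')) \<le> (a + a') * (?u * ?f (b / a) + ?v * ?f (b' / a'))"
    using p by (intro mult_left_mono) auto
  also have "\<dots> = a * ?f (b / a) + a' * ?f (b' / a')"
    using p by (simp add: distrib_left)
  finally show ?thesis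
    using p by (simp add: f)
qed

text \<open>Young's inequality with exponents \<open>s / (s + 1)\<close> and
  \<open>1 / (s + 1)\<close> for each child, then summation: the linear hypothesis consumes the
  share \<alpha> of the total 1, and the remaining \<beta> is the claim.\<close>

lemma powr_sum_ge:
  fixes s :: real
  assumes s: "s > 0" and fin: "finite S"
    and a: "\<And>x. x \<in> S \<Longrightarrow> a x > 0"
    and l: "\<And>x. x \<in> S \<Longrightarrow> l x > 0" "\<And>x. x \<in> S \<Longrightarrow> l x powr (1 + 1 / s) \<le> m x"
    and sum1: "(\<Sum>x\<in>S. l x) \<ge> 1" and b: "(\<Sum>x\<in>S. m x * a x) \<le> b" "b > 0"
  shows "b powr (- s) \<le> (\<Sum>x\<in>S. a x powr (- s))"
proof -
  define \<alpha> \<beta> where "\<alpha> = s / (s + 1)" and "\<beta> = 1 / (s + 1)"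
  have ab: "\<alpha> + \<beta> = 1" "\<alpha> \<ge> 0" "\<beta> \<ge> 0" 
    using s by (auto simp: \<alpha>_def \<beta>_def add_divide_distrib[symmetric])
  have ab2: "\<alpha> = s * \<beta>" by (simp add: \<alpha>_def \<beta>_def)
  have "1 + 1 / s = (s + 1) / s" using s by (simp add: field_simps)
  then have e: "(1 + 1 / s) * \<alpha> = 1" using s by (simp add: \<alpha>_def)
  have "l x \<le> \<alpha> * (m x * a x / b) + \<beta> * (a x powr (- s) * b powr s)" if x: "x \<in> S" for x
  proof -
    let ?u = "l x powr (1 + 1 / s) * a x / b" and ?v = "a x powr (- s) * b powr s"
    have pos: "?u > 0" "?v > 0" using a[OF x] l[OF x] b(2) by auto
    have lu: "ln ?u = (1 + 1 / s) * ln (l x) + ln (a x) - ln b"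
      using a[OF x] l(1)[OF x] b(2) by (simp add: ln_mult ln_div ln_powr)
    have lv: "ln ?v = - s * ln (a x) + s * ln b"
      using a[OF x] b(2) by (simp add: ln_mult ln_powr)
    have "\<alpha> * ln ?u + \<beta> * ln ?v = ((1 + 1 / s) * \<alpha>) * ln (l x) +
        (\<alpha> - s * \<beta>) * (ln (a x) - ln b)"
      unfolding lu lv by (simp add: algebra_simps)
    also have "\<dots> = ln (l x)" by (simp add: e ab2[symmetric])
    finally have eq: "\<alpha> * ln ?u + \<beta> * ln ?v = ln (l x)" .
    have "u powr \<alpha> * v powr \<beta> = exp (\<alpha> * ln u + \<beta> * ln v)" if "u > 0" "v > 0" for u v
      using that by (simp add: powr_def mult_exp_exp)
    from this[OF pos] have "?u powr \<alpha> * ?v powr \<beta> = l x"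
      using l(1)[OF x] by (simp only: eq exp_ln)
    then have "l x \<le> \<alpha> * ?u + \<beta> * ?v"
      using Youngs_inequality_0[OF ab(2,3,1) pos] by simp
    moreover have "?u \<le> m x * a x / b"
      using a[OF x] l(2)[OF x] b(2) by (intro divide_right_mono mult_right_mono) auto
    then have "\<alpha> * ?u \<le> \<alpha> * (m x * a x / b)" using ab by (intro mult_left_mono) auto
    ultimately show ?thesis by linarith
  qed
  then have "1 \<le> (\<Sum>x\<in>S. \<alpha> * (m x * a x / b) + \<beta> * (a x powr (- s) * b powr s))"
    using sum1 by (meson order_trans sum_mono)
  also have "\<dots> = \<alpha> * ((\<Sum>x\<in>S. m x * a x) / b) + \<beta> * ((\<Sum>x\<in>S. a x powr (- s)) * b powr s)"
    by (simp add: sum.distrib sum_distrib_left sum_divide_distrib sum_distrib_right mult.assoc)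
  also have "\<dots> \<le> \<alpha> * 1 + \<beta> * ((\<Sum>x\<in>S. a x powr (- s)) * b powr s)"
    using b ab by (intro add_mono mult_left_mono mult_right_mono sum_nonneg) auto
  finally have "\<beta> * 1 \<le> \<beta> * ((\<Sum>x\<in>S. a x powr (- s)) * b powr s)"
    using ab by linarith
  then have "1 \<le> (\<Sum>x\<in>S. a x powr (- s)) * b powr s"
    using s by (simp add: \<beta>_def divide_le_cancel)
  then have "b powr (- s) * 1 \<le> b powr (- s) * ((\<Sum>x\<in>S. a x powr (- s)) * b powr s)"
    by (intro mult_left_mono) auto
  also have "\<dots> = (\<Sum>x\<in>S. a x powr (- s))"
    using b(2) by (simp add: powr_minus field_simps)
  finally show ?thesis by simp
qed

text \<open>The difference is the integral of the convex function
  \<open>s * x powr (- s - 1)\<close>, which is at least its midpoint value times the length. The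
  proof widens the interval symmetrically about \<open>m\<close>; AM-GM shows that the gap
  grows.\<close>

lemma powr_diff_midpoint:
  fixes s :: real
  assumes s: "s > 0" and a: "a > 0" and d: "d > 0"
  shows "s * d * (a + d / 2) powr (- s - 1) \<le> a powr (- s) - (a + d) powr (- s)"
proof -
  define m where "m = a + d / 2"
  have m: "m > 0" using a d by (simp add: m_def)
  let ?f = "\<lambda>x. (m - x) powr (- s) - (m + x) powr (- s) - 2 * s * x * m powr (- s - 1)"
  have "?f 0 \<le> ?f (d / 2)"
  proof (rule DERIV_nonneg_imp_nondecreasing[of 0 "d / 2" ?f])
    show "0 \<le> d / 2" using d by simp
    fix x assume x: "0 \<le> x" "x \<le> d / 2"
    then have px: "m - x > 0" "m + x > 0" using a d by (auto simp: m_def)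
    let ?D = "s * (m - x) powr (- s - 1) + s * (m + x) powr (- s - 1) - 2 * s * m powr (- s - 1)"
    have "(?f has_real_derivative ?D) (at x)"
      using px by (auto intro!: derivative_eq_intros)
    moreover have "?D \<ge> 0"
    proof -
      let ?u = "(m - x) powr (- (s + 1) / 2)" and ?v = "(m + x) powr (- (s + 1) / 2)"
      have ee: "- (s + 1) / 2 + - (s + 1) / 2 = - s - 1" by (simp add: field_simps)
      have u2: "?u\<^sup>2 = (m - x) powr (- s - 1)" "?v\<^sup>2 = (m + x) powr (- s - 1)"
        by (simp_all only: power2_eq_square ee flip: powr_add)
      have "?u * ?v = ((m - x) * (m + x)) powr (- (s + 1) / 2)"
        using px by (simp add: powr_mult)
      also have "\<dots> \<ge> (m * m) powr (- (s + 1) / 2)"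
      proof (rule powr_mono2')
        show "(m - x) * (m + x) > 0" using px by simp
        show "(m - x) * (m + x) \<le> m * m" by (simp add: algebra_simps)
      qed (use s in simp)
      also have "(m * m) powr (- (s + 1) / 2) = m powr (- s - 1)"
        using m by (simp only: powr_mult less_imp_le ee flip: powr_add)
      finally have "2 * m powr (- s - 1) \<le> 2 * (?u * ?v)" by simp
      also have "\<dots> \<le> ?u\<^sup>2 + ?v\<^sup>2" using sum_squares_bound[of ?u ?v] by (simp add: mult.assoc)
      finally have "s * (2 * m powr (- s - 1)) \<le> s * ((m - x) powr (- s - 1) + (m + x) powr (- s - 1))"
        using s u2 by (intro mult_left_mono) auto
      then show ?thesis by (simp add: algebra_simps)
    qed
    ultimately show "\<exists>y. (?f has_real_derivative y) (at x) \<and> 0 \<le> y" by blast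
  qed
  moreover have "m - d / 2 = a" "m + d / 2 = a + d" by (simp_all add: m_def)
  ultimately show ?thesis by (simp add: m_def ac_simps)
qed

lemma powr_rat_le:
  fixes x y :: real
  assumes "x \<ge> 0" "y \<ge> 0" "n > 0" "x ^ k \<le> y ^ n"
  shows "x powr (real k / real n) \<le> y"
proof (cases "x = 0")
  case False
  then have x: "x > 0" using assms by simp
  have "x powr (real k / real n) = (x powr real k) powr (1 / real n)"
    by (simp add: powr_powr)
  also have "\<dots> = (x ^ k) powr (1 / real n)"
    using x by (simp add: powr_realpow)
  also have "\<dots> \<le> (y ^ n) powr (1 / real n)"
    using assms by (intro powr_mono2) auto
  also have "\<dots> = y"
  proof (cases "y = 0")
    case True then show ?thesis using assms x by (auto simp: power_0_left)
  next
    case False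
    then have "(y ^ n) powr (1 / real n) = (y powr real n) powr (1 / real n)"
      using assms by (simp add: powr_realpow)
    then show ?thesis using assms False by (simp add: powr_powr)
  qed
  finally show ?thesis .
qed (use assms in auto)

lemma powr_int_le:
  fixes a b c d :: int
  assumes "0 \<le> a" "0 < b" "0 \<le> c" "0 < d" "0 < n" and le: "a ^ k * d ^ n \<le> c ^ n * b ^ k"
  shows "(of_int a / of_int b :: real) powr (real k / real n) \<le> of_int c / of_int d"
proof (rule powr_rat_le)
  have "real_of_int (a ^ k * d ^ n) \<le> of_int (c ^ n * b ^ k)"
    using le by (simp only: of_int_le_iff)
  then have "real_of_int a ^ k * of_int d ^ n \<le> of_int c ^ n * of_int b ^ k"
    by simp
  moreover have "real_of_int b ^ k > 0" "real_of_int d ^ n > 0" using assms by auto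
  ultimately show "(of_int a / of_int b :: real) ^ k \<le> (of_int c / of_int d) ^ n"
    by (simp add: power_divide divide_le_eq pos_le_divide_eq)
qed (use assms in auto)

section \<open>Soundness of the upper certificate\<close>

abbreviation "sU \<equiv> 31 / 23 :: real"

fun rv :: "int v4 \<Rightarrow> real v4" where
  "rv (a, b, c, d) = (of_int a, of_int b, of_int c, of_int d)"

lemma mpair_rv [simp]: "mpair (rv v) (rv w) = of_int (mpair v w)"
  by (cases v; cases w) simp

lemma mirror_rv: "mirror l (rv v) = rv (mirror l v)"
  by (cases l; cases v) (simp_all add: Let_def)

lemma kf_rv [simp]: "kf l (rv v) = of_int (kf l v)"
  by (cases l; cases v) simp_all

lemma rv_add: "rv (v + w) = rv v + rv w"
  by (cases v; cases w) simp

lemma rv_nrm: "rv (nrm l) = nrm l"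
  by (cases l) simp_all

lemma rv_capV: "map rv (capV c) = capV c"
  by (simp add: capV_def rv_nrm rv_add comp_def)

lemma rv_exitV: "map rv (exitV c d) = exitV c d"
  unfolding exitV_def map_concat map_map comp_def
  by (intro arg_cong[where f = concat] map_cong refl) (simp add: rv_nrm rv_add)

lemma rv_altern: "rv (altern c d n v) = altern c d n (rv v)"
  by (induction c d n v rule: altern.induct) (simp_all flip: mirror_rv)

lemma dot_covec: "dot v (covec z) = mpair v z"
  by (cases v; cases z) (simp add: algebra_simps)

text \<open>Taking 23rd powers clears the exponent; with \<open>32 = 2 ^ 5\<close> and
  \<open>16384 = 2 ^ 14\<close> the power of two left over is
  \<open>14 * 23 - 5 * 31 = 167\<close>.\<close>

lemma pow_table_check:
  "list_all (\<lambda>k. case pow_table k of (t, s) \<Rightarrow> k ^ 31 * 2 ^ 167 \<le> t ^ 23 \<and> 0 \<le> t \<and> 0 \<le> s \<and>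
     (k < 32 \<longrightarrow> t + s = fst (pow_table (k + 1)))) [0..32]"
  by code_simp

lemma pow_table:
  assumes k: "k \<in> {0..32}" and ts: "pow_table k = (t, s)"
  shows "(of_int k / 32) powr sU \<le> of_int t / 16384" "s \<ge> 0" "t \<ge> 0"
    "k < 32 \<Longrightarrow> t + s = fst (pow_table (k + 1))"
proof -
  have *: "k ^ 31 * 2 ^ 167 \<le> t ^ 23" "0 \<le> t" "0 \<le> s"
     "k < 32 \<longrightarrow> t + s = fst (pow_table (k + 1))"
    using pow_table_check[unfolded list_all_iff, THEN bspec, of k] k by (simp_all add: ts)
  then show "s \<ge> 0" "t \<ge> 0" "k < 32 \<Longrightarrow> t + s = fst (pow_table (k + 1))" by auto
  have "real_of_int (k ^ 31 * 2 ^ 167) \<le> real_of_int (t ^ 23)"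
    using *(1) by (simp only: of_int_le_iff)
  then have "real_of_int k ^ 31 * 2 ^ 167 / 2 ^ 322 \<le> real_of_int t ^ 23 / 2 ^ 322"
    by (intro divide_right_mono) auto
  moreover have "real_of_int k ^ 31 * 2 ^ 167 / 2 ^ 322 = (of_int k / 32) ^ 31"
    by (simp add: power_divide)
  moreover have "real_of_int t ^ 23 / 2 ^ 322 = (of_int t / 16384) ^ 23"
    by (simp add: power_divide)
  ultimately have "(of_int k / 32 :: real) powr (real 31 / real 23) \<le> of_int t / 16384"
    using k *(2) by (intro powr_rat_le) auto
  then show "(of_int k / 32) powr sU \<le> of_int t / 16384" by simp
qed

lemma powbound:
  assumes b: "0 < b" "b \<le> a"
  shows "(of_int b / of_int a) powr sU \<le> of_int (powbound b a) / 16384"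
proof -
  define k where "k = 32 * b div a"
  define r where "r = 32 * b mod a"
  have a: "a > 0" using b by simp
  have kr: "32 * b = a * k + r" "0 \<le> r" "r < a"
    using a by (auto simp: k_def r_def)
  have k0: "0 \<le> k" using a b by (simp add: k_def pos_imp_zdiv_nonneg_iff)
  have "a * k \<le> a * 32" using kr b by linarith
  then have k32: "k \<le> 32" using a by simp
  obtain t s where ts: "pow_table k = (t, s)" by (cases "pow_table k")
  have T: "(of_int k / 32) powr sU \<le> of_int t / 16384" "s \<ge> 0" "t \<ge> 0"
    using pow_table[OF _ ts] k0 k32 by auto
  have pb: "powbound b a = t + s * r div a + 1"
    by (simp add: powbound_def Let_def ts flip: k_def r_def)
  define \<phi> where "\<phi> = (of_int r / of_int a :: real)"
  have \<phi>: "0 \<le> \<phi>" "\<phi> < 1" using kr a by (auto simp: \<phi>_def)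
  have "real_of_int (32 * b) = of_int (a * k + r)" using kr(1) by simp
  then have ba: "of_int b / of_int a = (of_int k + \<phi>) / (32::real)"
    using a by (simp add: \<phi>_def field_simps)
  have "((of_int k + \<phi>) / 32) powr sU \<le> (of_int t + of_int s * \<phi>) / 16384"
  proof (cases "k = 32")
    case True
    then have "r = 0" using kr b a by simp
    then show ?thesis using T True by (simp add: \<phi>_def)
  next
    case False
    then have k: "k < 32" using k32 by simp
    obtain t' s' where ts': "pow_table (k + 1) = (t', s')" by (cases "pow_table (k + 1)")
    have "t' = t + s" using pow_table(4)[OF _ ts] k k0 ts' by simp
    then have T': "(of_int (k + 1) / 32) powr sU \<le> of_int (t + s) / 16384"
      using pow_table(1)[OF _ ts'] k k0 by simp
    show ?thesis
    \<comment> \<open>Convexity is applied between positive nodes only; in the cell at zero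
      \<open>\<phi> powr sU <= \<phi>\<close> does the same service.\<close>
    proof (cases "k = 0")
      case True
      show ?thesis
      proof (cases "\<phi> = 0")
        case True
        then show ?thesis using T by (simp add: \<open>k = 0\<close>)
      next
        case False
        have "\<phi> powr sU \<le> \<phi>"
          using False \<phi> powr_mono'[of 1 sU \<phi>] by simp
        then have "(\<phi> / 32) powr sU \<le> \<phi> * (1 / 32) powr sU"
          using \<phi> by (simp add: powr_divide divide_right_mono)
        also have "\<dots> \<le> \<phi> * (of_int (t + s) / 16384)"
          using T' \<phi> by (intro mult_left_mono) (auto simp: \<open>k = 0\<close>)
        also have "\<dots> \<le> (of_int t + of_int s * \<phi>) / 16384"
        proof -
          have "\<phi> * of_int t \<le> 1 * of_int t"
            using \<phi> T by (intro mult_right_mono) auto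
          then show ?thesis by (simp add: algebra_simps)
        qed
        finally show ?thesis by (simp add: \<open>k = 0\<close>)
      qed
    next
      case False
      then have kp: "k > 0" using k0 by simp
      have "((1 - \<phi>) *\<^sub>R (of_int k / 32) + \<phi> *\<^sub>R (of_int (k + 1) / 32)) powr sU \<le>
          (1 - \<phi>) * (of_int k / 32) powr sU + \<phi> * (of_int (k + 1) / 32) powr sU"
        using powr_convex[of sU, unfolded convex_on_def, THEN conjunct2, rule_format,
          of "of_int k / 32" "of_int (k + 1) / 32" "1 - \<phi>" \<phi>] kp \<phi> by auto
      also have "\<dots> \<le> (1 - \<phi>) * (of_int t / 16384) + \<phi> * (of_int (t + s) / 16384)"
        using T T' \<phi> by (intro add_mono mult_left_mono) auto
      also have "(1 - \<phi>) *\<^sub>R (of_int k / 32) + \<phi> *\<^sub>R (of_int (k + 1) / 32) = (of_int k + \<phi>) / (32::real)"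
        by (simp add: field_simps)
      finally show ?thesis by (simp add: field_simps)
    qed
  qed
  also have "of_int s * \<phi> \<le> of_int (s * r div a) + 1"
  proof -
    have "real_of_int (s * r) / of_int a \<le> of_int (s * r div a) + 1"
      using floor_divide_of_int_eq[of "s * r" a, where ?'a = real] by linarith
    then show ?thesis by (simp add: \<phi>_def)
  qed
  then have "(of_int t + of_int s * \<phi>) / 16384 \<le> of_int (powbound b a) / (16384 :: real)"
    by (simp add: pb)
  finally show ?thesis by (simp add: ba)
qed

text \<open>The inequality for the weights multiplied by the parent's pairing: in this form it is
  homogeneous of degree one in \<open>p\<close> and additive by
  \<open>powr_ratio_add\<close>.\<close>

definition good :: "letter \<Rightarrow> real v4 \<Rightarrow> real v4 list \<Rightarrow> real v4 set" where
  "good c z ws = {p. 0 < mpair p z \<and> mpair p z \<le> - 12600 * kf c p \<and>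
     (\<forall>w\<in>set ws. 0 < mpair p w) \<and>
     sum_list (map (\<lambda>w. mpair p z * (mpair p z / mpair p w) powr sU) ws) \<le> mpair p z}"

lemma good_scale:
  assumes "p \<in> good c z ws" "t > 0" shows "t *\<^sub>R p \<in> good c z ws"
proof -
  have "sum_list (map (\<lambda>w. t * (mpair p z * (mpair p z / mpair p w) powr sU)) ws) \<le> t * mpair p z"
    using assms by (simp add: sum_list_const_mult good_def)
  moreover have "t * mpair p z \<le> t * (- 12600 * kf c p)"
    using assms by (intro mult_left_mono) (auto simp: good_def)
  ultimately show ?thesis
    using assms by (simp add: good_def mpair_scale_left kf_scale mult.assoc mult.left_commute)
qed

lemma good_add:
  assumes p: "p \<in> good c z ws" and p': "p' \<in> good c z ws" shows "p + p' \<in> good c z ws"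
proof -
  have pos: "mpair p z > 0" "mpair p' z > 0" using p p' by (auto simp: good_def)
  have posw: "mpair p w > 0" "mpair p' w > 0" if "w \<in> set ws" for w
    using p p' that by (auto simp: good_def)
  have "sum_list (map (\<lambda>w. mpair (p + p') z * (mpair (p + p') z / mpair (p + p') w) powr sU) ws) \<le>
      sum_list (map (\<lambda>w. mpair p z * (mpair p z / mpair p w) powr sU +
        mpair p' z * (mpair p' z / mpair p' w) powr sU) ws)"
    unfolding mpair_add_left by (intro sum_list_mono powr_ratio_add pos posw) auto
  also have "\<dots> \<le> mpair p z + mpair p' z"
    using p p' by (simp add: good_def sum_list_addf)
  finally have "sum_list (map (\<lambda>w. mpair (p + p') z *
      (mpair (p + p') z / mpair (p + p') w) powr sU) ws) \<le> mpair (p + p') z"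
    by (simp only: mpair_add_left)
  moreover have "mpair (p + p') z \<le> - 12600 * kf c (p + p')"
    using p p' by (simp add: good_def mpair_add_left kf_add)
  moreover have "mpair (p + p') w > 0" if "w \<in> set ws" for w
    using posw[OF that] by (simp add: mpair_add_left)
  moreover have "mpair (p + p') z > 0" using pos by (simp add: mpair_add_left)
  ultimately show ?thesis unfolding good_def by blast
qed

lemma good_ccone:
  assumes "p \<in> ccone P" and P: "P \<subseteq> good c z ws" shows "p \<in> good c z ws"
  using assms(1)
proof (induction rule: ccone.induct)
  case (base v t)
  then show ?case using P by (intro good_scale) auto
next
  case (add x y)
  then show ?case by (intro good_add)
qed

lemma checkU2_good:
  assumes "checkU2 c (covec z) (map covec ws) v"
  shows "rv v \<in> good c (rv z) (map rv ws)"
proof -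
  let ?b = "mpair v z"
  have C: "0 < ?b" "?b \<le> - 12600 * kf c v" "\<forall>w\<in>set ws. ?b \<le> mpair v w"
    "sum_list (map (\<lambda>w. powbound ?b (mpair v w)) ws) \<le> 16384"
    using assms by (auto simp: checkU2_def Let_def dot_covec list_all_iff comp_def)
  have "sum_list (map (\<lambda>w. (of_int ?b / of_int (mpair v w)) powr sU) ws) \<le>
      sum_list (map (\<lambda>w. of_int (powbound ?b (mpair v w)) / 16384) ws)"
    using C by (intro sum_list_mono powbound) auto
  also have "\<dots> = of_int (sum_list (map (\<lambda>w. powbound ?b (mpair v w)) ws)) / 16384"
    by (induction ws) (simp_all add: add_divide_distrib)
  also have "\<dots> \<le> 1"
  proof -
    have "real_of_int (sum_list (map (\<lambda>w. powbound ?b (mpair v w)) ws)) \<le> of_int 16384"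
      using C(4) by (simp only: of_int_le_iff)
    then show ?thesis by simp
  qed
  finally have "of_int ?b * sum_list (map (\<lambda>w. (of_int ?b / of_int (mpair v w)) powr sU) ws) \<le> of_int ?b * 1"
    using C(1) by (intro mult_left_mono) auto
  then have "sum_list (map (\<lambda>w. of_int ?b * (of_int ?b / of_int (mpair v w)) powr sU) ws) \<le> of_int ?b"
    by (simp add: sum_list_const_mult)
  moreover have "real_of_int ?b \<le> of_int (- 12600 * kf c v)"
    using C(2) by (simp only: of_int_le_iff)
  moreover have "0 < real_of_int (mpair v w)" if "w \<in> set ws" for w
    using C(1,3) that by fastforce
  ultimately show ?thesis
    using C(1) by (simp add: good_def comp_def)
qed

lemma checkU1_good:
  assumes c: "checkU1 c z zs vs" and p: "p \<in> ccone (rv ` set vs)"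
  shows "p \<in> good c (rv z) (map (\<lambda>(x, z'). rv (mirror x z')) zs)"
proof -
  define ws where "ws = map (\<lambda>(x, z'). mirror x z') zs"
  have eq: "map (\<lambda>(x, z'). covec (mirror x z')) zs = map covec ws"
    "map (\<lambda>(x, z'). rv (mirror x z')) zs = map rv ws"
    by (simp_all add: ws_def case_prod_unfold comp_def)
  have "rv v \<in> good c (rv z) (map rv ws)" if "v \<in> set vs" for v
    using c that unfolding checkU1_def eq(1) list_all_iff by (intro checkU2_good) (rule bspec)
  then show ?thesis unfolding eq(2) by (intro good_ccone[OF p] image_subsetI)
qed

lemma good_powr:
  assumes "p \<in> good c z ws"
  shows "sum_list (map (\<lambda>w. mpair p w powr (- sU)) ws) \<le> mpair p z powr (- sU)"
proof -
  let ?b = "mpair p z"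
  have b: "?b > 0" and w: "\<And>w. w \<in> set ws \<Longrightarrow> mpair p w > 0"
    and le: "sum_list (map (\<lambda>w. ?b * (?b / mpair p w) powr sU) ws) \<le> ?b"
    using assms by (auto simp: good_def)
  have eq: "map (\<lambda>w. ?b * (?b / mpair p w) powr sU) ws =
      map (\<lambda>w. (?b * ?b powr sU) * mpair p w powr (- sU)) ws"
  proof (intro map_cong HOL.refl)
    fix w assume "w \<in> set ws"
    then have "mpair p w > 0" by (rule w)
    then show "?b * (?b / mpair p w) powr sU = (?b * ?b powr sU) * mpair p w powr (- sU)"
      using b by (simp add: powr_divide powr_minus_divide)
  qed
  have "(?b * ?b powr sU) * sum_list (map (\<lambda>w. mpair p w powr (- sU)) ws) \<le> ?b"
    using le unfolding eq sum_list_const_mult .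
  then have "?b powr sU * sum_list (map (\<lambda>w. mpair p w powr (- sU)) ws) \<le> 1"
    using b by (simp add: mult.assoc)
  then show ?thesis
    using b by (simp add: powr_minus_divide pos_le_divide_eq mult.commute)
qed

section \<open>The upper weight of a word\<close>

text \<open>Table entry 0 belongs to run length 3, hence the shift; the cap 8 selects the entry
  shared by all long runs.\<close>

fun zU :: "letter list \<Rightarrow> int v4" where
  "zU (c # d # y # us) = (if y = c \<and> \<not> opp c d
     then runU c d ! (min (run (c # d # y # us)) 8 - 3) else startU c d y)"
| "zU _ = (0, 0, 0, 0)"

definition FU :: "letter list \<Rightarrow> real" where
  "FU ws = mpair (pt ws) (rv (zU ws)) powr (- sU)"

definition starts :: "letter \<Rightarrow> (letter \<times> letter) list" where
  "starts c = filter (\<lambda>(d, y). d \<noteq> c \<and> y \<noteq> d \<and> (y = c \<longrightarrow> opp c d)) (List.product letters letters)"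

lemma checkU_starts_N1: "list_all (\<lambda>(d, y). checkU_start N1 d y) (starts N1)"
  by code_simp
lemma checkU_starts_N2: "list_all (\<lambda>(d, y). checkU_start N2 d y) (starts N2)"
  by code_simp
lemma checkU_starts_N3: "list_all (\<lambda>(d, y). checkU_start N3 d y) (starts N3)"
  by code_simp
lemma checkU_starts_N4: "list_all (\<lambda>(d, y). checkU_start N4 d y) (starts N4)"
  by code_simp
lemma checkU_starts_N5: "list_all (\<lambda>(d, y). checkU_start N5 d y) (starts N5)"
  by code_simp
lemma checkU_runs_N1: "list_all (checkU_runs N1) [N2, N3, N5]"
  by code_simp
lemma checkU_runs_N2: "list_all (checkU_runs N2) [N1, N3, N4]"
  by code_simp
lemma checkU_runs_N3: "list_all (checkU_runs N3) [N1, N2, N4, N5]"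
  by code_simp
lemma checkU_runs_N4: "list_all (checkU_runs N4) [N2, N3, N5]"
  by code_simp
lemma checkU_runs_N5: "list_all (checkU_runs N5) [N1, N3, N4]"
  by code_simp

lemma checkU_start:
  assumes "d \<noteq> c" "y \<noteq> d" "y = c \<Longrightarrow> opp c d"
  shows "checkU_start c d y"
proof -
  have "(d, y) \<in> set (starts c)" using assms by (auto simp: starts_def)
  moreover have "list_all (\<lambda>(d, y). checkU_start c d y) (starts c)"
    using checkU_starts_N1 checkU_starts_N2 checkU_starts_N3 checkU_starts_N4 checkU_starts_N5
    by (cases c) simp_all
  ultimately show ?thesis by (auto simp: list_all_iff)
qed

lemma checkU_runs:
  assumes "d \<noteq> c" "\<not> opp c d"
  shows "checkU_runs c d"
  using assms checkU_runs_N1 checkU_runs_N2 checkU_runs_N3 checkU_runs_N4 checkU_runs_N5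
  by (cases c; cases d) simp_all

lemma length_runU: "c \<noteq> d \<Longrightarrow> \<not> opp c d \<Longrightarrow> length (runU c d) = 6"
  by (cases c; cases d) (simp_all add: runU_def)

lemma checkU_run_nth:
  assumes "checkU_run c d ex zs zs' (map (altern c d r) E) (map (altern d c r) E)"
    "n < length zs'" "n < length zs"
  shows "checkU1 c (zs ! n) ((d, zs' ! n) # ex) (map (altern c d (r + n)) E)"
  using assms
proof (induction n arbitrary: zs zs' r)
  case 0
  then show ?case by (cases zs'; cases zs) auto
next
  case (Suc n)
  then obtain z' zt' z zt where zs: "zs' = z' # zt'" "zs = z # zt"
    by (cases zs'; cases zs) auto
  have m: "map (mirror c) (map (altern d c r) E) = map (altern c d (Suc r)) E"
    "map (mirror d) (map (altern c d r) E) = map (altern d c (Suc r)) E"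
    by simp_all
  have "checkU_run c d ex zt zt' (map (altern c d (Suc r)) E) (map (altern d c (Suc r)) E)"
    using Suc.prems(1) unfolding zs by (simp only: checkU_run.simps m list.sel)
  from Suc.IH[OF this] Suc.prems(2,3) show ?case by (simp add: zs)
qed

definition kids :: "letter \<Rightarrow> letter \<Rightarrow> letter list" where
  "kids c d = d # filter (\<lambda>x. x \<noteq> c \<and> x \<noteq> d) letters"

lemma sum_kids:
  fixes f :: "letter \<Rightarrow> real"
  assumes "c \<noteq> d"
  shows "sum_list (map f (kids c d)) = (\<Sum>x\<in>- {c}. f x)"
proof -
  have "distinct letters" by (simp add: letters_def)
  then have "distinct (kids c d)" by (simp add: kids_def)
  then have "sum_list (map f (kids c d)) = sum f (set (kids c d))"
    by (rule sum_list_distinct_conv_sum_set)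
  also have "set (kids c d) = - {c}" using assms by (auto simp: kids_def)
  finally show ?thesis .
qed

lemma FU_step_gen:
  assumes "c \<noteq> d" "checkU1 c (zU (c # d # us)) (map (\<lambda>x. (x, zU (x # c # d # us))) (kids c d)) vs"
    "pt (c # d # us) \<in> ccone (rv ` set vs)"
  shows "mpair (pt (c # d # us)) (rv (zU (c # d # us))) > 0"
    "mpair (pt (c # d # us)) (rv (zU (c # d # us))) \<le> - 12600 * kf c (pt (c # d # us) :: real v4)"
    "(\<Sum>x\<in>- {c}. FU (x # c # d # us)) \<le> FU (c # d # us)"
proof -
  let ?p = "pt (c # d # us) :: real v4"
  have g: "?p \<in> good c (rv (zU (c # d # us))) (map (\<lambda>x. rv (mirror x (zU (x # c # d # us)))) (kids c d))"
    using checkU1_good[OF assms(2,3)] by (simp only: map_map comp_def prod.case)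
  then show "mpair ?p (rv (zU (c # d # us))) > 0"
    "mpair ?p (rv (zU (c # d # us))) \<le> - 12600 * kf c ?p"
    unfolding good_def by blast+
  have "FU (x # c # d # us) = mpair ?p (rv (mirror x (zU (x # c # d # us)))) powr (- sU)" for x
    by (simp add: FU_def mpair_mirror mirror_rv)
  then have "(\<Sum>x\<in>- {c}. FU (x # c # d # us)) =
      sum_list (map (\<lambda>x. mpair ?p (rv (mirror x (zU (x # c # d # us)))) powr (- sU)) (kids c d))"
    using sum_kids[OF assms(1)] by simp
  also have "\<dots> \<le> FU (c # d # us)"
    using good_powr[OF g] by (simp only: FU_def map_map comp_def)
  finally show "(\<Sum>x\<in>- {c}. FU (x # c # d # us)) \<le> FU (c # d # us)" .
qed

lemma kids_zU:
  assumes cd: "c \<noteq> d" and y: "y \<noteq> d"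
  shows "map (\<lambda>x. (x, zU (x # c # d # y # us))) (kids c d) =
     (d, zU (d # c # d # y # us)) # exitsU c d"
  by (auto simp: kids_def exitsU_def)

text \<open>Here the finite certificate applies: tangent runs shorter than 8 are read off
  \<open>checkU_runs\<close> with the exit cone, all other words off
  \<open>checkU_start\<close>.\<close>

lemma FU_step_short:
  assumes v: "valid (c # d # y # us)" and s: "y = c \<Longrightarrow> opp c d \<or> run (c # d # y # us) < 8"
  shows "mpair (pt (c # d # y # us)) (rv (zU (c # d # y # us))) > 0" (is ?A)
    "mpair (pt (c # d # y # us)) (rv (zU (c # d # y # us))) \<le>
       - 12600 * kf c (pt (c # d # y # us) :: real v4)" (is ?B)
    "(\<Sum>x\<in>- {c}. FU (x # c # d # y # us)) \<le> FU (c # d # y # us)" (is ?C)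
proof -
  have cd: "c \<noteq> d" and dy: "y \<noteq> d" using v by auto
  have "?A \<and> ?B \<and> ?C"
  proof (cases "y = c \<and> \<not> opp c d")
    case False
    let ?vs = "map (\<lambda>v. mirror c (mirror d (mirror y v))) (capV y)"
    have run2: "run (d # c # d # y # us) - 3 = 0 \<or> opp c d"
      using False by (auto simp: run_Cons)
    have zd: "zU (d # c # d # y # us) = (if opp c d then startU d c d else hd (runU d c))"
    proof (cases "opp c d")
      case True
      then show ?thesis by (simp add: opp_sym)
    next
      case o: False
      then have "y \<noteq> c" using False by simp
      moreover have "length (runU d c) = 6" using length_runU[of d c] cd o opp_sym by blast
      then have "hd (runU d c) = runU d c ! 0" by (intro hd_conv_nth) auto
      ultimately show ?thesis using o opp_sym[of c d] by (simp add: eval_nat_numeral)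
    qed
    have chk: "checkU1 c (zU (c # d # y # us)) (map (\<lambda>x. (x, zU (x # c # d # y # us))) (kids c d)) ?vs"
      using checkU_start[of d c y] cd dy False
      unfolding kids_zU[OF cd dy] zd checkU_start_def by auto
    have "pt us \<in> ccone (set (capV y))"
      using v by (intro pt_capV_tl) (auto dest!: valid_tl)
    then have "mirror c (mirror d (mirror y (pt us))) \<in> ccone ((\<lambda>v. mirror c (mirror d (mirror y v))) ` set (capV y))"
      by (rule ccone_image) (simp_all add: mirror_add mirror_scale)
    moreover have "rv ` set ?vs = (\<lambda>v. mirror c (mirror d (mirror y v))) ` set (capV y)"
    proof -
      have "rv ` set ?vs = (\<lambda>v. mirror c (mirror d (mirror y v))) ` set (map rv (capV y))"
        by (simp add: image_image mirror_rv)
      then show ?thesis by (simp only: rv_capV)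
    qed
    ultimately have "pt (c # d # y # us) \<in> ccone (rv ` set ?vs)" by simp
    from FU_step_gen[OF cd chk this] show ?thesis by blast
  next
    case True
    then have yc: "y = c" and o: "\<not> opp c d" by auto
    let ?r = "run (c # d # y # us)"
    have r: "?r \<ge> 3" "?r < 8"
      using s o run_ge[of "d # y # us"] by (auto simp: yc)
    let ?vs = "map (altern c d ?r) (exitV c d)"
    have len: "length (runU c d) = 6" "length (runU d c) = 6"
      using length_runU[of c d] length_runU[of d c] cd o opp_sym by blast+
    have zd: "zU (d # c # d # y # us) = tl (runU d c) ! (?r - 3)"
    proof -
      have o': "\<not> opp d c" using o opp_sym by blast
      have a1: "run (d # c # d # y # us) = Suc ?r" by (simp add: yc)
      have a2: "min (Suc ?r) 8 - 3 = Suc (?r - 3)" using r by simp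
      have a3: "zU (d # c # d # y # us) = runU d c ! (min (run (d # c # d # y # us)) 8 - 3)"
        by (simp only: zU.simps o' simp_thms if_True)
      have a4: "tl (runU d c) ! (?r - 3) = runU d c ! Suc (?r - 3)"
        using r len by (intro nth_tl) auto
      show ?thesis by (simp only: a1 a2 a3 a4)
    qed
    have "checkU1 c (runU c d ! (?r - 3)) ((d, tl (runU d c) ! (?r - 3)) # exitsU c d)
        (map (altern c d (3 + (?r - 3))) (exitV c d))"
      using checkU_runs[of d c] cd o r len unfolding checkU_runs_def
      by (intro checkU_run_nth) auto
    then have chk: "checkU1 c (zU (c # d # y # us)) (map (\<lambda>x. (x, zU (x # c # d # y # us))) (kids c d)) ?vs"
      unfolding kids_zU[OF cd dy] zd using r o yc by simp
    obtain p where p: "p \<in> ccone (set (exitV c d))" "pt (c # d # y # us) = altern c d ?r p"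
      using pt_altern[OF v] by blast
    have "altern c d ?r p \<in> ccone (altern c d ?r ` set (exitV c d))"
      by (rule ccone_image[OF p(1)]) (simp_all add: altern_add altern_scale)
    moreover have "rv ` set ?vs = altern c d ?r ` set (exitV c d)"
    proof -
      have "rv ` set ?vs = altern c d ?r ` set (map rv (exitV c d))"
        by (simp add: image_image rv_altern)
      then show ?thesis by (simp only: rv_exitV)
    qed
    ultimately have "pt (c # d # y # us) \<in> ccone (rv ` set ?vs)" by (simp only: p(2))
    from FU_step_gen[OF cd chk this] show ?thesis by blast
  qed
  then show ?A ?B ?C by blast+
qed

section \<open>Long alternating runs\<close>

text \<open>In signature (1,3) the orthogonal complement of a nonzero light vector is negative
  semidefinite; the second condition on \<open>t\<close> only expresses that it is nonzero.\<close>

lemma orthogonal_light: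
  assumes t: "mpair t t = 0" "kap t \<noteq> 0 \<or> ccm t \<noteq> 0" and a: "mpair a t = 0"
  shows "mpair a a \<le> 0"
proof (cases "kap t = 0")
  case True
  have "(ccx t)\<^sup>2 + (ccy t)\<^sup>2 = kap t * ccm t" using t(1) by (simp add: mpair_circle)
  then have "(ccx t)\<^sup>2 + (ccy t)\<^sup>2 = 0" by (simp only: True mult_zero_left)
  then have "ccx t = 0" "ccy t = 0"
    using sum_power2_eq_zero_iff[of "ccx t" "ccy t"] by blast+
  then have "kap a = 0" using a t(2) True by (simp add: mpair_circle2)
  then show ?thesis by (simp add: mpair_circle)
next
  case False
  have e1: "(ccx t)\<^sup>2 + (ccy t)\<^sup>2 = kap t * ccm t" using t(1) by (simp add: mpair_circle)
  have e2: "kap a * ccm t + kap t * ccm a = 2 * (ccx a * ccx t + ccy a * ccy t)"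
    using a unfolding mpair_circle2 by (simp add: field_simps)
  have "(kap t)\<^sup>2 * mpair a a = kap t * kap a * (kap t * ccm a) - (kap t)\<^sup>2 * ((ccx a)\<^sup>2 + (ccy a)\<^sup>2)"
    by (simp add: mpair_circle power2_eq_square algebra_simps)
  also have "kap t * ccm a = 2 * (ccx a * ccx t + ccy a * ccy t) - kap a * ccm t"
    using e2 by simp
  also have "kap t * kap a * \<dots> - (kap t)\<^sup>2 * ((ccx a)\<^sup>2 + (ccy a)\<^sup>2) =
      2 * kap t * kap a * (ccx a * ccx t + ccy a * ccy t) - (kap a)\<^sup>2 * (kap t * ccm t)
      - (kap t)\<^sup>2 * ((ccx a)\<^sup>2 + (ccy a)\<^sup>2)"
    by (simp add: power2_eq_square algebra_simps)
  also have "\<dots> = - ((kap t * ccx a - kap a * ccx t)\<^sup>2 + (kap t * ccy a - kap a * ccy t)\<^sup>2)"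
    unfolding e1[symmetric] by (simp add: power2_eq_square algebra_simps)
  finally have "(kap t)\<^sup>2 * mpair a a \<le> 0" by simp
  moreover have "(kap t)\<^sup>2 > 0" using False by simp
  ultimately show ?thesis by (simp add: mult_le_0_iff)
qed

text \<open>The light vector \<open>t = nrm c + nrm d\<close> is the cusp, and
  \<open>w = nrm d - nrm c\<close> is orthogonal to it. So is \<open>a = D u - U p\<close>; removing
  its component along \<open>w\<close> leaves a vector of nonpositive square. The result bounds the
  pairing with an exit vector below by a quadratic in \<open>H\<close>.\<close>

lemma run_pairing_bound:
  fixes p u :: "real v4"
  assumes cd: "c \<noteq> d" "\<not> opp c d" and p: "mpair p p = 0"
  defines "D \<equiv> mpair p (nrm c + nrm d)" and "H \<equiv> mpair p (nrm d - nrm c)"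
  defines "U \<equiv> mpair u (nrm c + nrm d)" and "X \<equiv> mpair u (nrm d - nrm c)"
  shows "(U * H - D * X)\<^sup>2 + 32 * D\<^sup>2 * mpair u u \<le> 64 * D * U * mpair p u"
proof -
  define t w where "t = (nrm c + nrm d :: real v4)" and "w = (nrm d - nrm c :: real v4)"
  have nn: "mpair (nrm c) (nrm c) = (- 8 :: real)" "mpair (nrm d) (nrm d) = (- 8 :: real)"
    "mpair (nrm c) (nrm d) = (8 :: real)"
    using cd by (cases c; cases d; simp)+
  have tw: "mpair t t = 0" "mpair w t = 0" "mpair w w = - 32"
    by (simp_all add: t_def w_def mpair_add mpair_add_left mpair_diff mpair_diff_left nn
        mpair_comm[of "nrm d" "nrm c"])
  have tw4: "kap t \<noteq> 0 \<or> ccm t \<noteq> 0"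
    using cd by (cases c; cases d; simp add: t_def kap_eq ccm_def)
  define a where "a = D *\<^sub>R u - U *\<^sub>R p"
  define b where "b = a + (mpair a w / 32) *\<^sub>R w"
  have pt: "mpair p t = D" "mpair u t = U" "mpair p w = H" "mpair u w = X"
    by (simp_all add: D_def U_def H_def X_def t_def w_def)
  have at: "mpair a t = 0"
    by (simp add: a_def mpair_diff_left mpair_scale_left pt)
  have bt: "mpair b t = 0"
    by (simp add: b_def mpair_add_left mpair_scale_left at tw)
  have "mpair b b = mpair a a + 2 * (mpair a w / 32) * mpair a w + (mpair a w / 32)\<^sup>2 * mpair w w"
    by (simp add: b_def mpair_add_left mpair_scale_left mpair_add mpair_scale power2_eq_square
        mpair_comm[of w a] field_simps)
  also have "\<dots> = mpair a a + (mpair a w)\<^sup>2 / 32"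
    by (simp add: tw(3) power2_eq_square)
  finally have le: "mpair a a + (mpair a w)\<^sup>2 / 32 \<le> 0"
    using orthogonal_light[OF tw(1) tw4 bt] by simp
  have aa: "mpair a a = D\<^sup>2 * mpair u u - 2 * D * U * mpair p u"
    unfolding a_def mpair_diff_left mpair_diff mpair_scale_left mpair_scale mpair_comm[of u p] p
    by (simp add: power2_eq_square algebra_simps)
  have aw: "mpair a w = D * X - U * H"
    by (simp add: a_def mpair_diff_left mpair_scale_left pt)
  show ?thesis
    using le unfolding aa aw by (simp add: power2_commute[of "U * H"])
qed

text \<open>The coefficients \<open>C\<close> and \<open>B\<close> of the long-run vector in terms
  of \<open>nrm c\<close> and the cusp \<open>nrm c + nrm d\<close>.\<close>

definition coeffLR :: "letter \<Rightarrow> letter \<Rightarrow> int \<times> int" where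
  "coeffLR c d = (if c = N3 \<or> d = N3 then (12176, 11771) else (14562, 14078))"

text \<open>\<open>V / 225\<close> bounds the quadratic of \<open>run_pairing_bound\<close>, divided
  by \<open>H^2\<close>, from below as long as \<open>D / H\<close> is at most
  \<open>1 / 15\<close>. The last bound says that the exits together cost at most
  \<open>24133 / 16384 < 1473 / 1000\<close> units.\<close>

definition checkLR :: "letter \<Rightarrow> letter \<Rightarrow> bool" where
  "checkLR c d = (let (C, B) = coeffLR c d; t = nrm c + nrm d; w = nrm d - nrm c;
     us = map (\<lambda>(y, z). mirror y z) (exitsU c d) in
     runU c d ! 5 = - smul C (nrm c) - smul B t \<and>
     list_all (\<lambda>u. let U = mpair u t; X = mpair u w;
       V = 225 * U * U - 30 * max (U * X) 0 + min 0 (X * X + 32 * mpair u u) in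
       0 < U \<and> 0 < 1800 * C * U \<and> 1800 * C * U \<le> V) us \<and>
     sum_list (map (\<lambda>u. let U = mpair u t; X = mpair u w;
       V = 225 * U * U - 30 * max (U * X) 0 + min 0 (X * X + 32 * mpair u u) in
       powbound (1800 * C * U) V) us) \<le> 24133)"

lemma checkLR: "list_all (\<lambda>(c, d). c = d \<or> opp c d \<or> checkLR c d) (List.product letters letters)"
  by code_simp

text \<open>The left side increases in \<open>\<rho>\<close> by weighted AM-GM with weights \<open>8/62\<close> and \<open>54/62\<close>.\<close>

lemma run_rate:
  fixes \<rho> :: real
  assumes r: "0 < \<rho>" "\<rho> \<le> 1 / 15"
  shows "\<rho> powr (8 / 23) * (1 - 27 / 14 * \<rho>) powr (54 / 23) * (1473 / 1000) \<le> 2 * sU * 4 powr (- sU)"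
proof -
  have num: "(1 :: int) ^ 8 * 100 ^ 23 \<le> 39 ^ 23 * 15 ^ 8"
    "(61 :: int) ^ 54 * 250 ^ 23 \<le> 181 ^ 23 * 70 ^ 54"
    "(4 :: int) ^ 31 * 25 ^ 23 \<le> 162 ^ 23 * 1 ^ 31"
    by code_simp+
  \<comment> \<open>Scaled so that \<open>x = y = 1\<close> at the endpoint \<rho> =
    \<open>1 / 15\<close>. The exponents \<open>8 / 23\<close> and \<open>54 / 23\<close> are
    \<open>sU - 1\<close> and \<open>sU + 1\<close>.\<close>
  define x where "x = 15 * \<rho>"
  define y where "y = (1 - 27 / 14 * \<rho>) / (61 / 70)"
  have xy: "x > 0" "y > 0" using r by (auto simp: x_def y_def)
  have "x powr (8 / 62) * y powr (54 / 62) \<le> 8 / 62 * x + 54 / 62 * y"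
    using Youngs_inequality_0[of "8 / 62" "54 / 62" x y] xy by simp
  also have "\<dots> \<le> 1" using r by (simp add: x_def y_def field_simps)
  finally have "(x powr (8 / 62) * y powr (54 / 62)) powr (62 / 23) \<le> 1 powr (62 / 23)"
    by (intro powr_mono2) auto
  then have "x powr (8 / 23) * y powr (54 / 23) \<le> 1"
    using xy by (simp add: powr_mult powr_powr)
  moreover have "\<rho> = x * (1 / 15)" "1 - 27 / 14 * \<rho> = y * (61 / 70)"
    by (simp_all add: x_def y_def)
  then have "\<rho> powr (8 / 23) * (1 - 27 / 14 * \<rho>) powr (54 / 23) =
      (x powr (8 / 23) * y powr (54 / 23)) * ((1 / 15) powr (8 / 23) * (61 / 70) powr (54 / 23))"
    using xy by (simp only: powr_mult) (simp add: mult_ac)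
  ultimately have "\<rho> powr (8 / 23) * (1 - 27 / 14 * \<rho>) powr (54 / 23) \<le>
      1 * ((1 / 15) powr (8 / 23) * (61 / 70) powr (54 / 23))"
    by (simp only:) (intro mult_right_mono, auto)
  also have "\<dots> \<le> 2 * sU * 4 powr (- sU) / (1473 / 1000)"
  proof -
    have a: "(1 / 15 :: real) powr (8 / 23) \<le> 39 / 100"
      using powr_int_le[of 1 15 39 100 23 8] num(1) by simp
    have b: "(61 / 70 :: real) powr (54 / 23) \<le> 181 / 250"
      using powr_int_le[of 61 70 181 250 23 54] num(2) by simp
    have c: "(4 :: real) powr (31 / 23) \<le> 162 / 25"
      using powr_int_le[of 4 1 162 25 23 31] num(3) by simp
    have "(1 / 15 :: real) powr (8 / 23) * (61 / 70) powr (54 / 23) \<le> 39 / 100 * (181 / 250)"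
      using a b by (intro mult_mono) auto
    also have "\<dots> \<le> 2 * sU / (162 / 25) / (1473 / 1000)" by simp
    also have "\<dots> \<le> 2 * sU / 4 powr sU / (1473 / 1000)"
      using c by (intro divide_right_mono divide_left_mono) auto
    also have "\<dots> = 2 * sU * 4 powr (- sU) / (1473 / 1000)"
      by (simp only: powr_minus_divide times_divide_eq_right mult_1_right)
    finally show ?thesis by simp
  qed
  finally show ?thesis by (simp add: pos_le_divide_eq)
qed

text \<open>Reflections of the run preserve \<open>kf c + kf d\<close>, and each one raises the
  curvature by exactly this amount.\<close>

lemma run_depth:
  assumes "valid (c # d # us)" "\<not> opp c d"
  shows "- kf c (pt (c # d # us)) \<ge>
     real (run (c # d # us) - 1) * (kf c (pt (c # d # us)) + kf d (pt (c # d # us)))"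
  using assms
proof (induction us arbitrary: c d)
  case Nil
  let ?q = "pt [d] :: real v4"
  have v: "valid [d]" "d \<noteq> c" "\<not> opp d c" using Nil opp_sym by auto
  have e: "pt [c, d] = mirror c ?q" by (simp only: act_simps)
  have "kf d (mirror c ?q) = kf d ?q + 2 * kf c ?q"
    using kf_mirror[OF v(2), of ?q] v(3) by (simp only: if_False)
  moreover have "kf d ?q \<le> 0"
  proof -
    have "kf d ?q \<le> - 4 * real (length [d])" using pt_kf[OF v(1)] by blast
    then show ?thesis by (simp del: act_simps)
  qed
  moreover have "run [c, d] - 1 = 1" by simp
  ultimately show ?case
    unfolding e kf_mirror_same by (simp only: of_nat_1 mult_1; linarith)
next
  case (Cons y us)
  let ?q = "pt (d # y # us) :: real v4"
  have v: "valid (d # y # us)" "c \<noteq> d" "\<not> opp d c" using Cons.prems opp_sym by auto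
  have e: "pt (c # d # y # us) = mirror c ?q" by (simp only: act_simps)
  have kd: "kf d (mirror c ?q) = kf d ?q + 2 * kf c ?q"
    using kf_mirror[OF v(2)[symmetric], of ?q] v(3) by (simp only: if_False)
  show ?case
  proof (cases "y = c")
    case True
    have IH: "- kf d ?q \<ge> real (run (d # y # us) - 1) * (kf d ?q + kf c ?q)"
      using Cons.IH[OF v(1)] v(3) unfolding True by blast
    have r: "real (run (c # d # y # us) - 1) = real (run (d # y # us) - 1) + 1"
      using run_ge[of "d # y # us"] True by (simp add: of_nat_diff)
    show ?thesis
      unfolding e kf_mirror_same kd r using IH by (simp add: distrib_right distrib_left del: act_simps)
  next
    case False
    have "kf d ?q \<le> - 4 * real (length (d # y # us))" using pt_kf[OF v(1)] by blast
    then have "kf d ?q \<le> 0" by (simp del: act_simps)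
    moreover have "run (c # d # y # us) - 1 = 1" using False by simp
    ultimately show ?thesis
      unfolding e kf_mirror_same kd by (simp only: of_nat_1 mult_1; linarith)
  qed
qed

lemma coeffLR_commute: "coeffLR c d = coeffLR d c"
  by (auto simp: coeffLR_def)

lemma coeffLR_bounds: "coeffLR c d = (C, B) \<Longrightarrow> 0 < C \<and> 0 < B \<and> B \<le> C \<and> 27 * C \<le> 28 * B \<and> C \<le> 15000"
  by (auto simp: coeffLR_def split: if_splits)

lemma smul_rv: "rv (smul t v) = of_int t *\<^sub>R rv v"
  by (cases v) simp

lemma rv_diff: "rv (v - w) = rv v - rv w"
  by (cases v; cases w) simp

lemma rv_uminus: "rv (- w) = - rv w"
  by (cases w) simp

lemma mpair_uminus: "mpair x (- y) = - mpair x y"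
  by (cases x; cases y) (simp add: algebra_simps)

lemma runU_long:
  assumes "c \<noteq> d" "\<not> opp c d" "coeffLR c d = (C, B)"
  shows "checkLR c d"
    "mpair p (rv (runU c d ! 5)) = - of_int C * kf c p - of_int B * (kf c p + kf d p)"
proof -
  have "(c, d) \<in> set (List.product letters letters)" by simp
  then show chk: "checkLR c d"
    using checkLR assms unfolding list_all_iff by fast
  then have e: "runU c d ! 5 = - smul C (nrm c) - smul B (nrm c + nrm d)"
    using assms(3) by (simp add: checkLR_def Let_def)
  show "mpair p (rv (runU c d ! 5)) = - of_int C * kf c p - of_int B * (kf c p + kf d p)"
    by (simp add: e rv_diff rv_uminus smul_rv rv_add rv_nrm mpair_diff mpair_uminus mpair_scale
        mpair_add mpair_nrm)
qed

text \<open>Splits the cost of an exit into the unit \<open>8 * D / (C * H^2)\<close>, common to all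
  exits of the run, and a ratio at most 1 that \<open>powbound\<close> can estimate.\<close>

lemma exit_bound:
  assumes cd: "c \<noteq> d" "\<not> opp c d" and p: "mpair p p = 0" and CB: "coeffLR c d = (C, B)"
    and yz: "(y, z) \<in> set (exitsU c d)"
    and D: "kf c p + kf d p > 0" (is "?D > 0") and H: "kf d p - kf c p \<ge> 15 * (kf c p + kf d p)" (is "?H \<ge> _")
  defines "U \<equiv> mpair (mirror y z) (nrm c + nrm d)"
  defines "V \<equiv> 225 * U * U - 30 * max (U * mpair (mirror y z) (nrm d - nrm c)) 0 +
      min 0 ((mpair (mirror y z) (nrm d - nrm c))\<^sup>2 + 32 * mpair (mirror y z) (mirror y z))"
  shows "mpair p (rv (mirror y z)) > 0"
    "mpair p (rv (mirror y z)) powr (- sU) \<le>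
      (8 * ?D / (of_int C * ?H\<^sup>2)) powr sU * (of_int (powbound (1800 * C * U) V) / 16384)"
proof -
  define X where "X = mpair (mirror y z) (nrm d - nrm c)"
  define N where "N = mpair (mirror y z) (mirror y z)"
  have chk: "0 < U" "0 < 1800 * C * U" "1800 * C * U \<le> V"
    using runU_long(1)[OF cd CB] yz CB
    unfolding checkLR_def V_def U_def
    by (auto simp: Let_def list_all_iff power2_eq_square)
  let ?P = "mpair p (rv (mirror y z))"
  define r where "r = ?D / ?H"
  have "0 < 15 * ?D" using D by simp
  also note H
  finally have Hpos: "?H > 0" .
  have r: "0 < r" "r \<le> 1 / 15" using D H Hpos by (auto simp: r_def divide_le_eq)
  have Dr: "?D = r * ?H" using Hpos by (simp add: r_def)
  have pt: "mpair p (nrm c + nrm d) = ?D" "mpair p (nrm d - nrm c) = ?H"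
    by (simp_all add: mpair_add mpair_diff mpair_nrm)
  have rvt: "mpair (rv (mirror y z)) (nrm c + nrm d) = of_int U"
    "mpair (rv (mirror y z)) (nrm d - nrm c) = of_int X"
    by (simp_all add: U_def X_def rv_add rv_diff flip: rv_nrm mpair_rv)
  have rvt': "mpair (rv (mirror y z)) (rv (mirror y z)) = of_int N"
    by (simp only: N_def mpair_rv)
  have "(of_int U * ?H - ?D * of_int X)\<^sup>2 + 32 * ?D\<^sup>2 * of_int N \<le> 64 * ?D * of_int U * ?P"
    using run_pairing_bound[OF cd p, of "rv (mirror y z)"] unfolding pt rvt rvt' by simp
  moreover have "(of_int U * ?H - ?D * of_int X)\<^sup>2 + 32 * ?D\<^sup>2 * of_int N =
      ?H\<^sup>2 * ((of_int U)\<^sup>2 - 2 * r * (of_int U * of_int X) + r\<^sup>2 * ((of_int X)\<^sup>2 + 32 * of_int N))"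
    unfolding Dr by (simp add: power2_eq_square algebra_simps)
  moreover have "of_int V / 225 \<le>
      (of_int U)\<^sup>2 - 2 * r * (of_int U * of_int X) + r\<^sup>2 * ((of_int X)\<^sup>2 + 32 * of_int N :: real)"
  proof -
    have V: "real_of_int V = 225 * (of_int U)\<^sup>2 - 30 * max (of_int U * of_int X) 0 +
        min 0 ((of_int X)\<^sup>2 + 32 * of_int N)"
      unfolding V_def X_def[symmetric] N_def[symmetric]
      by (simp add: power2_eq_square of_int_max of_int_min)
    have "r * (of_int U * of_int X) \<le> r * max (of_int U * of_int X) (0::real)"
      using r by (intro mult_left_mono) auto
    also have "\<dots> \<le> (1 / 15) * max (of_int U * of_int X) 0"
      using r by (intro mult_right_mono) auto
    finally have a: "r * (of_int U * of_int X) \<le> (1 / 15) * max (of_int U * of_int X) (0::real)" .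
    have r2: "0 \<le> r\<^sup>2" "r\<^sup>2 \<le> 1 / 225"
      using r power_mono[of r "1 / 15" 2] by (auto simp: power_divide)
    have "(1 / 225) * min 0 ((of_int X)\<^sup>2 + 32 * of_int N) \<le> r\<^sup>2 * min 0 ((of_int X)\<^sup>2 + 32 * of_int N :: real)"
      using r2 by (intro mult_right_mono_neg) auto
    also have "\<dots> \<le> r\<^sup>2 * ((of_int X)\<^sup>2 + 32 * of_int N)"
      using r2 by (intro mult_left_mono) auto
    finally show ?thesis using a unfolding V by (simp add: field_simps)
  qed
  then have "?H\<^sup>2 * (of_int V / 225) \<le>
      ?H\<^sup>2 * ((of_int U)\<^sup>2 - 2 * r * (of_int U * of_int X) + r\<^sup>2 * ((of_int X)\<^sup>2 + 32 * of_int N))"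
    by (intro mult_left_mono) auto
  ultimately have le: "?H\<^sup>2 * (of_int V / 225) \<le> 64 * ?D * of_int U * ?P" by linarith
  have "0 < V" using chk(2,3) by linarith
  moreover have "0 < C" using coeffLR_bounds[OF CB] by linarith
  ultimately have pos: "of_int V > (0::real)" "of_int U > (0::real)" "of_int C > (0::real)"
    using chk(1) by (simp_all only: of_int_0_less_iff)
  let ?Q = "?H\<^sup>2 * (of_int V / 225) / (64 * ?D * of_int U)"
  have Q: "0 < ?Q" "?Q \<le> ?P"
    using pos D Hpos le by (auto simp: divide_le_eq mult_ac)
  then show "?P > 0" by linarith
  have "?P powr (- sU) \<le> ?Q powr (- sU)" using Q by (intro powr_mono2') auto
  also have "\<dots> = ((8 * ?D / (of_int C * ?H\<^sup>2)) * (of_int (1800 * C * U) / of_int V)) powr sU"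
  proof -
    have "1 / ?Q = (8 * ?D / (of_int C * ?H\<^sup>2)) * (of_int (1800 * C * U) / of_int V)"
      using pos D Hpos by (simp add: field_simps)
    moreover have "?Q powr (- sU) = (1 / ?Q) powr sU"
      using Q by (simp only: powr_minus_divide powr_divide powr_one_eq_one less_imp_le zero_le_one)
    ultimately show ?thesis by simp
  qed
  also have "\<dots> = (8 * ?D / (of_int C * ?H\<^sup>2)) powr sU * (of_int (1800 * C * U) / of_int V) powr sU"
    using pos D by (intro powr_mult)
  also have "\<dots> \<le> (8 * ?D / (of_int C * ?H\<^sup>2)) powr sU * (of_int (powbound (1800 * C * U) V) / 16384)"
    using chk by (intro mult_left_mono powbound) auto
  finally show "?P powr (- sU) \<le>
      (8 * ?D / (of_int C * ?H\<^sup>2)) powr sU * (of_int (powbound (1800 * C * U) V) / 16384)" .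
qed

text \<open>The right side is the weight freed by one more letter of the run, the left side the cost
  of the exits. After the midpoint estimate, \<open>27 * C <= 28 * B\<close> eliminates
  \<open>B\<close> and leaves the one-variable inequality \<open>run_rate\<close> in
  \<open>r = D / H\<close>.\<close>

lemma run_gain:
  fixes C B D H :: real
  assumes C: "0 < C" "27 * C \<le> 28 * B" "B \<le> C" and D: "0 < D" "15 * D \<le> H"
  shows "(8 * D / (C * H\<^sup>2)) powr sU * (1473 / 1000) \<le>
    (C * (H - D) / 2 - B * D) powr (- sU) - (C * (H + D) / 2 - B * D) powr (- sU)"
proof -
  define r where "r = D / H"
  have H: "H > 0" using D by linarith
  have r: "0 < r" "r \<le> 1 / 15" using D H by (auto simp: r_def divide_le_eq)
  have Dr: "D = r * H" using H by (simp add: r_def)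
  define a where "a = C * (H - D) / 2 - B * D"
  have "B * D \<le> C * D" using C D by (intro mult_right_mono) auto
  moreover have "C * (15 * D) \<le> C * H" using C D by (intro mult_left_mono) auto
  moreover have "C * D > 0" using C D by simp
  ultimately have a: "a > 0" unfolding a_def by (simp add: algebra_simps)
  let ?m = "C * H / 2 * (1 - 27 / 14 * r)"
  have rr: "1 - 27 / 14 * r > 0" using r by simp
  have m: "?m > 0" using C H rr by simp
  have am: "a + C * D / 2 \<le> ?m"
  proof -
    have "27 * C * (r * H) \<le> 28 * B * (r * H)" using C r H by (intro mult_right_mono) auto
    then show ?thesis unfolding a_def Dr by (simp add: field_simps)
  qed
  have "(8 * D / (C * H\<^sup>2)) powr sU * (1473 / 1000) =
      8 powr sU * r powr sU * (C * H) powr (- sU) * (1473 / 1000)"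
  proof -
    have "8 * D / (C * H\<^sup>2) = (8 * r) / (C * H)" unfolding Dr using H by (simp add: power2_eq_square)
    moreover have "((8 * r) / (C * H)) powr sU = (8 * r) powr sU / (C * H) powr sU"
      by (intro powr_divide)
    ultimately show ?thesis using r by (simp add: powr_mult powr_minus_divide)
  qed
  also have "\<dots> \<le> sU * (C * D) * ?m powr (- sU - 1)"
  proof -
    let ?g = "r powr (8 / 23) * (1 - 27 / 14 * r) powr (54 / 23)"
    have e1: "r powr sU = r * r powr (8 / 23)"
      using r powr_add[of r 1 "8 / 23"] by simp
    have e2: "?m powr (- sU - 1) = (C * H) powr (- sU - 1) * (1 / 2) powr (- sU - 1) *
        (1 - 27 / 14 * r) powr (- (54 / 23))"
    proof -
      have "?m = (C * H) * (1 / 2) * (1 - 27 / 14 * r)" by simp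
      then have "?m powr (- sU - 1) = ((C * H) * (1 / 2) * (1 - 27 / 14 * r)) powr (- sU - 1)"
        by (simp only:)
      also have "\<dots> = ((C * H) * (1 / 2)) powr (- sU - 1) * (1 - 27 / 14 * r) powr (- sU - 1)"
        using C H rr by (intro powr_mult)
      also have "((C * H) * (1 / 2)) powr (- sU - 1) = (C * H) powr (- sU - 1) * (1 / 2) powr (- sU - 1)"
        using C H by (intro powr_mult)
      finally show ?thesis by simp
    qed
    have e3: "(C * H) powr (- sU - 1) * (C * H) = (C * H) powr (- sU)"
      using C H powr_add[of "C * H" "- sU - 1" 1] by simp
    have e4: "(1 / 2 :: real) powr (- sU - 1) = 2 * 2 powr sU"
      using powr_add[of "1 / 2 :: real" "- sU" "- 1"] by (simp add: powr_minus_divide powr_divide)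
    have e5: "8 powr sU = 2 powr sU * (4 :: real) powr sU"
      using powr_mult[of 2 "4 :: real" sU] by simp
    have e6: "(1 - 27 / 14 * r) powr (54 / 23) * (1 - 27 / 14 * r) powr (- (54 / 23)) = 1"
      using rr by (simp flip: powr_add)
    have g: "?g * (1473 / 1000) * 4 powr sU \<le> 2 * sU"
    proof -
      have "?g * (1473 / 1000) * 4 powr sU \<le> 2 * sU * 4 powr (- sU) * 4 powr sU"
        using run_rate[OF r] by (intro mult_right_mono) auto
      also have "\<dots> = 2 * sU" by (simp add: powr_minus_divide)
      finally show ?thesis .
    qed
    let ?k = "r * 2 powr sU * (C * H) powr (- sU) * (1 - 27 / 14 * r) powr (- (54 / 23))"
    have "8 powr sU * r powr sU * (C * H) powr (- sU) * (1473 / 1000) =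
        8 powr sU * r powr sU * (C * H) powr (- sU) * (1473 / 1000) *
        ((1 - 27 / 14 * r) powr (54 / 23) * (1 - 27 / 14 * r) powr (- (54 / 23)))"
      by (simp only: e6 mult_1_right)
    also have "\<dots> = ?k * (?g * (1473 / 1000) * 4 powr sU)"
      by (simp only: e1 e5 mult_ac)
    also have "\<dots> \<le> ?k * (2 * sU)"
      using r by (intro mult_left_mono[OF g]) auto
    also have "\<dots> = sU * r * ((C * H) powr (- sU - 1) * (C * H)) * (2 * 2 powr sU) *
        (1 - 27 / 14 * r) powr (- (54 / 23))"
      by (subst e3) (simp only: mult_ac)
    also have "\<dots> = sU * (C * D) * ?m powr (- sU - 1)"
      unfolding e2 e4 Dr by (simp only: mult_ac)
    finally show ?thesis .
  qed
  also have "\<dots> \<le> sU * (C * D) * (a + C * D / 2) powr (- sU - 1)"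
  proof -
    have CD: "C * D > 0" using C D by simp
    have "0 < a + C * D / 2" using a CD by linarith
    then show ?thesis using am CD by (intro mult_left_mono powr_mono2') auto
  qed
  also have "\<dots> \<le> a powr (- sU) - (a + C * D) powr (- sU)"
    using a C D by (intro powr_diff_midpoint) auto
  also have "a + C * D = C * (H + D) / 2 - B * D" by (simp add: a_def field_simps)
  finally show ?thesis by (simp only: a_def)
qed

text \<open>The child continuing the run has a pairing larger by \<open>C * D\<close>; the resulting
  drop in weight pays for the three exits.\<close>

lemma FU_step_long:
  assumes v: "valid (c # d # c # us)" and o: "\<not> opp c d" and run8: "run (c # d # c # us) \<ge> 8"
  shows "mpair (pt (c # d # c # us)) (rv (zU (c # d # c # us))) > 0" (is "?z > 0")
    "mpair (pt (c # d # c # us)) (rv (zU (c # d # c # us))) \<le> - 15000 * kf c (pt (c # d # c # us) :: real v4)"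
    "(\<Sum>x\<in>- {c}. FU (x # c # d # c # us)) \<le> FU (c # d # c # us)"
proof -
  let ?ws = "c # d # c # us"
  let ?p = "pt ?ws :: real v4"
  have cd: "c \<noteq> d" using v by auto
  obtain C B where CB: "coeffLR c d = (C, B)" by (cases "coeffLR c d")
  note CBb = coeffLR_bounds[OF CB]
  define D where "D = kf c ?p + kf d ?p"
  define H where "H = kf d ?p - kf c ?p"
  have D: "D \<ge> 4" using pt_kf[OF v] cd by (auto simp: D_def)
  have "- kf c ?p \<ge> real (run ?ws - 1) * D" using run_depth[OF v o] by (simp only: D_def)
  moreover have "real (run ?ws - 1) * D \<ge> 7 * D" using run8 D by (intro mult_right_mono) auto
  ultimately have K: "- kf c ?p \<ge> 7 * D" by linarith
  \<comment> \<open>\<open>H = D - 2 * kf c\<close>, so seven cusp steps give 15; this is the origin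
    of the threshold \<open>1 / 15\<close>.\<close>
  have HD: "H \<ge> 15 * D" using K by (simp add: H_def D_def)
  have min8: "min (run ?ws) 8 - 3 = 5" using run8 by simp
  have "zU ?ws = runU c d ! (min (run ?ws) 8 - 3)" using o by (simp only: zU.simps simp_thms if_True)
  then have "zU ?ws = runU c d ! 5" by (simp only: min8)
  then have z: "?z = of_int C * (H - D) / 2 - of_int B * D"
    using runU_long(2)[OF cd o CB, of ?p] by (simp add: H_def D_def field_simps)
  have o': "\<not> opp d c" using o opp_sym by blast
  have min8': "min (run (d # ?ws)) 8 - 3 = 5" using run8 by simp
  have "zU (d # ?ws) = runU d c ! (min (run (d # ?ws)) 8 - 3)"
    using o' by (simp only: zU.simps simp_thms if_True)
  then have "zU (d # ?ws) = runU d c ! 5" by (simp only: min8')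
  moreover have "coeffLR d c = (C, B)" using CB by (simp only: coeffLR_commute[of d c])
  ultimately have "mpair (pt (d # ?ws)) (rv (zU (d # ?ws))) =
      - of_int C * kf d (mirror d ?p) - of_int B * (kf d (mirror d ?p) + kf c (mirror d ?p))"
    using runU_long(2)[of d c C B "pt (d # ?ws)"] cd o' by simp
  also have "\<dots> = of_int C * (H + D) / 2 - of_int B * D"
  proof -
    have "kf c (mirror d ?p) = kf c ?p + 2 * kf d ?p" "kf d (mirror d ?p) = - kf d ?p"
      using kf_mirror[of c d ?p] cd o by (auto simp del: act_simps)
    then show ?thesis unfolding H_def D_def by (simp add: field_simps del: act_simps)
  qed
  finally have z': "mpair (pt (d # ?ws)) (rv (zU (d # ?ws))) = of_int C * (H + D) / 2 - of_int B * D" .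
  have Cr: "(0::real) < of_int C" "27 * (of_int C :: real) \<le> 28 * of_int B" "(of_int B :: real) \<le> of_int C"
    using CBb by auto
  have BD: "of_int B * D \<le> of_int C * D" using Cr D by (intro mult_right_mono) auto
  have CH: "of_int C * (15 * D) \<le> of_int C * H" using Cr HD by (intro mult_left_mono) auto
  have CD: "of_int C * D > 0" using Cr D by simp
  show "?z > 0" unfolding z using BD CH CD by (simp add: algebra_simps)
  have "?z \<le> of_int C * (- kf c ?p)"
    unfolding z using Cr D CBb by (simp add: H_def D_def field_simps)
  also have "\<dots> \<le> 15000 * (- kf c ?p)" using CBb K D by (intro mult_right_mono) auto
  finally show "?z \<le> - 15000 * kf c ?p" by simp
  have zy: "map (\<lambda>x. (x, zU (x # ?ws))) (filter (\<lambda>x. x \<noteq> c \<and> x \<noteq> d) letters) = exitsU c d"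
    by (auto simp: exitsU_def)
  let ?q = "(8 * D / (of_int C * H\<^sup>2)) powr sU"
  define G where "G = (\<lambda>u. let U = mpair u (nrm c + nrm d); X = mpair u (nrm d - nrm c);
       V = 225 * U * U - 30 * max (U * X) 0 + min 0 (X * X + 32 * mpair u u) in powbound (1800 * C * U) V)"
  have chk: "sum_list (map G (map (\<lambda>(y, z). mirror y z) (exitsU c d))) \<le> 24133"
    using runU_long(1)[OF cd o CB] CB by (simp only: checkLR_def Let_def prod.case G_def)
  have e: "(\<Sum>x\<in>- {c}. FU (x # ?ws)) = FU (d # ?ws) + (\<Sum>(y, z)\<leftarrow>exitsU c d. mpair ?p (rv (mirror y z)) powr (- sU))"
    unfolding sum_kids[OF cd, symmetric] kids_def zy[symmetric]
    by (simp add: FU_def mpair_mirror mirror_rv comp_def del: act_simps(2)) (simp add: mpair_mirror mirror_rv)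
  have "(\<Sum>(y, z)\<leftarrow>exitsU c d. mpair ?p (rv (mirror y z)) powr (- sU)) \<le>
      (\<Sum>(y, z)\<leftarrow>exitsU c d. ?q * (of_int (G (mirror y z)) / 16384))"
  proof (rule sum_list_mono, clarify)
    fix y and a b e f :: int assume yz: "(y, (a, b, e, f)) \<in> set (exitsU c d)"
    have "kf c ?p + kf d ?p > 0" "kf d ?p - kf c ?p \<ge> 15 * (kf c ?p + kf d ?p)"
      using D HD by (simp_all add: D_def H_def)
    from exit_bound(2)[OF cd o pt_light CB yz this]
    show "mpair ?p (rv (mirror y (a, b, e, f))) powr (- sU) \<le> ?q * (of_int (G (mirror y (a, b, e, f))) / 16384)"
      by (simp only: G_def Let_def power2_eq_square flip: D_def H_def)
  qed
  also have "(\<Sum>(y, z)\<leftarrow>exitsU c d. ?q * (of_int (G (mirror y z)) / 16384)) =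
      ?q * (of_int (sum_list (map G (map (\<lambda>(y, z). mirror y z) (exitsU c d)))) / 16384)"
  proof -
    have "(\<Sum>(y, z)\<leftarrow>xs. ?q * (of_int (G (mirror y z)) / 16384)) =
      ?q * (of_int (sum_list (map G (map (\<lambda>(y, z). mirror y z) xs))) / 16384)" for xs
      by (induction xs) (simp_all add: case_prod_unfold algebra_simps add_divide_distrib)
    then show ?thesis .
  qed
  also have "\<dots> \<le> ?q * (1473 / 1000)"
  proof -
    have "real_of_int (sum_list (map G (map (\<lambda>(y, z). mirror y z) (exitsU c d)))) \<le> of_int 24133"
      using chk by (simp only: of_int_le_iff)
    then show ?thesis by (intro mult_left_mono) auto
  qed
  also have "\<dots> \<le> ?z powr (- sU) - mpair (pt (d # ?ws)) (rv (zU (d # ?ws))) powr (- sU)"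
    unfolding z z' using Cr D HD by (intro run_gain) auto
  finally show "(\<Sum>x\<in>- {c}. FU (x # ?ws)) \<le> FU ?ws"
    unfolding e by (simp only: FU_def)
qed

section \<open>Hausdorff measure\<close>

lemma hausdorff_null_finite:
  fixes A :: "'a::metric_space set"
  assumes s: "s > 0"
    and cov: "\<And>d e. d > 0 \<Longrightarrow> e > 0 \<Longrightarrow> \<exists>xs. A \<subseteq> \<Union> (set xs) \<and>
      (\<forall>U\<in>set xs. bounded U \<and> diameter U \<le> d) \<and> (\<Sum>U\<leftarrow>xs. diameter U powr s) \<le> e"
  shows "hausdorff_measure s A = 0"
proof -
  have "hausdorff_premeasure s d A = 0" if d: "d > 0" for d
  proof -
    have le: "hausdorff_premeasure s d A \<le> ennreal e" if e: "e > 0" for e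
    proof -
      obtain xs where xs: "A \<subseteq> \<Union> (set xs)" "\<forall>U\<in>set xs. bounded U \<and> diameter U \<le> d"
        "(\<Sum>U\<leftarrow>xs. diameter U powr s) \<le> e" using cov[OF d e] by blast
      define U where "U = (\<lambda>n. if n < length xs then xs ! n else {})"
      have "A \<subseteq> (\<Union>n. U n)"
      proof
        fix x assume "x \<in> A"
        then obtain B where "B \<in> set xs" "x \<in> B" using xs(1) by blast
        then obtain n where "n < length xs" "x \<in> xs ! n" by (auto simp: in_set_conv_nth)
        then show "x \<in> (\<Union>n. U n)" by (intro UN_I[of n]) (auto simp: U_def)
      qed
      moreover have "bounded (U n) \<and> diameter (U n) \<le> d" for n
      proof (cases "n < length xs")
        case True
        then have "U n \<in> set xs" by (simp add: U_def)
        then show ?thesis using xs(2) by blast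
      next
        case False
        then have "U n = {}" by (simp add: U_def)
        then show ?thesis using d by simp
      qed
      ultimately have "hausdorff_premeasure s d A \<le> (\<Sum>n. hausdorff_gauge s (U n))"
        unfolding hausdorff_premeasure_def by (intro INF_lower) auto
      also have "\<dots> = (\<Sum>n<length xs. hausdorff_gauge s (U n))"
        by (intro suminf_finite) (auto simp: U_def hausdorff_gauge_def)
      also have "\<dots> \<le> (\<Sum>n<length xs. ennreal (diameter (xs ! n) powr s))"
        using s by (intro sum_mono) (auto simp: U_def hausdorff_gauge_def)
      also have "\<dots> = ennreal (\<Sum>n<length xs. diameter (xs ! n) powr s)"
        by (intro sum_ennreal) auto
      also have "(\<Sum>n<length xs. diameter (xs ! n) powr s) = (\<Sum>U\<leftarrow>xs. diameter U powr s)"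
        by (simp add: sum_list_sum_nth atLeast0LessThan)
      finally show ?thesis using xs(3) by (meson ennreal_leI order_trans)
    qed
    have "hausdorff_premeasure s d A \<le> 0"
    proof (rule ennreal_le_epsilon)
      fix e :: real assume "e > 0"
      from le[OF this] show "hausdorff_premeasure s d A \<le> 0 + ennreal e" by simp
    qed
    then show ?thesis by simp
  qed
  then show ?thesis unfolding hausdorff_measure_def by (simp add: SUP_constant)
qed

lemma hausdorff_null_UN:
  fixes A :: "nat \<Rightarrow> 'a::metric_space set"
  assumes "\<And>i. hausdorff_measure s (A i) = 0"
  shows "hausdorff_measure s (\<Union>i. A i) = 0"
proof -
  have "hausdorff_premeasure s d (\<Union>i. A i) \<le> 0" if d: "d > 0" for d
  proof (rule ennreal_le_epsilon)
    fix e :: real assume e: "e > 0"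
    have "\<exists>U. A i \<subseteq> (\<Union>n. U n) \<and> (\<forall>n. bounded (U n) \<and> diameter (U n) \<le> d) \<and>
        (\<Sum>n. hausdorff_gauge s (U n)) \<le> ennreal (e * (1/2) ^ Suc i)" for i
    proof -
      have "hausdorff_premeasure s d (A i) \<le> hausdorff_measure s (A i)"
        unfolding hausdorff_measure_def using d by (intro SUP_upper) auto
      then have "hausdorff_premeasure s d (A i) < ennreal (e * (1/2) ^ Suc i)"
        using assms[of i] e by (simp add: le_less_trans)
      then show ?thesis unfolding hausdorff_premeasure_def INF_less_iff
        by (force intro: less_imp_le)
    qed
    then obtain U where U: "\<And>i. A i \<subseteq> (\<Union>n. U i n)"
      "\<And>i n. bounded (U i n) \<and> diameter (U i n) \<le> d"
      "\<And>i. (\<Sum>n. hausdorff_gauge s (U i n)) \<le> ennreal (e * (1/2) ^ Suc i)" by metis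
    let ?V = "\<lambda>m. case_prod U (prod_decode m)"
    have "(\<Union>i. A i) \<subseteq> (\<Union>m. ?V m)"
    proof
      fix x assume "x \<in> (\<Union>i. A i)"
      then obtain i n where "x \<in> U i n" using U(1) by blast
      then show "x \<in> (\<Union>m. ?V m)" by (intro UN_I[of "prod_encode (i, n)"]) auto
    qed
    then have "hausdorff_premeasure s d (\<Union>i. A i) \<le> (\<Sum>m. hausdorff_gauge s (?V m))"
      unfolding hausdorff_premeasure_def using U(2)
      by (intro INF_lower) (auto split: prod.split)
    also have "\<dots> = (\<Sum>m. (\<lambda>(i, n). hausdorff_gauge s (U i n)) (prod_decode m))"
      by (simp add: case_prod_unfold)
    also have "\<dots> = (\<Sum>i. \<Sum>n. hausdorff_gauge s (U i n))"
      by (rule suminf_ennreal_2dimen) simp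
    also have "\<dots> \<le> (\<Sum>i. ennreal (e * (1/2) ^ Suc i))"
      by (intro suminf_le U(3)) auto
    also have "\<dots> = ennreal e"
    proof -
      have "(\<lambda>i. e * (1/2) ^ Suc i) sums (e * 1)" by (intro sums_mult power_half_series)
      then show ?thesis using e by (subst suminf_ennreal_eq[of _ e]) auto
    qed
    finally show "hausdorff_premeasure s d (\<Union>i. A i) \<le> 0 + ennreal e" by simp
  qed
  then have "hausdorff_premeasure s d (\<Union>i. A i) = 0" if "d > 0" for d using that by simp
  then show ?thesis unfolding hausdorff_measure_def by (simp add: SUP_constant)
qed

lemma hausdorff_measure_mono:
  assumes "A \<subseteq> B"
  shows "hausdorff_measure s A \<le> hausdorff_measure s B"
  unfolding hausdorff_measure_def hausdorff_premeasure_def using assms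
  by (intro SUP_mono bexI INF_superset_mono) auto

section \<open>Coding residual points by words\<close>

lemma act_rev: "act (rev w) (act w x) = x"
  by (induction w) (simp_all add: act_append)

text \<open>The centre of the \<open>c\<close>-circle is its inversion image of infinity, hence residual.\<close>

lemma circle_kf:
  assumes k: "kf c (pt w :: real v4) < 0"
  shows "\<exists>q\<in>mallows_residual. \<forall>X. kf c (act w (lift X)) =
    (8 - (kf c (pt w :: real v4))\<^sup>2 * (dist X q)\<^sup>2) / - kf c (pt w :: real v4)"
proof -
  define b where "b = act (rev w) (nrm c :: real v4)"
  let ?k = "kf c (pt w :: real v4)"
  have kb: "kap b = ?k"
    by (simp add: kap_def b_def mpair_act[symmetric] mpair_comm[of infty] mpair_nrm)
  have bb: "mpair b b = - 8" unfolding b_def mpair_act_act by (cases c) simp_all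
  define q :: "real^2" where "q = vector [ccx b / ?k, ccy b / ?k]"
  have kq: "?k * q$1 = ccx b" "?k * q$2 = ccy b" using k by (simp_all add: q_def vector_2_simps)
  have "?k\<^sup>2 * mpair (lift q) v = 8 * mpair (pt (rev w @ c # w)) v" for v
  proof -
    have e: "?k * ccm b = (ccx b)\<^sup>2 + (ccy b)\<^sup>2 - 8" using bb unfolding mpair_circle kb by linarith
    have "pt (rev w @ c # w) = act (rev w) (mirror c (pt w) :: real v4)" by (simp add: act_append)
    also have "\<dots> = infty + (?k / 4) *\<^sub>R b"
      unfolding mirror_eq act_add act_scale act_rev b_def ..
    finally have "8 * mpair (pt (rev w @ c # w)) v = 8 * kap v + 2 * ?k * mpair b v"
      by (simp only: mpair_add_left mpair_scale_left kap_def) (simp add: algebra_simps)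
    also have "\<dots> = 8 * kap v + ?k\<^sup>2 * ccm v + kap v * (?k * ccm b) - 2 * ?k * (ccx v * ccx b + ccy v * ccy b)"
      unfolding mpair_circle2 kb by (simp add: power2_eq_square algebra_simps)
    also have "\<dots> = kap v * ((?k * q$1)\<^sup>2 + (?k * q$2)\<^sup>2) - 2 * ?k * (ccx v * (?k * q$1) + ccy v * (?k * q$2)) + ?k\<^sup>2 * ccm v"
      unfolding e kq by (simp add: algebra_simps)
    also have "\<dots> = ?k\<^sup>2 * mpair (lift q) v"
      unfolding mpair_lift by (simp add: power2_eq_square algebra_simps)
    finally show ?thesis by simp
  qed
  note lq = this
  have "mpair (act us (lift q)) e \<ge> 0" if "e \<in> seeds" for us e
  proof -
    have "0 \<le> 8 * mpair (pt (us @ (rev w @ c # w))) e" using seed_nonneg[OF that] by simp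
    also have "\<dots> = ?k\<^sup>2 * mpair (act us (lift q)) e"
      unfolding act_append[of us] mpair_act[of us] lq ..
    finally show ?thesis using k by (simp add: zero_le_mult_iff)
  qed
  then have "q \<in> mallows_residual" by (simp add: residual_iff)
  moreover have "kf c (act w (lift X)) = (8 - ?k\<^sup>2 * (dist X q)\<^sup>2) / - ?k" for X
  proof -
    have "kf c (act w (lift X)) = mpair (lift X) b"
      unfolding b_def mpair_nrm[symmetric] mpair_act ..
    moreover have "?k * mpair (lift X) b = (?k * X$1 - ?k * q$1)\<^sup>2 + (?k * X$2 - ?k * q$2)\<^sup>2 - 8"
      using kap_mpair_lift[of b X] unfolding kq by (simp add: kb bb)
    moreover have "(?k * X$1 - ?k * q$1)\<^sup>2 + (?k * X$2 - ?k * q$2)\<^sup>2 = ?k\<^sup>2 * (dist X q)\<^sup>2"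
    proof -
      have "(dist X q)\<^sup>2 = (X$1 - q$1)\<^sup>2 + (X$2 - q$2)\<^sup>2"
        by (simp add: dist_norm norm_eq_sqrt_inner inner_vec_def sum_2 power2_eq_square)
      then show ?thesis by (simp add: power_mult_distrib distrib_left flip: right_diff_distrib)
    qed
    ultimately show ?thesis using k by (simp add: divide_simps mult.commute)
  qed
  ultimately show ?thesis by blast
qed

lemma circle_ball:
  assumes K: "K > 0" and f: "\<And>X. f X = (8 - K\<^sup>2 * (dist X q)\<^sup>2) / K"
  shows "{X. 0 \<le> f X} = cball q (sqrt 8 / K)" "{X. 0 < f X} = ball q (sqrt 8 / K)"
proof -
  have "K * dist X q \<le> sqrt 8 \<longleftrightarrow> (K * dist X q)\<^sup>2 \<le> 8" for X
    using real_sqrt_le_iff[of "(K * dist X q)\<^sup>2" 8] K by (simp add: real_sqrt_abs)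
  moreover have "K * dist X q < sqrt 8 \<longleftrightarrow> (K * dist X q)\<^sup>2 < 8" for X
    using real_sqrt_less_iff[of "(K * dist X q)\<^sup>2" 8] K by (simp add: real_sqrt_abs)
  ultimately show "{X. 0 \<le> f X} = cball q (sqrt 8 / K)" "{X. 0 < f X} = ball q (sqrt 8 / K)"
    using K by (auto simp: f zero_le_divide_iff zero_less_divide_iff pos_le_divide_eq pos_less_divide_eq
        power_mult_distrib dist_commute[of q] mult.commute[of _ K])
qed

text \<open>The head reflection reverses the sign at its own wall, so nonnegativity here means lying
  inside the circle before it. The word \<open>u\<close> fixes infinity and first moves the point
  into the coded strip.\<close>

definition disc :: "letter list \<Rightarrow> letter list \<Rightarrow> (real^2) set" where
  "disc u ws = {X. kf (hd ws) (act (ws @ u) (lift X)) \<ge> 0}"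

definition odisc :: "letter list \<Rightarrow> letter list \<Rightarrow> (real^2) set" where
  "odisc u ws = {X. kf (hd ws) (act (ws @ u) (lift X)) > 0}"

lemma act_stabilizer: "set u \<subseteq> {N1, N2} \<Longrightarrow> act u infty = infty"
  by (induction u) auto

lemma disc_cball:
  assumes u: "set u \<subseteq> {N1, N2}" and v: "valid (c # ws)"
  shows "\<exists>q\<in>mallows_residual. disc u (c # ws) = cball q (sqrt 8 / - kf c (pt (c # ws) :: real v4)) \<and>
    odisc u (c # ws) = ball q (sqrt 8 / - kf c (pt (c # ws) :: real v4))"
proof -
  let ?k = "kf c (pt (c # ws) :: real v4)"
  have k: "?k < 0"
  proof -
    have "?k \<le> - 4 * real (length (c # ws))" using pt_kf[OF v] by blast
    then show ?thesis by simp
  qed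
  have pw: "pt ((c # ws) @ u) = (pt (c # ws) :: real v4)"
    by (simp only: act_append act_stabilizer[OF u])
  obtain q where q: "q \<in> mallows_residual"
    "\<And>X. kf c (act ((c # ws) @ u) (lift X)) = (8 - ?k\<^sup>2 * (dist X q)\<^sup>2) / - ?k"
    using circle_kf[of c "(c # ws) @ u"] k unfolding pw by blast
  have "- ?k > 0" using k by linarith
  from circle_ball[OF this, of "\<lambda>X. kf c (act ((c # ws) @ u) (lift X))" q] q show ?thesis
    unfolding disc_def odisc_def list.sel power2_minus by blast
qed

text \<open>On the vectors of points \<open>N1\<close> and \<open>N2\<close> are the lines
  \<open>a = 0\<close> and \<open>b = 0\<close>. A negative \<open>a\<close> is first made positive
  by \<open>N1\<close>; then \<open>N2\<close> sends \<open>a\<close> to \<open>2 - a\<close>, which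
  lowers the bound by one.\<close>

lemma strip_word:
  fixes a b c d :: real
  assumes "a + b = 1" "\<bar>a\<bar> \<le> real n"
  shows "\<exists>u. set u \<subseteq> {N1, N2} \<and> kf N1 (act u (a, b, c, d)) \<ge> 0 \<and> kf N2 (act u (a, b, c, d)) \<ge> 0"
  using assms
proof (induction n arbitrary: a b c d)
  case 0
  then show ?case by (intro exI[of _ "[]"]) auto
next
  case (Suc n)
  have pos: "\<exists>u. set u \<subseteq> {N1, N2} \<and> kf N1 (act u (a, b, c, d)) \<ge> 0 \<and> kf N2 (act u (a, b, c, d)) \<ge> 0"
    if "a \<ge> 0" "a + b = 1" "a \<le> real (Suc n)" for a b c d :: real
  proof (cases "a \<le> 1")
    case True
    then show ?thesis using that by (intro exI[of _ "[]"]) auto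
  next
    case False
    then have "n \<noteq> 0" using that by (cases n) auto
    then have "real n \<ge> 1" by simp
    moreover have "a \<le> real n + 1" "b = 1 - a" using that by simp_all
    ultimately have "\<bar>a + 2 * b\<bar> \<le> real n" "(a + 2 * b) + (- b) = 1" using False by linarith+
    from Suc.IH[OF this(2,1)] obtain u where
      "set u \<subseteq> {N1, N2}" "kf N1 (act u (a + 2 * b, - b, c + 4 * b, d + 4 * b)) \<ge> 0"
      "kf N2 (act u (a + 2 * b, - b, c + 4 * b, d + 4 * b)) \<ge> 0" by blast
    then show ?thesis by (intro exI[of _ "u @ [N2]"]) (simp add: act_append)
  qed
  show ?case
  proof (cases "a \<ge> 0")
    case True then show ?thesis using pos Suc.prems by auto
  next
    case False
    from pos[of "- a" "b + 2 * a" "c + 4 * a" "d + 4 * a"] False Suc.prems obtain u where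
      "set u \<subseteq> {N1, N2}" "kf N1 (act u (- a, b + 2 * a, c + 4 * a, d + 4 * a)) \<ge> 0"
      "kf N2 (act u (- a, b + 2 * a, c + 4 * a, d + 4 * a)) \<ge> 0" by auto
    then show ?thesis by (intro exI[of _ "u @ [N1]"]) (simp add: act_append)
  qed
qed

lemma residual_covering:
  assumes X: "X \<in> mallows_residual"
  shows "(\<exists>l. kf l (act w (lift X)) < 0) \<or>
    (\<exists>l l'. l \<noteq> l' \<and> kf l (act w (lift X)) \<le> 0 \<and> kf l' (act w (lift X)) \<le> 0)"
proof (rule ccontr)
  assume n: "\<not> ?thesis"
  have s: "mpair (act w (lift X)) e \<ge> 0" if "e \<in> seeds" for e
    using X that by (auto simp: residual_iff)
  show False
  proof (rule covering)
    show "mpair (act w (lift X)) (act w (lift X)) = 0" by simp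
    show "kf l (act w (lift X)) \<ge> 0" for l using n by (meson not_le)
    show "kf l (act w (lift X)) > 0 \<or> kf l' (act w (lift X)) > 0" if "l \<noteq> l'" for l l'
      using n that by (meson not_le)
  qed (auto intro!: s simp: seeds_def)
qed

definition words :: "nat \<Rightarrow> letter list set" where
  "words n = {ws. valid ws \<and> length ws = n}"

text \<open>Greedy coding: in the current frame the point is on or inside some circle other than
  that of the last letter, by \<open>residual_covering\<close>, so each word extends.\<close>

lemma residual_words:
  assumes X: "X \<in> mallows_residual"
  shows "\<exists>u. set u \<subseteq> {N1, N2} \<and> (\<forall>n. \<exists>ws\<in>words (Suc n). X \<in> disc u ws)"
proof -
  obtain n where n: "\<bar>1 - sqrt 2 / 2 * X$1\<bar> \<le> real n" using real_arch_simple by blast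
  define m where "m = (X$1)\<^sup>2 + (X$2)\<^sup>2 - sqrt 2 * X$1 + 1/4"
  have lift: "lift X = (1 - sqrt 2 / 2 * X$1, sqrt 2 / 2 * X$1, m + X$2, m - X$2)"
    by (simp only: lift_def Let_def m_def)
  have one: "(1 - sqrt 2 / 2 * X$1) + sqrt 2 / 2 * X$1 = 1" by simp
  from strip_word[OF one n, of "m + X$2" "m - X$2"] obtain u where
    u: "set u \<subseteq> {N1, N2}" "kf N1 (act u (lift X)) \<ge> 0" "kf N2 (act u (lift X)) \<ge> 0"
    unfolding lift[symmetric] by blast
  \<comment> \<open>\<open>kf N1 + kf N2\<close> is four times the pairing with
    \<open>infty\<close>, hence 8. So a first letter other than \<open>N1\<close> and
    \<open>N2\<close> is always available.\<close>
  have not2: "\<not> (kf N1 (act u (lift X)) \<le> 0 \<and> kf N2 (act u (lift X)) \<le> 0)"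
  proof
    assume a: "kf N1 (act u (lift X)) \<le> 0 \<and> kf N2 (act u (lift X)) \<le> 0"
    have "mpair infty (act u (lift X)) = 2"
      using act_stabilizer[of "rev u", where 'a = real] u(1)
      by (simp add: mpair_comm[of infty "act u _"] mpair_act) (simp add: mpair_comm[of _ infty])
    moreover obtain a b c d where "act u (lift X) = (a, b, c, d)" by (cases "act u (lift X)")
    ultimately show False using a by auto
  qed
  have "\<exists>ws\<in>words (Suc n). X \<in> disc u ws" for n
  proof (induction n)
    case 0
    obtain x where "x \<notin> {N1, N2}" "kf x (act u (lift X)) \<le> 0"
    proof (cases "\<exists>l. kf l (act u (lift X)) < 0")
      case True
      then obtain l where "kf l (act u (lift X)) < 0" by blast
      moreover from this have "l \<notin> {N1, N2}" using u by (metis insertE not_le singletonD)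
      ultimately show ?thesis using that less_imp_le by blast
    next
      case False
      then obtain l l' where l: "l \<noteq> l'" "kf l (act u (lift X)) \<le> 0" "kf l' (act u (lift X)) \<le> 0"
        using residual_covering[OF X, of u] by blast
      then have "l \<notin> {N1, N2} \<or> l' \<notin> {N1, N2}" using not2 by (metis insertE singletonD)
      then show ?thesis using that l by blast
    qed
    then show ?case by (intro bexI[of _ "[x]"]) (auto simp: words_def disc_def)
  next
    case (Suc n)
    then obtain ws where ws: "ws \<in> words (Suc n)" "X \<in> disc u ws" by blast
    then obtain c us where c: "ws = c # us" by (cases ws) (auto simp: words_def)
    let ?y = "act (ws @ u) (lift X)"
    have nn: "kf c ?y \<ge> 0" using ws(2) by (simp add: disc_def c)
    obtain x where x: "x \<noteq> c" "kf x ?y \<le> 0"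
      using residual_covering[OF X, of "ws @ u"] nn by (metis less_imp_le not_le)
    have "x # ws \<in> words (Suc (Suc n))" using ws x by (auto simp: words_def c)
    moreover have "X \<in> disc u (x # ws)" using x by (simp add: disc_def)
    ultimately show ?case by blast
  qed
  with u show ?thesis by blast
qed

section \<open>The upper bound\<close>

lemma FU_step:
  assumes v: "valid ws" and l: "length ws \<ge> 3"
  shows "mpair (pt ws) (rv (zU ws)) > 0"
    "mpair (pt ws) (rv (zU ws)) \<le> - 15000 * kf (hd ws) (pt ws :: real v4)"
    "(\<Sum>x\<in>- {hd ws}. FU (x # ws)) \<le> FU ws"
proof -
  obtain c d y us where ws: "ws = c # d # y # us"
    using l by (cases ws; cases "tl ws"; cases "tl (tl ws)") auto
  have v': "valid (c # d # y # us)" using v ws by blast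
  have k: "kf c (pt (c # d # y # us) :: real v4) \<le> 0"
  proof -
    have "kf c (pt (c # d # y # us) :: real v4) \<le> - 4 * real (length (c # d # y # us))"
      using pt_kf[OF v'] by blast
    then show ?thesis by simp
  qed
  have "mpair (pt ws) (rv (zU ws)) > 0 \<and>
    mpair (pt ws) (rv (zU ws)) \<le> - 15000 * kf (hd ws) (pt ws :: real v4) \<and>
    (\<Sum>x\<in>- {hd ws}. FU (x # ws)) \<le> FU ws"
  proof (cases "y = c \<and> \<not> opp c d \<and> run ws \<ge> 8")
    case True
    then have "y = c" by blast
    then show ?thesis using FU_step_long[of c d us] v' True unfolding ws by (simp only: list.sel) blast
  next
    case False
    then have "y = c \<Longrightarrow> opp c d \<or> run (c # d # y # us) < 8" unfolding ws by linarith
    from FU_step_short[OF v' this] k show ?thesis unfolding ws list.sel by linarith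
  qed
  then show "mpair (pt ws) (rv (zU ws)) > 0"
    "mpair (pt ws) (rv (zU ws)) \<le> - 15000 * kf (hd ws) (pt ws :: real v4)"
    "(\<Sum>x\<in>- {hd ws}. FU (x # ws)) \<le> FU ws" by blast+
qed

lemma finite_words: "finite (words n)"
  using finite_lists_length_eq[of "UNIV :: letter set" n]
  by (rule finite_subset[rotated]) (auto simp: words_def)

lemma words_Suc:
  "n > 0 \<Longrightarrow> words (Suc n) = (\<lambda>(ws, x). x # ws) ` (SIGMA ws:words n. - {hd ws})"
proof (intro equalityI subsetI)
  fix vs assume n: "n > 0" and "vs \<in> words (Suc n)"
  then obtain x y us where "vs = x # y # us" "x \<noteq> y" "y # us \<in> words n"
    by (cases vs; cases "tl vs") (auto simp: words_def)
  then show "vs \<in> (\<lambda>(ws, x). x # ws) ` (SIGMA ws:words n. - {hd ws})" by force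
next
  fix vs assume n: "n > 0" and "vs \<in> (\<lambda>(ws, x). x # ws) ` (SIGMA ws:words n. - {hd ws})"
  then obtain ws x where "vs = x # ws" "ws \<in> words n" "x \<noteq> hd ws" by auto
  then show "vs \<in> words (Suc n)" using n by (cases ws) (auto simp: words_def)
qed

lemma sum_FU_le: "n \<ge> 3 \<Longrightarrow> (\<Sum>ws\<in>words n. FU ws) \<le> (\<Sum>ws\<in>words 3. FU ws)"
proof (induction n rule: dec_induct)
  case (step n)
  have "(\<Sum>ws\<in>words (Suc n). FU ws) = (\<Sum>(ws, x)\<in>(SIGMA ws:words n. - {hd ws}). FU (x # ws))"
    using step by (subst words_Suc, simp, subst sum.reindex) (auto simp: inj_on_def case_prod_unfold)
  also have "\<dots> = (\<Sum>ws\<in>words n. \<Sum>x\<in>- {hd ws}. FU (x # ws))"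
    by (rule sum.Sigma[symmetric]) (auto simp: finite_words)
  also have "\<dots> \<le> (\<Sum>ws\<in>words n. FU ws)"
    using step by (intro sum_mono FU_step) (auto simp: words_def)
  finally show ?case using step by simp
qed simp

text \<open>The sums at exponent \<open>sU\<close> merely stay bounded; the excess
  \<open>s - sU\<close> contributes a power of the mesh that tends to zero. The countably many
  strips are then united.\<close>

lemma residual_null:
  assumes s: "s > sU"
  shows "hausdorff_measure s mallows_residual = 0"
proof -
  have s0: "s > 0" using s by simp
  define A where "A = (\<lambda>u. {X. set u \<subseteq> {N1, N2} \<and> (\<forall>n. \<exists>ws\<in>words (Suc n). X \<in> disc u ws)})"
  have A: "hausdorff_measure s (A u) = 0" for u
  proof (rule hausdorff_null_finite[OF s0])
    fix d e :: real assume d: "d > 0" and e: "e > 0"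
    define T where "T = (\<Sum>ws\<in>words 3. FU ws)"
    let ?C = "(2 * sqrt 8 * 15000) powr sU"
    have lim: "(\<lambda>n. 2 * sqrt 8 / (4 * real (Suc n))) \<longlonglongrightarrow> 0"
      by real_asymp
    have lim2: "(\<lambda>n. (2 * sqrt 8 / (4 * real (Suc n))) powr (s - sU) * (?C * T)) \<longlonglongrightarrow> 0 powr (s - sU) * (?C * T)"
      using s by (intro tendsto_intros tendsto_powr2 lim) auto
    then have lim2: "(\<lambda>n. (2 * sqrt 8 / (4 * real (Suc n))) powr (s - sU) * (?C * T)) \<longlonglongrightarrow> 0"
      using s by simp
    have "\<forall>\<^sub>F n in sequentially. 2 * sqrt 8 / (4 * real (Suc n)) < d \<and>
        (2 * sqrt 8 / (4 * real (Suc n))) powr (s - sU) * (?C * T) < e \<and> n \<ge> 2"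
      using order_tendstoD(2)[OF lim d] order_tendstoD(2)[OF lim2 e] eventually_ge_at_top[of 2]
      by eventually_elim auto
    then obtain n where n: "2 * sqrt 8 / (4 * real (Suc n)) < d"
      "(2 * sqrt 8 / (4 * real (Suc n))) powr (s - sU) * (?C * T) < e" "n \<ge> 2"
      by (auto dest!: eventually_happens)
    let ?m = "2 * sqrt 8 / (4 * real (Suc n))"
    show "\<exists>xs. A u \<subseteq> \<Union> (set xs) \<and> (\<forall>U\<in>set xs. bounded U \<and> diameter U \<le> d) \<and>
        (\<Sum>U\<leftarrow>xs. diameter U powr s) \<le> e"
    proof (cases "set u \<subseteq> {N1, N2}")
      case False
      then show ?thesis using e by (intro exI[of _ "[]"]) (auto simp: A_def)
    next
      case u: True
      obtain W where W: "set W = words (Suc n)" "distinct W"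
        using finite_distinct_list[OF finite_words] by blast
      have disc: "bounded (disc u ws) \<and> diameter (disc u ws) \<le> ?m \<and>
          diameter (disc u ws) powr s \<le> ?m powr (s - sU) * (?C * FU ws)" if ws: "ws \<in> words (Suc n)" for ws
      proof -
        have v: "valid ws" and l: "length ws = Suc n" using ws by (auto simp: words_def)
        then obtain c us where c: "ws = c # us" by (cases ws) auto
        have vc: "valid (c # us)" using v c by simp
        define K where "K = - kf c (pt ws :: real v4)"
        have K: "K \<ge> 4 * real (Suc n)"
        proof -
          have "kf c (pt (c # us) :: real v4) \<le> - 4 * real (length (c # us))"
            using pt_kf[OF vc] by blast
          moreover have e: "length (c # us) = Suc n" using l c by simp
          ultimately show ?thesis unfolding K_def c e by simp
        qed
        have K0: "K > 0" using K by simp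
        obtain q where q: "disc u ws = cball q (sqrt 8 / K)"
          using disc_cball[OF u vc] unfolding c K_def by blast
        have dm: "diameter (disc u ws) = 2 * sqrt 8 / K"
          unfolding q using K0 by (auto simp: divide_less_0_iff)
        have le: "2 * sqrt 8 / K \<le> ?m" using K K0 by (intro divide_left_mono) auto
        have "2 * sqrt 8 / K \<le> (2 * sqrt 8 * 15000) / mpair (pt ws) (rv (zU ws))"
        proof -
          have z: "mpair (pt ws) (rv (zU ws)) > 0" "mpair (pt ws) (rv (zU ws)) \<le> 15000 * K"
            using FU_step(1,2)[OF v] l n(3) unfolding K_def c list.sel by linarith+
          have "2 * sqrt 8 * mpair (pt ws) (rv (zU ws)) \<le> 2 * sqrt 8 * (15000 * K)"
            using z by (intro mult_left_mono) auto
          then show ?thesis using z K0 by (simp add: divide_simps mult_ac)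
        qed
        then have "(2 * sqrt 8 / K) powr sU \<le> ((2 * sqrt 8 * 15000) / mpair (pt ws) (rv (zU ws))) powr sU"
          using K0 by (intro powr_mono2) auto
        also have "\<dots> = ?C * FU ws"
          by (simp only: powr_divide FU_def powr_minus_divide times_divide_eq_right mult_1_right)
        finally have a: "(2 * sqrt 8 / K) powr sU \<le> ?C * FU ws" .
        have "(2 * sqrt 8 / K) powr s = (2 * sqrt 8 / K) powr (s - sU) * (2 * sqrt 8 / K) powr sU"
          by (simp flip: powr_add)
        also have "\<dots> \<le> ?m powr (s - sU) * (?C * FU ws)"
          using a le s K0 by (intro mult_mono powr_mono2) auto
        finally have "(2 * sqrt 8 / K) powr s \<le> ?m powr (s - sU) * (?C * FU ws)" .
        moreover have "bounded (disc u ws)" unfolding q by simp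
        ultimately show ?thesis using le unfolding dm by blast
      qed
      have "A u \<subseteq> \<Union> (set (map (disc u) W))"
        using W by (force simp: A_def)
      moreover have "\<forall>U\<in>set (map (disc u) W). bounded U \<and> diameter U \<le> d"
        using disc n(1) W(1) by (metis (no_types, lifting) image_iff less_imp_le list.set_map order_trans)
      moreover have "(\<Sum>U\<leftarrow>map (disc u) W. diameter U powr s) \<le> e"
      proof -
        have "(\<Sum>U\<leftarrow>map (disc u) W. diameter U powr s) = (\<Sum>ws\<in>words (Suc n). diameter (disc u ws) powr s)"
          using W by (simp add: sum_list_distinct_conv_sum_set comp_def)
        also have "\<dots> \<le> (\<Sum>ws\<in>words (Suc n). ?m powr (s - sU) * (?C * FU ws))"
          using disc by (intro sum_mono) blast
        also have "\<dots> = ?m powr (s - sU) * (?C * (\<Sum>ws\<in>words (Suc n). FU ws))"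
          by (simp only: sum_distrib_left)
        also have "\<dots> \<le> ?m powr (s - sU) * (?C * T)"
          unfolding T_def using n(3) by (intro mult_left_mono sum_FU_le) auto
        finally show ?thesis using n(2) by simp
      qed
      ultimately show ?thesis by blast
    qed
  qed
  have "mallows_residual \<subseteq> (\<Union>i. A (from_nat i))"
  proof
    fix X assume "X \<in> mallows_residual"
    then obtain u where "X \<in> A u" using residual_words unfolding A_def by blast
    then show "X \<in> (\<Union>i. A (from_nat i))" by (intro UN_I[of "to_nat u"]) auto
  qed
  then have "hausdorff_measure s mallows_residual \<le> hausdorff_measure s (\<Union>i. A (from_nat i))"
    by (rule hausdorff_measure_mono)
  also have "\<dots> = 0" by (intro hausdorff_null_UN A)
  finally show ?thesis by simp
qed

lemma dim_upper: "hausdorff_dim mallows_residual < ereal 1.348771"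
proof -
  \<comment> \<open>Any exponent strictly between \<open>31 / 23\<close> and the claimed bound would
    serve.\<close>
  have "hausdorff_dim mallows_residual \<le> ereal 1.3487"
    unfolding hausdorff_dim_def using residual_null[of "1.3487"]
    by (intro INF_lower) auto
  also have "\<dots> < ereal 1.348771" by simp
  finally show ?thesis .
qed

section \<open>The lower certificate\<close>

text \<open>Every weight \<open>(\<lambda>, \<mu>)\<close> satisfies \<open>\<mu> \<ge> \<lambda> powr (128/73)\<close> in the scales \<open>2^16\<close> and
  \<open>2^20\<close>, where \<open>128/73 = 1 + 1/s\<close> for \<open>s = 73/55\<close>. The admitted \<open>\<lambda>\<close> are \<open>(1 + i/16) / 2^j\<close>.\<close>

fun halfpow :: "nat \<Rightarrow> int" where
  "halfpow 0 = 16777216"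
| "halfpow (Suc n) = halfpow n * 4976070 div 16777216 + 1"

definition mu_table :: "int list" where
  "mu_table = [65536, 72887, 80570, 88582, 96918, 105575, 114547, 123833, 133427, 143328, 153531, 164035,
     174836, 185931, 197319, 208996]"

text \<open>The factors of the second component have scales \<open>2 ^ 16\<close> and
  \<open>2 ^ 24\<close>; the division returns to \<open>2 ^ 20\<close>, rounding up.\<close>

definition leaf :: "nat \<Rightarrow> int \<times> int" where
  "leaf n = ((16 + int (n mod 16)) * 2 ^ (12 - n div 16),
     mu_table ! (n mod 16) * halfpow (n div 16) div 1048576 + 1)"

definition leaves :: "(int \<times> int) list" where
  "leaves =
    [(36864, 382350), (38912, 420371), (40960, 459930), (43008, 501012), (45056, 543589),
     (47104, 587656), (49152, 633185), (51200, 680171), (53248, 728590), (55296, 778437),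
     (57344, 829694), (16384, 92244), (17408, 102590), (19456, 124681), (20480, 136414),
     (21504, 148599), (22528, 161227), (23552, 174297), (24576, 187801), (26624, 216098),
     (28672, 246085), (29696, 261701), (30720, 277730), (31744, 294166), (8192, 27360), (8704,
     30428), (9216, 33636), (9728, 36980), (10752, 44074), (11264, 47820), (11776, 51696),
     (12288, 55702), (13312, 64094), (13824, 68479), (14336, 72988), (15360, 82374), (15872,
     87249), (4096, 8115), (4352, 9025), (4608, 9977), (4864, 10969), (5120, 12001), (5376,
     13073), (5632, 14184), (5888, 15333), (6144, 16521), (6656, 19011), (6912, 20311), (7168,
     21649), (7424, 23022), (7680, 24432), (2048, 2407), (2176, 2677), (2304, 2959), (2432,
     3254), (2560, 3560), (2688, 3878), (2816, 4207), (2944, 4548), (3072, 4901), (3200, 5264),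
     (3328, 5639), (3584, 6421), (3712, 6829), (3840, 7247), (3968, 7676), (1536, 1454), (1600,
     1562), (1728, 1787), (1856, 2026)]"

definition leaf_codes :: "nat list" where
  "leaf_codes =
    [18, 19, 20, 21, 22, 23, 24, 25, 26, 27, 28, 32, 33, 35, 36, 37, 38, 39, 40, 42, 44, 45,
     46, 47, 48, 49, 50, 51, 53, 54, 55, 56, 58, 59, 60, 62, 63, 64, 65, 66, 67, 68, 69, 70,
     71, 72, 74, 75, 76, 77, 78, 80, 81, 82, 83, 84, 85, 86, 87, 88, 89, 90, 92, 93, 94, 95,
     104, 105, 107, 109]"

lemma leaves_eq: "leaves = map leaf leaf_codes"
  by code_simp

lemma leaf_codes_less: "list_all (\<lambda>n. n div 16 \<le> 12) leaf_codes"
  by code_simp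

text \<open>Fixed-point products with 40 binary digits after the point, rounded up and down.\<close>

definition mulup :: "int \<Rightarrow> int \<Rightarrow> int" where
  "mulup a b = (a * b + 1099511627775) div 1099511627776"

definition muldown :: "int \<Rightarrow> int \<Rightarrow> int" where
  "muldown a b = a * b div 1099511627776"

definition pow128up :: "int \<Rightarrow> int" where
  "pow128up a = (let b = mulup a a; c = mulup b b; d = mulup c c; e = mulup d d; f = mulup e e;
     g = mulup f f in mulup g g)"

definition pow73down :: "int \<Rightarrow> int" where
  "pow73down a = (let b = muldown a a; c = muldown b b; d = muldown c c; e = muldown d d;
     f = muldown e e; g = muldown f f in muldown (muldown g d) a)"

lemma mu_table_check:
  "list_all (\<lambda>(i, m). 0 \<le> m \<and> pow128up ((16 + i) * 68719476736) \<le> pow73down (m * 16777216))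
     (zip [0,1,2,3,4,5,6,7,8,9,10,11,12,13,14,15] mu_table)"
  by code_simp

text \<open>\<open>(1 / 2) ^ 128\<close> would vanish at 40 binary digits. Multiplying both sides by
  \<open>4 ^ 73\<close> turns it into \<open>2 ^ 18 = 262144\<close>.\<close>

lemma halfpow_check: "262144 * 1099511627776 \<le> pow73down (4976070 * 262144)"
  by code_simp

lemma div_bounds:
  fixes q x :: int
  assumes "q > 0"
  shows "q * (x div q) \<le> x" "x \<le> q * (x div q + 1)" "x \<le> q * ((x + (q - 1)) div q)"
proof -
  have e: "q * (y div q) + y mod q = y" "0 \<le> y mod q" "y mod q < q" for y
    using assms by simp_all
  show "q * (x div q) \<le> x" using e[of x] by linarith
  show "x \<le> q * (x div q + 1)" using e[of x] by (simp only: distrib_left mult_1_right)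
  show "x \<le> q * ((x + (q - 1)) div q)" using e[of "x + (q - 1)"] by linarith
qed

abbreviation fx :: "int \<Rightarrow> real" where "fx a \<equiv> of_int a / 1099511627776"

lemma mulup: "r \<le> fx a \<Longrightarrow> 0 \<le> r \<Longrightarrow> r * r \<le> fx (mulup a a)"
proof -
  assume r: "r \<le> fx a" "0 \<le> r"
  have "a * a \<le> 1099511627776 * mulup a a" using div_bounds(3)[of 1099511627776 "a * a"] by (simp add: mulup_def)
  then have "real_of_int (a * a) \<le> of_int (1099511627776 * mulup a a)" by (simp only: of_int_le_iff)
  then have "fx a * fx a \<le> fx (mulup a a)" by simp
  moreover have "r * r \<le> fx a * fx a" using r by (intro mult_mono) auto
  ultimately show ?thesis by linarith
qed

lemma muldown:
  "fx a \<le> r \<Longrightarrow> 0 \<le> a \<Longrightarrow> fx b \<le> t \<Longrightarrow> 0 \<le> b \<Longrightarrow> fx (muldown a b) \<le> r * t \<and> 0 \<le> muldown a b"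
proof -
  assume r: "fx a \<le> r" "0 \<le> a" "fx b \<le> t" "0 \<le> b"
  have "1099511627776 * muldown a b \<le> a * b" using div_bounds(1)[of 1099511627776 "a * b"] by (simp add: muldown_def)
  then have "real_of_int (1099511627776 * muldown a b) \<le> of_int (a * b)" by (simp only: of_int_le_iff)
  then have "fx (muldown a b) \<le> fx a * fx b" by simp
  moreover have "fx a * fx b \<le> r * t" using r by (intro mult_mono) (auto intro: order_trans[OF _ r(1)])
  ultimately show ?thesis using r by (simp add: muldown_def pos_imp_zdiv_nonneg_iff)
qed

lemma pow128up:
  assumes "0 \<le> a" shows "fx a ^ 128 \<le> fx (pow128up a)"
proof -
  let ?r = "fx a"
  define b c d e f g where "b = mulup a a" and "c = mulup b b" and "d = mulup c c"
    and "e = mulup d d" and "f = mulup e e" and "g = mulup f f"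
  have sq: "?r ^ n * ?r ^ n = ?r ^ (2 * n)" for n by (simp add: mult_2 power_add)
  have up: "?r ^ (2 * n) \<le> fx (mulup k k)" if "?r ^ n \<le> fx k" for n k
    using mulup[OF that] assms unfolding sq by simp
  have "?r ^ 1 \<le> fx a" by simp
  from up[OF this] have "?r ^ 2 \<le> fx b" by (simp add: b_def)
  from up[OF this] have "?r ^ 4 \<le> fx c" by (simp add: c_def)
  from up[OF this] have "?r ^ 8 \<le> fx d" by (simp add: d_def)
  from up[OF this] have "?r ^ 16 \<le> fx e" by (simp add: e_def)
  from up[OF this] have "?r ^ 32 \<le> fx f" by (simp add: f_def)
  from up[OF this] have "?r ^ 64 \<le> fx g" by (simp add: g_def)
  from up[OF this] have "?r ^ 128 \<le> fx (mulup g g)" by simp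
  then show ?thesis
    by (simp only: pow128up_def Let_def b_def c_def d_def e_def f_def g_def)
qed

lemma pow73down:
  assumes "0 \<le> a" shows "fx (pow73down a) \<le> fx a ^ 73"
proof -
  let ?r = "fx a"
  define b c d e f g where "b = muldown a a" and "c = muldown b b" and "d = muldown c c"
    and "e = muldown d d" and "f = muldown e e" and "g = muldown f f"
  have dn: "fx (muldown k l) \<le> ?r ^ (m + n) \<and> 0 \<le> muldown k l"
    if "fx k \<le> ?r ^ m \<and> 0 \<le> k" "fx l \<le> ?r ^ n \<and> 0 \<le> l" for k l m n
    using muldown[of k "?r ^ m" l "?r ^ n"] that by (simp add: power_add)
  have a1: "fx a \<le> ?r ^ 1 \<and> 0 \<le> a" using assms by simp
  from dn[OF a1 a1] have "fx b \<le> ?r ^ 2 \<and> 0 \<le> b" by (simp add: b_def numeral_2_eq_2)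
  from dn[OF this this] have "fx c \<le> ?r ^ 4 \<and> 0 \<le> c" by (simp add: c_def)
  from dn[OF this this] have d: "fx d \<le> ?r ^ 8 \<and> 0 \<le> d" by (simp add: d_def)
  from dn[OF this this] have "fx e \<le> ?r ^ 16 \<and> 0 \<le> e" by (simp add: e_def)
  from dn[OF this this] have "fx f \<le> ?r ^ 32 \<and> 0 \<le> f" by (simp add: f_def)
  from dn[OF this this] have "fx g \<le> ?r ^ 64 \<and> 0 \<le> g" by (simp add: g_def)
  from dn[OF dn[OF this d] a1] have "fx (muldown (muldown g d) a) \<le> ?r ^ 73" by simp
  then show ?thesis
    by (simp only: pow73down_def Let_def b_def c_def d_def e_def f_def g_def)
qed

lemma mu_table_bound:
  assumes "i < 16"
  shows "0 \<le> mu_table ! i" "(of_int (16 + int i) / of_int 16 :: real) powr (128 / 73) \<le> of_int (mu_table ! i) / 65536"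
proof -
  let ?l = "[0,1,2,3,4,5,6,7,8,9,10,11,12,13,14,15] :: int list"
  have len: "length mu_table = 16" by (simp add: mu_table_def)
  have "?l = map int [0..<16]" by (simp add: upt_rec)
  then have "?l ! i = int i" using assms by simp
  then have "(int i, mu_table ! i) \<in> set (zip ?l mu_table)"
    using assms len by (auto simp: in_set_conv_nth intro!: exI[of _ i])
  then have m: "0 \<le> mu_table ! i"
    "pow128up ((16 + int i) * 68719476736) \<le> pow73down (mu_table ! i * 16777216)"
    using mu_table_check unfolding list_all_iff by fast+
  show "0 \<le> mu_table ! i" by (rule m)
  have "real_of_int (pow128up ((16 + int i) * 68719476736)) \<le> of_int (pow73down (mu_table ! i * 16777216))"
    using m(2) by (simp only: of_int_le_iff)
  then have "fx ((16 + int i) * 68719476736) ^ 128 \<le> fx (mu_table ! i * 16777216) ^ 73"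
    using pow128up[of "(16 + int i) * 68719476736"] pow73down[of "mu_table ! i * 16777216"] m(1) by simp
  moreover have "fx ((16 + int i) * 68719476736) = of_int (16 + int i) / of_int 16"
    "fx (mu_table ! i * 16777216) = of_int (mu_table ! i) / 65536" by simp_all
  ultimately have "(of_int (16 + int i) / of_int 16 :: real) ^ 128 \<le> (of_int (mu_table ! i) / 65536) ^ 73"
    by (simp only:)
  then show "(of_int (16 + int i) / of_int 16 :: real) powr (128 / 73) \<le> of_int (mu_table ! i) / 65536"
    using powr_rat_le[of "of_int (16 + int i) / of_int 16" "of_int (mu_table ! i) / 65536" 73 128] m(1)
    by simp
qed

lemma half_powr: "(1 / 2 :: real) powr (128 / 73) \<le> 4976070 / 16777216"
proof -
  have "real_of_int (262144 * 1099511627776) \<le> of_int (pow73down (4976070 * 262144))"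
    using halfpow_check by (simp only: of_int_le_iff)
  then have "262144 \<le> fx (4976070 * 262144) ^ 73"
    using pow73down[of "4976070 * 262144"] by simp
  also have "fx (4976070 * 262144) = 4 * (4976070 / 16777216)" by simp
  finally have "262144 / 4 ^ 73 \<le> (4976070 / 16777216 :: real) ^ 73"
    by (simp only: power_mult_distrib) (simp only: pos_divide_le_eq zero_less_power zero_less_numeral mult.commute)
  moreover have "(1 / 2 :: real) ^ 128 = 262144 / 4 ^ 73"
    using power_add[of "2 :: real" 128 18] power_mult[of "2 :: real" 2 73]
    by (simp only: power_divide power_one) (simp add: divide_simps)
  ultimately have "(1 / 2 :: real) ^ 128 \<le> (4976070 / 16777216) ^ 73" by (simp only:)
  then show ?thesis
    using powr_rat_le[of "1 / 2" "4976070 / 16777216" 73 128] by simp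
qed

lemma halfpow: "((1 / 2) ^ n) powr (128 / 73) \<le> of_int (halfpow n) / (16777216 :: real) \<and> halfpow n > 0"
proof (induction n)
  case (Suc n)
  note h = half_powr
  have "((1 / 2 :: real) ^ Suc n) powr (128 / 73) = (1 / 2) powr (128 / 73) * ((1 / 2) ^ n) powr (128 / 73)"
    by (simp only: power_Suc powr_mult)
  also have "\<dots> \<le> 4976070 / 16777216 * (of_int (halfpow n) / 16777216)"
    using Suc h by (intro mult_mono) auto
  also have "\<dots> \<le> of_int (halfpow (Suc n)) / 16777216"
  proof -
    have "halfpow n * 4976070 \<le> 16777216 * halfpow (Suc n)"
      using div_bounds(2)[of 16777216 "halfpow n * 4976070"] by simp
    then have "real_of_int (halfpow n * 4976070) \<le> of_int (16777216 * halfpow (Suc n))"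
      by (simp only: of_int_le_iff)
    then show ?thesis by (simp del: halfpow.simps)
  qed
  moreover have "halfpow (Suc n) > 0" using Suc by (simp add: pos_imp_zdiv_nonneg_iff add_nonneg_pos)
  ultimately show ?case by (simp del: halfpow.simps)
qed simp

lemma leaf_bound:
  assumes "leaf n = (l, m)" "n div 16 \<le> 12"
  shows "l > 0 \<and> (of_int l / 65536) powr (128 / 73) \<le> of_int m / (1048576 :: real)"
proof -
  define i j where "i = n mod 16" and "j = n div 16"
  have l: "l = (16 + int i) * 2 ^ (12 - j)" and m: "m = mu_table ! i * halfpow j div 1048576 + 1"
    using assms(1) by (simp_all add: leaf_def i_def j_def)
  have i: "i < 16" by (simp add: i_def)
  have j: "j \<le> 12" using assms(2) by (simp only: j_def)
  note mu = mu_table_bound[OF i]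
  have "(2 :: real) ^ 12 = 2 ^ (12 - j) * 2 ^ j" using j by (simp flip: power_add)
  then have "(2 :: real) ^ (12 - j) / 4096 = (1 / 2) ^ j" by (simp add: field_simps)
  moreover have "real_of_int l / 65536 = of_int (16 + int i) / of_int 16 * (2 ^ (12 - j) / 4096)"
    unfolding l by simp
  ultimately have "real_of_int l / 65536 = of_int (16 + int i) / of_int 16 * (1 / 2) ^ j"
    by (simp only:)
  then have "(of_int l / 65536 :: real) powr (128 / 73) =
      (of_int (16 + int i) / of_int 16) powr (128 / 73) * ((1 / 2) ^ j) powr (128 / 73)"
    by (simp only: powr_mult)
  also have "\<dots> \<le> of_int (mu_table ! i) / 65536 * (of_int (halfpow j) / 16777216)"
  proof (intro mult_mono)
    show "(of_int (16 + int i) / of_int 16 :: real) powr (128 / 73) \<le> of_int (mu_table ! i) / 65536"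
      by (rule mu)
  qed (use halfpow mu in auto)
  also have "\<dots> = of_int (mu_table ! i * halfpow j) / 1099511627776" by simp
  also have "\<dots> \<le> of_int m / 1048576"
  proof -
    have "mu_table ! i * halfpow j \<le> 1048576 * m"
      unfolding m using div_bounds(2)[of 1048576 "mu_table ! i * halfpow j"] by simp
    then have "real_of_int (mu_table ! i * halfpow j) \<le> of_int (1048576 * m)"
      by (simp only: of_int_le_iff)
    then show ?thesis by (simp add: mult.commute)
  qed
  finally show ?thesis unfolding l by simp
qed

lemma if_mem: "x \<in> A \<Longrightarrow> y \<in> A \<Longrightarrow> (if P then x else y) \<in> A"
  by simp

lemma weight_leaf: "weight n \<in> set leaves"
  unfolding weight_def by (intro if_mem) (simp_all add: leaves_def)

lemma weight_bound:
  "weight n = (l, m) \<Longrightarrow> l > 0 \<and> (of_int l / 65536) powr (128 / 73) \<le> of_int m / (1048576 :: real)"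
proof -
  assume "weight n = (l, m)"
  then have "(l, m) \<in> set leaves" using weight_leaf[of n] by simp
  then obtain k where "k \<in> set leaf_codes" "leaf k = (l, m)" unfolding leaves_eq by auto
  then show ?thesis using leaf_bound leaf_codes_less by (auto simp: list_all_iff)
qed

section \<open>Soundness of the lower certificate\<close>

lemma kap_kf: "kap q = (kf N1 q + kf N2 q) / 4"
  by (cases q) (simp add: kap_eq)

lemma pt_kap: "valid (c # ws) \<Longrightarrow> kap (pt (c # ws)) > 0"
proof -
  assume v: "valid (c # ws)"
  let ?p = "pt (c # ws) :: real v4"
  have k: "x \<noteq> c \<Longrightarrow> kf x ?p + kf c ?p \<ge> 4" for x using pt_kf[OF v] by blast
  have "kf c ?p \<le> - 4 * real (length (c # ws))" using pt_kf[OF v] by blast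
  then have c0: "kf c ?p \<le> 0" by (simp del: act_simps)
  have "kf N1 ?p + kf N2 ?p > 0"
    using k[of N1] k[of N2] c0 by (cases "c = N1"; cases "c = N2") force+
  then show ?thesis unfolding kap_kf by (rule divide_pos_pos) simp
qed

lemma qform_mpair: "mpair v v = qform v" for v :: "int v4"
  by (cases v) (simp add: algebra_simps)

lemma kap_rv: "causal v \<Longrightarrow> kap (rv v) > 0"
proof -
  assume c: "causal v"
  obtain a b c' d where v: "v = (a, b, c', d)" by (cases v)
  have "0 < a + b" using c unfolding v causal.simps by blast
  then have "(0::real) < of_int (a + b)" by (simp only: of_int_0_less_iff)
  then show ?thesis unfolding v rv.simps kap_eq by simp
qed

lemma causal_pair:
  assumes c: "causal v" and p: "mpair p p = 0" "kap p > 0"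
  shows "mpair p (rv v) \<ge> 0"
proof (rule mpair_causal_nonneg)
  have "0 \<le> qform v" using c by (cases v) (simp only: causal.simps)
  then show "0 \<le> mpair (rv v) (rv v)" by (simp only: mpair_rv of_int_0_le_iff qform_mpair)
  show "0 \<le> mpair p p" by (simp only: p(1) order_refl)
qed (use p kap_rv[OF c] in blast)+

lemma mpair_foldr:
  "mpair p (rv (foldr (\<lambda>(n, w) v. v - smul (snd n) w) ys (smul k z))) =
     of_int k * mpair p (rv z) - (\<Sum>(n, w)\<leftarrow>ys. of_int (snd n) * mpair p (rv w))"
  by (induction ys) (simp_all add: case_prod_unfold smul_rv mpair_scale rv_diff mpair_diff)

definition FL :: "real v4 \<Rightarrow> int v4 \<Rightarrow> real" where
  "FL p z = mpair p (rv z) powr (- (73 / 55))"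

definition total :: "real v4 \<Rightarrow> real" where
  "total p = (\<Sum>x\<in>UNIV. kf x p)"

lemma total_eq: "total p = kf N1 p + kf N2 p + kf N3 p + kf N4 p + kf N5 p"
  by (simp add: total_def UNIV_letter)

lemma checkL1_bound:
  assumes "checkL1 c d e xs" "mpair p p = 0" "kap p > 0"
  shows "total p \<le> mpair p (rv (orient c d (fst e)))"
proof -
  let ?z = "orient c d (fst e)"
  have "causal (?z - (5, 5, 6, 0))" using assms(1) unfolding checkL1_def Let_def by blast
  from causal_pair[OF this assms(2,3)]
  have "mpair p (rv (5, 5, 6, 0)) \<le> mpair p (rv ?z)" by (simp only: rv_diff mpair_diff diff_ge_0_iff_ge)
  moreover have "mpair p (rv (5, 5, 6, 0)) = total p"
    by (cases p) (simp add: total_eq algebra_simps)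
  ultimately show ?thesis by simp
qed

text \<open>Pairing the causal difference vector with \<open>p\<close> yields the linear hypothesis
  of \<open>powr_sum_ge\<close>, with the \<lambda> as multipliers.\<close>

lemma checkL1_sound:
  assumes chk: "checkL1 c d e xs" and p: "mpair p p = 0" "kap p > 0" and tot: "total p > 0"
    and pos: "\<And>x z. (x, z) \<in> set xs \<Longrightarrow> mpair p (rv (mirror x z)) > 0"
  shows "FL p (orient c d (fst e)) \<le> (\<Sum>(x, z)\<leftarrow>xs. FL p (mirror x z))"
proof -
  let ?z = "orient c d (fst e)" and ?w = "\<lambda>x. weight (pick (snd e) (local c d x))"
  let ?S = "{..<length xs}" and ?x = "\<lambda>i. fst (xs ! i)" and ?z' = "\<lambda>i. snd (xs ! i)"
  let ?ys = "map (\<lambda>(x, z'). (?w x, mirror x z')) xs"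
  have N: "mpair p (rv ?z) > 0" using checkL1_bound[OF chk p] tot by linarith
  have lam: "65536 \<le> sum_list (map (\<lambda>(n, w). fst n) ?ys)"
    and mu: "causal (foldr (\<lambda>(n, w) v. v - smul (snd n) w) ?ys (smul 1048576 ?z))"
    using chk unfolding checkL1_def Let_def by blast+
  have "0 \<le> of_int 1048576 * mpair p (rv ?z) - (\<Sum>(n, w)\<leftarrow>?ys. of_int (snd n) * mpair p (rv w))"
    using causal_pair[OF mu p] unfolding mpair_foldr .
  also have "(\<Sum>(n, w)\<leftarrow>?ys. of_int (snd n) * mpair p (rv w)) =
      (\<Sum>i\<in>?S. of_int (snd (?w (?x i))) * mpair p (rv (mirror (?x i) (?z' i))))"
    by (simp add: sum_list_sum_nth atLeast0LessThan case_prod_unfold comp_def)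
  finally have mu': "(\<Sum>i\<in>?S. of_int (snd (?w (?x i))) / 1048576 * mpair p (rv (mirror (?x i) (?z' i)))) \<le> mpair p (rv ?z)"
    by (simp flip: sum_divide_distrib)
  have "real_of_int 65536 \<le> of_int (sum_list (map (\<lambda>(n, w). fst n) ?ys))"
    using lam by (simp only: of_int_le_iff)
  also have "sum_list (map (\<lambda>(n, w). fst n) ?ys) = (\<Sum>i\<in>?S. fst (?w (?x i)))"
    by (simp add: sum_list_sum_nth atLeast0LessThan case_prod_unfold comp_def)
  finally have lam': "1 \<le> (\<Sum>i\<in>?S. real_of_int (fst (?w (?x i))) / 65536)"
    by (simp flip: sum_divide_distrib)
  have "FL p ?z \<le> (\<Sum>i\<in>?S. mpair p (rv (mirror (?x i) (?z' i))) powr (- (73 / 55)))"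
    unfolding FL_def
  proof (rule powr_sum_ge[OF _ _ _ _ _ lam' mu' N])
    fix i assume "i \<in> ?S"
    then have "(?x i, ?z' i) \<in> set xs" by simp
    then show "mpair p (rv (mirror (?x i) (?z' i))) > 0" by (rule pos)
    have w: "weight k = (fst (weight k), snd (weight k))" for k by simp
    show "0 < real_of_int (fst (?w (?x i))) / 65536"
      using weight_bound[OF w, of "pick (snd e) (local c d (?x i))"] by simp
    show "(real_of_int (fst (?w (?x i))) / 65536) powr (1 + 1 / (73 / 55)) \<le> of_int (snd (?w (?x i))) / 1048576"
      using weight_bound[OF w, of "pick (snd e) (local c d (?x i))"] by simp
  qed auto
  also have "\<dots> = (\<Sum>(x, z)\<leftarrow>xs. FL p (mirror x z))"
    by (simp add: sum_list_sum_nth atLeast0LessThan case_prod_unfold FL_def)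
  finally show ?thesis .
qed

section \<open>The tree of admitted words\<close>

fun zL :: "letter list \<Rightarrow> int v4" where
  "zL (c # d # y # us) = (if y = c \<and> \<not> opp c d
     then orient c d (fst (lower_run (kind c d) ! (run (c # d # y # us) - 3))) else startL c d y)"
| "zL _ = (0, 0, 0, 0)"

declare zL.simps [simp del] lower_run.simps [simp del] lower_start.simps [simp del]

text \<open>Opposite walls need no long runs; for tangent ones 36 is the length reached by the 34
  table entries.\<close>

definition admitted :: "letter list \<Rightarrow> bool" where
  "admitted ws \<longleftrightarrow> valid ws \<and> length ws \<ge> 3 \<and>
     run ws \<le> (if opp (hd ws) (hd (tl ws)) then 3 else 36)"

lemma checkL_runs_N1: "list_all (checkL_runs N1) [N2, N3, N5]"
  by code_simp
lemma checkL_runs_N2: "list_all (checkL_runs N2) [N1, N3, N4]"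
  by code_simp
lemma checkL_runs_N3: "list_all (checkL_runs N3) [N1, N2, N4, N5]"
  by code_simp
lemma checkL_runs_N4: "list_all (checkL_runs N4) [N2, N3, N5]"
  by code_simp
lemma checkL_runs_N5: "list_all (checkL_runs N5) [N1, N3, N4]"
  by code_simp
lemma checkL_starts: "list_all (\<lambda>c. list_all (\<lambda>(d, y). checkL_start c d y) (starts c)) letters"
  by code_simp

lemma checkL_start:
  assumes "d \<noteq> c" "y \<noteq> d" "y = c \<Longrightarrow> opp c d"
  shows "checkL_start c d y"
proof -
  have "(d, y) \<in> set (starts c)" using assms by (auto simp: starts_def)
  then show ?thesis using checkL_starts by (fastforce simp: list_all_iff)
qed

lemma checkL_runs:
  assumes "d \<noteq> c" "\<not> opp c d"
  shows "checkL_runs c d"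
  using assms checkL_runs_N1 checkL_runs_N2 checkL_runs_N3 checkL_runs_N4 checkL_runs_N5
  by (cases c; cases d) simp_all

lemma length_lower_run: "c \<noteq> d \<Longrightarrow> \<not> opp c d \<Longrightarrow> length (lower_run (kind c d)) = 34"
  by (cases "kind c d") (auto simp: kind.simps lower_run.simps split: if_splits)

lemma checkL_run_nth:
  "checkL_run c d ex as bs \<Longrightarrow> n < length as \<Longrightarrow>
   checkL1 c d (as ! n) (if Suc n < length as then (d, orient d c (fst (bs ! n))) # ex else ex)"
proof (induction c d ex as bs arbitrary: n rule: checkL_run.induct)
  case (3 c d ex a a' as b bs)
  show ?case
  proof (cases n)
    case 0
    then show ?thesis using 3 by simp
  next
    case (Suc m)
    then show ?thesis using "3.IH"[of m] "3.prems" by (cases "m < length as") simp_all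
  qed
qed simp_all

definition kidsL :: "letter list \<Rightarrow> letter list" where
  "kidsL ws = filter (\<lambda>x. admitted (x # ws)) (kids (hd ws) (hd (tl ws)))"

lemma set_kidsL:
  assumes "admitted ws"
  shows "set (kidsL ws) = {x. admitted (x # ws)}" "distinct (kidsL ws)"
proof -
  obtain c d y us where ws: "ws = c # d # y # us"
    using assms by (cases ws; cases "tl ws"; cases "tl (tl ws)") (auto simp: admitted_def)
  have "c \<noteq> d" using assms by (auto simp: admitted_def ws)
  then have "set (kids c d) = - {c}" by (auto simp: kids_def)
  moreover have "\<not> admitted (c # ws)" by (simp add: admitted_def ws)
  ultimately show "set (kidsL ws) = {x. admitted (x # ws)}" by (auto simp: kidsL_def ws)
  have "distinct letters" by (simp add: letters_def)
  then show "distinct (kidsL ws)" by (simp add: kidsL_def kids_def ws)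
qed

lemma admitted_exit:
  assumes "admitted (c # d # y # us)" "x \<noteq> c" "x \<noteq> d"
  shows "admitted (x # c # d # y # us)" "zL (x # c # d # y # us) = startL x c d"
  using assms by (auto simp: admitted_def zL.simps)

lemma kidsL_map:
  assumes "admitted (c # d # y # us)"
  shows "map (\<lambda>x. (x, zL (x # c # d # y # us))) (kidsL (c # d # y # us)) =
    (if admitted (d # c # d # y # us) then [(d, zL (d # c # d # y # us))] else []) @ exitsL c d"
proof -
  have "filter (\<lambda>x. admitted (x # c # d # y # us)) (filter (\<lambda>x. x \<noteq> c \<and> x \<noteq> d) letters) =
      filter (\<lambda>x. x \<noteq> c \<and> x \<noteq> d) letters"
    using admitted_exit(1)[OF assms] by (intro filter_True) auto
  then show ?thesis
    using admitted_exit(2)[OF assms] by (auto simp: kidsL_def kids_def exitsL_def)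
qed

lemma admitted_check:
  assumes adm: "admitted (c # d # y # us)" (is "admitted ?ws")
  shows "\<exists>e. zL ?ws = orient c d (fst e) \<and> checkL1 c d e (map (\<lambda>x. (x, zL (x # ?ws))) (kidsL ?ws))"
proof -
  have v: "valid ?ws" and cd: "c \<noteq> d" and dy: "y \<noteq> d"
    and r: "run ?ws \<le> (if opp c d then 3 else 36)"
    using adm by (auto simp: admitted_def)
  have opp': "opp d c \<longleftrightarrow> opp c d" by (rule opp_sym)
  have ad: "admitted (d # ?ws) \<longleftrightarrow> Suc (run ?ws) \<le> (if opp c d then 3 else 36)"
    using v cd opp' by (simp add: admitted_def)
  show ?thesis
  proof (cases "y = c \<and> \<not> opp c d")
    case False
    let ?e = "lower_start (kind c d) (local c d y)"
    have z: "zL ?ws = orient c d (fst ?e)" by (simp only: zL.simps False if_False startL_def)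
    have run2: "y \<noteq> c \<Longrightarrow> run ?ws = 2" by simp
    have eq: "(if admitted (d # ?ws) then [(d, zL (d # ?ws))] else []) =
        (if opp c d then (if y = c then [] else [(d, startL d c d)])
         else [(d, orient d c (fst (hd (lower_run (kind d c)))))])"
    proof (cases "opp c d")
      case True
      then show ?thesis
        using ad run2 run_ge[of "d # y # us"] opp' by (auto simp: eval_nat_numeral zL.simps)
    next
      case o: False
      then have y: "y \<noteq> c" using False by blast
      have "lower_run (kind d c) \<noteq> []" using length_lower_run[of d c] cd o opp' by force
      then have "hd (lower_run (kind d c)) = lower_run (kind d c) ! 0" by (rule hd_conv_nth)
      moreover have "zL (d # ?ws) = orient d c (fst (lower_run (kind d c) ! (run (d # ?ws) - 3)))"
        using o opp' by (simp only: zL.simps simp_thms if_True)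
      moreover have "run (d # ?ws) - 3 = 0" using y by simp
      moreover have "admitted (d # ?ws)" using ad run2[OF y] o by simp
      ultimately show ?thesis using o by (simp del: run.simps)
    qed
    have "checkL_start c d y" using cd dy False by (intro checkL_start) auto
    then have "checkL1 c d ?e (map (\<lambda>x. (x, zL (x # ?ws))) (kidsL ?ws))"
      unfolding kidsL_map[OF adm] eq checkL_start_def .
    with z show ?thesis by blast
  next
    case True
    then have yc: "y = c" and o: "\<not> opp c d" by auto
    let ?n = "run ?ws - 3"
    let ?e = "lower_run (kind c d) ! ?n"
    have r3: "3 \<le> run ?ws" "run ?ws \<le> 36" using r o run_ge[of "d # y # us"] by (auto simp: yc)
    have z: "zL ?ws = orient c d (fst ?e)" using True by (simp only: zL.simps simp_thms if_True)
    have len: "length (lower_run (kind c d)) = 34" "length (lower_run (kind d c)) = 34"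
      using length_lower_run[of c d] length_lower_run[of d c] cd o opp' by blast+
    have "checkL_run c d (exitsL c d) (lower_run (kind c d)) (tl (lower_run (kind d c)))"
      using checkL_runs[of d c] cd o unfolding checkL_runs_def by simp
    from checkL_run_nth[OF this, of ?n] r3 len
    have chk: "checkL1 c d ?e (if Suc ?n < 34
        then (d, orient d c (fst (tl (lower_run (kind d c)) ! ?n))) # exitsL c d else exitsL c d)"
      by simp
    have ad': "admitted (d # ?ws) \<longleftrightarrow> Suc ?n < 34" unfolding ad using o r3 by auto
    have zd: "zL (d # ?ws) = orient d c (fst (tl (lower_run (kind d c)) ! ?n))" if "Suc ?n < 34"
    proof -
      have a1: "run (d # ?ws) = Suc (run ?ws)" by (simp add: yc)
      have a2: "Suc (run ?ws) - 3 = Suc ?n" using r3 by simp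
      have "zL (d # ?ws) = orient d c (fst (lower_run (kind d c) ! (run (d # ?ws) - 3)))"
        using o opp' by (simp only: zL.simps simp_thms if_True)
      moreover have "tl (lower_run (kind d c)) ! ?n = lower_run (kind d c) ! Suc ?n"
        using that len by (intro nth_tl) simp
      ultimately show ?thesis by (simp only: a1 a2)
    qed
    have "checkL1 c d ?e (map (\<lambda>x. (x, zL (x # ?ws))) (kidsL ?ws))"
      unfolding kidsL_map[OF adm] ad' using chk zd by (cases "Suc ?n < 34") simp_all
    with z show ?thesis by blast
  qed
qed

text \<open>Each of the four other walls contributes at least the curvature, and \<open>c\<close>
  takes it away once.\<close>

lemma pt_total:
  assumes v: "valid (c # ws)"
  shows "total (pt (c # ws)) \<ge> - 3 * kf c (pt (c # ws) :: real v4)"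
proof -
  let ?p = "pt (c # ws) :: real v4"
  have "kf x ?p \<ge> - kf c ?p" if "x \<noteq> c" for x
  proof -
    have "kf x ?p + kf c ?p \<ge> 4" using pt_kf[OF v] that by blast
    then show ?thesis by linarith
  qed
  then have "(\<Sum>x\<in>- {c}. - kf c ?p) \<le> (\<Sum>x\<in>- {c}. kf x ?p)" by (intro sum_mono) auto
  moreover have "card (- {c}) = 4"
    by (simp add: card_Diff_singleton Compl_eq_Diff_UNIV) (simp add: UNIV_letter)
  moreover have "total ?p = kf c ?p + (\<Sum>x\<in>- {c}. kf x ?p)"
    unfolding total_def by (subst sum.remove[of _ c]) (auto simp: Compl_eq_Diff_UNIV)
  ultimately show ?thesis by simp
qed

lemma admitted_total:
  assumes adm: "admitted ws"
  shows "0 < total (pt ws)" "total (pt ws) \<le> mpair (pt ws) (rv (zL ws))"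
    "mpair (pt ws) (pt ws :: real v4) = 0" "kap (pt ws) > 0"
proof -
  obtain c d y us where ws: "ws = c # d # y # us"
    using adm by (cases ws; cases "tl ws"; cases "tl (tl ws)") (auto simp: admitted_def)
  have v: "valid (c # d # y # us)" using adm by (simp add: admitted_def ws)
  show l: "mpair (pt ws) (pt ws :: real v4) = 0" by (rule pt_light)
  show k: "kap (pt ws) > 0" unfolding ws by (rule pt_kap[OF v])
  have "kf c (pt ws :: real v4) \<le> - 4 * real (length ws)" using pt_kf[OF v] unfolding ws by blast
  then have "kf c (pt ws :: real v4) < 0" by (simp add: ws del: act_simps)
  moreover have "total (pt ws) \<ge> - 3 * kf c (pt ws :: real v4)" using pt_total[OF v] unfolding ws .
  ultimately show "0 < total (pt ws)" by linarith
  obtain e where e: "zL ws = orient c d (fst e)" "checkL1 c d e (map (\<lambda>x. (x, zL (x # ws))) (kidsL ws))"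
    using admitted_check[of c d y us] adm unfolding ws by blast
  show "total (pt ws) \<le> mpair (pt ws) (rv (zL ws))"
    unfolding e(1) by (rule checkL1_bound[OF e(2) l k])
qed

lemma FL_step:
  assumes adm: "admitted ws"
  shows "FL (pt ws) (zL ws) \<le> (\<Sum>x | admitted (x # ws). FL (pt (x # ws)) (zL (x # ws)))"
proof -
  obtain c d y us where ws: "ws = c # d # y # us"
    using adm by (cases ws; cases "tl ws"; cases "tl (tl ws)") (auto simp: admitted_def)
  obtain e where e: "zL ws = orient c d (fst e)" "checkL1 c d e (map (\<lambda>x. (x, zL (x # ws))) (kidsL ws))"
    using admitted_check[of c d y us] adm unfolding ws by blast
  have eq: "mpair (pt (x # ws)) (rv z) = mpair (pt ws) (rv (mirror x z))" for x z
    by (simp only: act_simps mpair_mirror mirror_rv)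
  have "FL (pt ws) (zL ws) \<le> (\<Sum>(x, z)\<leftarrow>map (\<lambda>x. (x, zL (x # ws))) (kidsL ws). FL (pt ws) (mirror x z))"
    unfolding e(1)
  proof (rule checkL1_sound[OF e(2) admitted_total(3,4,1)[OF adm]])
    fix x z assume "(x, z) \<in> set (map (\<lambda>x. (x, zL (x # ws))) (kidsL ws))"
    then have "x \<in> set (kidsL ws)" and z: "z = zL (x # ws)" by auto
    then have "admitted (x # ws)" using set_kidsL(1)[OF adm] by blast
    then show "mpair (pt ws) (rv (mirror x z)) > 0"
      using admitted_total(1,2)[of "x # ws"] unfolding z eq[symmetric] by linarith
  qed
  also have "\<dots> = (\<Sum>x\<leftarrow>kidsL ws. FL (pt (x # ws)) (zL (x # ws)))"
    by (simp only: map_map comp_def prod.case FL_def eq)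
  also have "\<dots> = (\<Sum>x\<in>set (kidsL ws). FL (pt (x # ws)) (zL (x # ws)))"
    by (rule sum_list_distinct_conv_sum_set[OF set_kidsL(2)[OF adm]])
  finally show ?thesis by (simp only: set_kidsL(1)[OF adm])
qed

section \<open>Geometry of the discs of admitted words\<close>

lemma total_mirror: "total (mirror c q) = total q + (if c = N3 then 6 else 10) * kf c q"
  by (cases c; cases q) (simp_all add: total_eq Let_def algebra_simps)

lemma pt_regular_step:
  fixes q :: "real v4"
  assumes k: "kf c q \<ge> 0" and x: "x \<noteq> c" "kf x q \<ge> 0" and t: "total q \<le> 12 * kf c q \<or> total q \<le> 12 * kf x q"
  shows "total (mirror c q) \<le> 12 * kf x (mirror c q)"
proof -
  have "total (mirror c q) \<le> total q + 12 * kf c q"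
    using k by (auto simp: total_mirror)
  moreover have "kf x (mirror c q) \<ge> kf x q + 2 * kf c q"
    using k by (simp add: kf_mirror[OF x(1)])
  ultimately show ?thesis using t x(2) k by linarith
qed

text \<open>Reflection in \<open>c\<close> raises \<open>total\<close> by at most
  \<open>12 * kf c\<close> and any other wall by at least \<open>2 * kf c\<close>. So walls outside
  the run stay comparable to \<open>total\<close>, while the constant for the head grows by 12 with
  each letter of the run.\<close>

lemma pt_regular:
  assumes "valid (c # d # us)"
  shows "(\<forall>x. x \<noteq> c \<and> x \<noteq> d \<longrightarrow> total (pt (c # d # us)) \<le> 12 * kf x (pt (c # d # us) :: real v4)) \<and>
    total (pt (c # d # us)) \<le> 12 * real (run (c # d # us)) * - kf c (pt (c # d # us) :: real v4)"
  using assms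
proof (induction us arbitrary: c d)
  case Nil
  let ?q = "pt [d] :: real v4"
  have v: "valid [d]" "c \<noteq> d" using Nil by auto
  have e: "pt [c, d] = mirror c ?q" by (simp only: act_simps)
  have t: "total ?q \<le> 12 * kf x ?q" "kf x ?q \<ge> 0" if "x \<noteq> d" for x
    using v(1) that by (cases d; cases x; simp add: total_eq Let_def)+
  have "total (mirror c ?q) \<le> 12 * kf x (mirror c ?q)" if "x \<noteq> c" "x \<noteq> d" for x
    using t[OF v(2)] t[OF that(2)] that by (intro pt_regular_step) auto
  moreover have "total (mirror c ?q) \<le> 24 * kf c ?q"
    using t[OF v(2)] by (auto simp: total_mirror)
  moreover have "run [c, d] = 2" by simp
  ultimately show ?case unfolding e by (simp del: act_simps)
next
  case (Cons y us)
  let ?q = "pt (d # y # us) :: real v4"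
  have v: "valid (d # y # us)" "c \<noteq> d" using Cons.prems by auto
  have e: "pt (c # d # y # us) = mirror c ?q" by (simp only: act_simps)
  note IH = Cons.IH[OF v(1)]
  have "kf d ?q \<le> - 4 * real (length (d # y # us))" using pt_kf[OF v(1)] by blast
  then have d0: "kf d ?q \<le> 0" by (simp del: act_simps)
  have nn: "kf x ?q \<ge> - kf d ?q" if "x \<noteq> d" for x
  proof -
    have "kf x ?q + kf d ?q \<ge> 4" using pt_kf[OF v(1)] that by blast
    then show ?thesis by linarith
  qed
  have nn0: "kf x ?q \<ge> 0" if "x \<noteq> d" for x using nn[OF that] d0 by linarith
  have tm: "total (mirror c ?q) \<le> total ?q + 12 * kf c ?q"
    using nn0[OF v(2)] by (auto simp: total_mirror)
  have "total (mirror c ?q) \<le> 12 * kf x (mirror c ?q)" if "x \<noteq> c" "x \<noteq> d" for x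
    using IH that v(2) nn0 by (intro pt_regular_step) blast+
  moreover have "total (mirror c ?q) \<le> 12 * real (run (c # d # y # us)) * kf c ?q"
  proof (cases "c = y")
    case False
    then have "total ?q \<le> 12 * kf c ?q" using IH v(2) by blast
    then show ?thesis using tm False by simp
  next
    case True
    have r: "real (run (c # d # y # us)) = real (run (d # y # us)) + 1" using True by simp
    have "total ?q \<le> 12 * real (run (d # y # us)) * - kf d ?q" using IH by blast
    also have "\<dots> \<le> 12 * real (run (d # y # us)) * kf c ?q"
      using nn[OF v(2)] by (intro mult_left_mono) auto
    finally show ?thesis using tm unfolding r by (simp only: distrib_left distrib_right)
  qed
  ultimately show ?case unfolding e kf_mirror_same by (simp del: act_simps run.simps)
qed

abbreviation curv :: "letter list \<Rightarrow> real" where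
  "curv ws \<equiv> - kf (hd ws) (pt ws :: real v4)"

lemma curv_child:
  assumes v: "valid (x # c # us)"
  shows "curv (x # c # us) \<ge> curv (c # us) + 4" "curv (x # c # us) \<le> total (pt (c # us)) + curv (c # us)"
proof -
  let ?p = "pt (c # us) :: real v4"
  have vc: "valid (c # us)" and xc: "x \<noteq> c" using v by auto
  have e: "- kf x (pt (x # c # us)) = kf x ?p" by (simp only: act_simps kf_mirror_same minus_minus)
  have k: "kf z ?p + kf c ?p \<ge> 4" if "z \<noteq> c" for z using pt_kf[OF vc] that by blast
  show "curv (x # c # us) \<ge> curv (c # us) + 4" unfolding list.sel e using k[OF xc] by linarith
  have "kf c ?p \<le> - 4 * real (length (c # us))" using pt_kf[OF vc] by blast
  then have c0: "kf c ?p \<le> 0" by (simp del: act_simps)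
  have "0 \<le> (\<Sum>z\<in>- {c, x}. kf z ?p)"
  proof (rule sum_nonneg)
    fix z assume "z \<in> - {c, x}"
    then have "z \<noteq> c" by simp
    from k[OF this] c0 show "0 \<le> kf z ?p" by linarith
  qed
  moreover have "total ?p = kf c ?p + (kf x ?p + (\<Sum>z\<in>- {c, x}. kf z ?p))"
  proof -
    have "(UNIV :: letter set) = insert c (insert x (- {c, x}))" by auto
    then have "total ?p = (\<Sum>z\<in>insert c (insert x (- {c, x})). kf z ?p)" by (simp only: total_def)
    then show ?thesis using xc by (simp del: act_simps)
  qed
  ultimately show "curv (x # c # us) \<le> total ?p + curv (c # us)" unfolding list.sel e by linarith
qed

text \<open>With runs of at most 36 letters the constant is \<open>12 * 36 = 432\<close>, so
  consecutive discs have comparable size.\<close>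

lemma admitted_curv:
  assumes adm: "admitted ws"
  shows "curv ws > 0" "total (pt ws) \<le> 432 * curv ws" "FL (pt ws) (zL ws) \<le> curv ws powr (- (73 / 55))"
proof -
  obtain c d y us where ws: "ws = c # d # y # us"
    using adm by (cases ws; cases "tl ws"; cases "tl (tl ws)") (auto simp: admitted_def)
  have v: "valid (c # d # y # us)" using adm by (simp add: admitted_def ws)
  have "kf c (pt ws :: real v4) \<le> - 4 * real (length ws)" using pt_kf[OF v] unfolding ws by blast
  then show pos: "curv ws > 0" by (simp add: ws del: act_simps)
  have r: "real (run ws) \<le> 36" using adm by (auto simp: admitted_def split: if_splits)
  have "total (pt ws) \<le> 12 * real (run ws) * curv ws" using pt_regular[OF v] unfolding ws list.sel by blast
  also have "\<dots> \<le> 12 * 36 * curv ws" using pos r by (intro mult_right_mono) auto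
  finally show "total (pt ws) \<le> 432 * curv ws" by simp
  have "total (pt ws) \<ge> 3 * curv ws" using pt_total[OF v] unfolding ws list.sel by linarith
  then have "curv ws \<le> mpair (pt ws) (rv (zL ws))" using admitted_total(2)[OF adm] pos by linarith
  then show "FL (pt ws) (zL ws) \<le> curv ws powr (- (73 / 55))"
    unfolding FL_def using pos by (intro powr_mono2') auto
qed

text \<open>Distinct normals pair to 8 or 24 against squares \<open>-8\<close>, so their sum is
  causal; the hypothesis makes it future-directed. A point can therefore not be strictly inside both
  circles.\<close>

lemma pair_nonneg:
  assumes p: "kf x (pt ws) + kf y (pt ws :: real v4) > 0" and xy: "x \<noteq> y"
  shows "kf x (act ws (lift X)) + kf y (act ws (lift X)) \<ge> 0"
proof -
  define b where "b = act (rev ws) (nrm x + nrm y :: real v4)"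
  have nn: "mpair (nrm x + nrm y) (nrm x + nrm y :: real v4) \<ge> 0"
    using xy by (cases x; cases y) simp_all
  have bb: "mpair b b \<ge> 0"
    unfolding b_def mpair_act_act by (rule nn)
  have "kap b = mpair (act (rev ws) (nrm x + nrm y)) infty"
    unfolding kap_def b_def by (rule mpair_comm)
  also have "\<dots> = mpair (nrm x + nrm y) (pt ws)"
    by (simp only: mpair_act rev_rev_ident)
  also have "\<dots> = mpair (pt ws) (nrm x + nrm y)" by (rule mpair_comm)
  also have "\<dots> = kf x (pt ws) + kf y (pt ws)" by (simp only: mpair_add mpair_nrm)
  finally have kb: "kap b > 0" using p by linarith
  have kl: "kap (lift X) > 0" unfolding kap_def lift_infty by simp
  have ll: "mpair (lift X) (lift X) \<ge> 0" unfolding lift_light by simp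
  have "mpair (lift X) b \<ge> 0" by (rule mpair_causal_nonneg[OF kl ll kb bb])
  also have "mpair (lift X) b = mpair (act ws (lift X)) (nrm x + nrm y)"
    unfolding b_def by (rule mpair_act[symmetric])
  finally show ?thesis by (simp only: mpair_add mpair_nrm)
qed

lemma disc_child:
  assumes v: "valid (x # c # us)"
  shows "disc [] (x # c # us) \<subseteq> disc [] (c # us)" "odisc [] (x # c # us) \<subseteq> odisc [] (c # us)"
proof -
  have vc: "valid (c # us)" and xc: "x \<noteq> c" using v by auto
  have "kf x (pt (c # us)) + kf c (pt (c # us) :: real v4) \<ge> 4" using pt_kf[OF vc] xc by blast
  then have "kf x (pt (c # us)) + kf c (pt (c # us) :: real v4) > 0" by linarith
  from pair_nonneg[OF this xc]
  have a: "kf c (act (c # us) (lift X)) \<ge> - kf x (act (c # us) (lift X))" for X by (smt (verit))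
  have e: "kf x (act (x # c # us) (lift X)) = - kf x (act (c # us) (lift X))" for X
    by (simp only: act_simps kf_mirror_same)
  show "disc [] (x # c # us) \<subseteq> disc [] (c # us)" "odisc [] (x # c # us) \<subseteq> odisc [] (c # us)"
    unfolding disc_def odisc_def append_Nil2 list.sel e using a by (smt (verit) Collect_mono)+
qed

lemma odisc_siblings:
  assumes v: "valid (x # c # us)" "valid (y # c # us)" and xy: "x \<noteq> y"
  shows "odisc [] (x # c # us) \<inter> odisc [] (y # c # us) = {}"
proof -
  have vc: "valid (c # us)" and c: "x \<noteq> c" "y \<noteq> c" using v by auto
  have "kf c (pt (c # us) :: real v4) \<le> - 4 * real (length (c # us))" using pt_kf[OF vc] by blast
  then have c0: "kf c (pt (c # us) :: real v4) \<le> 0" by (simp del: act_simps)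
  have "kf z (pt (c # us)) + kf c (pt (c # us) :: real v4) \<ge> 4" if "z \<noteq> c" for z
    using pt_kf[OF vc] that by blast
  from this[OF c(1)] this[OF c(2)] c0
  have "kf x (pt (c # us)) + kf y (pt (c # us) :: real v4) > 0" by linarith
  from pair_nonneg[OF this xy]
  have a: "kf x (act (c # us) (lift X)) + kf y (act (c # us) (lift X)) \<ge> 0" for X .
  have e: "kf z (act (z # c # us) (lift X)) = - kf z (act (c # us) (lift X))" for X z
    by (simp only: act_simps kf_mirror_same)
  show ?thesis
  proof (rule ccontr)
    assume "odisc [] (x # c # us) \<inter> odisc [] (y # c # us) \<noteq> {}"
    then obtain X where "X \<in> odisc [] (x # c # us)" "X \<in> odisc [] (y # c # us)" by blast
    then have "- kf x (act (c # us) (lift X)) > 0" "- kf y (act (c # us) (lift X)) > 0"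
      unfolding odisc_def append_Nil2 list.sel e by simp_all
    then show False using a[of X] by linarith
  qed
qed

lemma valid_append: "valid (zs @ ws) \<Longrightarrow> valid ws"
  by (induction zs) (auto dest: valid_tl)

lemma extension:
  assumes "valid (zs @ c # us)"
  shows "odisc [] (zs @ c # us) \<subseteq> odisc [] (c # us)" "curv (c # us) \<le> curv (zs @ c # us)"
proof -
  have "odisc [] (zs @ c # us) \<subseteq> odisc [] (c # us) \<and> curv (c # us) \<le> curv (zs @ c # us)"
    using assms
  proof (induction zs)
    case (Cons z zs)
    obtain y ys where ys: "zs @ c # us = y # ys" by (cases zs) auto
    have v: "valid (z # y # ys)" using Cons.prems unfolding append_Cons ys .
    then have IH: "odisc [] (y # ys) \<subseteq> odisc [] (c # us) \<and> curv (c # us) \<le> curv (y # ys)"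
      using Cons.IH unfolding ys by (blast dest: valid_tl)
    then show ?case
      unfolding append_Cons ys using disc_child(2)[OF v] curv_child(1)[OF v] by (smt (verit) order_trans)
  qed simp
  then show "odisc [] (zs @ c # us) \<subseteq> odisc [] (c # us)" "curv (c # us) \<le> curv (zs @ c # us)" by blast+
qed

section \<open>Words stopped at a given size\<close>

text \<open>The common root ensures that any two words share a nonempty suffix above which they
  branch into siblings.\<close>

inductive tree :: "letter list \<Rightarrow> bool" where
  root: "tree [N3, N4, N5]"
| child: "tree ws \<Longrightarrow> admitted (x # ws) \<Longrightarrow> tree (x # ws)"

lemma tree_admitted: "tree ws \<Longrightarrow> admitted ws"
  by (induction rule: tree.induct) (auto simp: admitted_def)

lemma tree_suffix: "tree ws \<Longrightarrow> \<exists>zs. ws = zs @ [N3, N4, N5]"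
proof (induction rule: tree.induct)
  case (child ws x)
  then obtain zs where "ws = zs @ [N3, N4, N5]" by blast
  then show ?case by (intro exI[of _ "x # zs"]) simp
qed simp

text \<open>Curvature increases along a branch, so a branch stops at most once: when the curvature
  first reaches \<open>1 / r\<close>.\<close>

definition stopped :: "real \<Rightarrow> (real^2) set \<Rightarrow> letter list set" where
  "stopped r U = {ws. tree ws \<and> tree (tl ws) \<and> 1 \<le> curv ws * r \<and> curv (tl ws) * r < 1 \<and>
     disc [] ws \<inter> U \<noteq> {}}"

lemma stopped_not_suffix:
  assumes r: "r > 0" and v: "v \<in> stopped r U" and w: "w \<in> stopped r U" and e: "v = zs @ w"
  shows "v = w"
proof (rule ccontr)
  assume "v \<noteq> w"
  then obtain z zs' where z: "zs = z # zs'" using e by (cases zs) auto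
  have tw: "admitted w" "admitted (tl v)" using v w tree_admitted by (auto simp: stopped_def)
  then obtain c us where c: "w = c # us" by (cases w) (auto simp: admitted_def)
  have tv: "tl v = zs' @ c # us" by (simp add: e z c)
  have "curv w \<le> curv (tl v)"
    unfolding tv c using tw(2) by (intro extension(2)) (simp add: admitted_def tv)
  then have "curv w * r \<le> curv (tl v) * r" using r by (intro mult_right_mono) auto
  then show False using v w by (simp add: stopped_def)
qed

text \<open>Neither word extends the other. Read in reverse they separate at siblings, whose open
  discs are disjoint, and descendants stay inside them.\<close>

lemma stopped_disjoint:
  assumes r: "r > 0" and v: "v \<in> stopped r U" and w: "w \<in> stopped r U" and ne: "v \<noteq> w"
  shows "odisc [] v \<inter> odisc [] w = {}"
proof -
  have np: "\<not> prefix (rev a) (rev b)"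
    if "a \<in> stopped r U" "b \<in> stopped r U" "a \<noteq> b" for a b
  proof
    assume "prefix (rev a) (rev b)"
    then obtain z where "rev b = rev a @ z" by (rule prefixE)
    then have "rev (rev b) = rev (rev a @ z)" by (simp only:)
    then have "b = rev z @ a" by simp
    then show False using stopped_not_suffix[OF r that(2,1)] that(3) by blast
  qed
  have "rev v \<parallel> rev w" using np[OF v w ne] np[OF w v] ne by (intro parallelI) auto
  then obtain as b bs b' bs' where d: "b \<noteq> b'" "rev v = as @ b # bs" "rev w = as @ b' # bs'"
    using parallel_decomp by blast
  obtain zv zw where z: "v = zv @ [N3, N4, N5]" "w = zw @ [N3, N4, N5]"
    using v w tree_suffix unfolding stopped_def by blast
  have "as \<noteq> []"
  proof
    assume "as = []"
    then have "hd (rev v) = b" "hd (rev w) = b'" using d by simp_all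
    then show False using d(1) z by simp
  qed
  then obtain c us where c: "rev as = c # us" by (cases "rev as") auto
  have ev: "v = rev bs @ b # c # us" using arg_cong[OF d(2), of rev] by (simp add: c)
  have ew: "w = rev bs' @ b' # c # us" using arg_cong[OF d(3), of rev] by (simp add: c)
  have vv: "valid v" "valid w" using v w tree_admitted by (auto simp: stopped_def admitted_def)
  have "odisc [] (b # c # us) \<inter> odisc [] (b' # c # us) = {}"
    using vv d(1) unfolding ev ew by (intro odisc_siblings) (blast dest: valid_append)+
  moreover have "odisc [] v \<subseteq> odisc [] (b # c # us)" "odisc [] w \<subseteq> odisc [] (b' # c # us)"
    using vv unfolding ev ew by (intro extension(1); simp)+
  ultimately show ?thesis by blast
qed

lemma card_disjoint_balls:
  fixes q :: "'i \<Rightarrow> real^2"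
  assumes fin: "finite F" and r: "r > 0" "R > 0" and sub: "\<And>i. i \<in> F \<Longrightarrow> ball (q i) r \<subseteq> ball a R"
    and dis: "disjoint_family_on (\<lambda>i. ball (q i) r) F"
  shows "real (card F) \<le> (R / r)\<^sup>2"
proof -
  let ?V = "unit_ball_vol 2"
  have "real (card F) * (?V * r\<^sup>2) = (\<Sum>i\<in>F. measure lborel (ball (q i) r))"
    using r by (simp add: content_ball)
  also have "\<dots> = measure lborel (\<Union>i\<in>F. ball (q i) r)"
    using fin dis by (intro measure_finite_Union[symmetric]) (auto simp: emeasure_ball r less_imp_le)
  also have "\<dots> \<le> measure lborel (ball a R)"
    using sub by (intro measure_mono_fmeasurable) (auto intro!: sets.finite_UN fin fmeasurableI simp: emeasure_ball r less_imp_le)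
  also have "\<dots> = ?V * R\<^sup>2" using r by (simp add: content_ball)
  finally have "?V * (real (card F) * r\<^sup>2) \<le> ?V * R\<^sup>2" by (simp add: mult_ac)
  moreover have "?V > 0" by simp
  ultimately have "real (card F) * r\<^sup>2 \<le> R\<^sup>2" by (simp only: mult_le_cancel_left_pos)
  then show ?thesis using r by (simp add: power_divide pos_le_divide_eq)
qed

text \<open>The parent has curvature below \<open>1 / r\<close>, so the word itself has at most
  \<open>433 / r\<close>, which leaves room for radius \<open>r / 250\<close>. Conversely its radius
  is at most \<open>3 * r\<close>.\<close>

lemma stopped_ball:
  assumes r: "r > 0" and ws: "ws \<in> stopped r U"
  shows "\<exists>q. ball q (r / 250) \<subseteq> odisc [] ws \<and> (\<exists>X\<in>U. dist q X \<le> 3 * r)"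
proof -
  have ad: "admitted ws" "admitted (tl ws)" and c: "1 \<le> curv ws * r" "curv (tl ws) * r < 1"
    and meet: "disc [] ws \<inter> U \<noteq> {}"
    using ws tree_admitted by (auto simp: stopped_def)
  obtain x c' us where w: "ws = x # c' # us"
    using ad(1) by (cases ws; cases "tl ws") (auto simp: admitted_def)
  have v: "valid (x # c' # us)" using ad(1) by (simp add: admitted_def w)
  let ?K = "curv ws"
  have K: "?K > 0" by (rule admitted_curv(1)[OF ad(1)])
  obtain q where q: "disc [] ws = cball q (sqrt 8 / ?K)" "odisc [] ws = ball q (sqrt 8 / ?K)"
    using disc_cball[of "[]", OF _ v] unfolding w list.sel by auto
  have s8: "2 \<le> sqrt (8::real)" "sqrt (8::real) \<le> 3"
    using real_sqrt_le_mono[of 4 8] real_sqrt_le_mono[of 8 9] by (simp_all del: real_sqrt_le_iff)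
  have "?K \<le> 433 * curv (tl ws)"
    using curv_child(2)[OF v] admitted_curv(2)[OF ad(2)] unfolding w list.sel by linarith
  then have "?K * r \<le> 433 * (curv (tl ws) * r)"
    using r mult_right_mono[of ?K "433 * curv (tl ws)" r] by (simp only: mult.assoc less_imp_le)
  then have Kr: "?K * r \<le> 433" using c(2) by linarith
  have "r / 250 * k = k * r / 250" for k by simp
  then have "r / 250 * ?K \<le> 2" using Kr by (simp only:; linarith)
  then have "r / 250 \<le> 2 / ?K" using K by (simp only: pos_le_divide_eq)
  also have "\<dots> \<le> sqrt 8 / ?K" using K s8 by (intro divide_right_mono) auto
  finally have "ball q (r / 250) \<subseteq> odisc [] ws" unfolding q by (rule subset_ball)
  moreover have "\<exists>X\<in>U. dist q X \<le> 3 * r"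
  proof -
    obtain X where X: "X \<in> U" "dist q X \<le> sqrt 8 / ?K" using meet unfolding q by auto
    have "sqrt 8 / ?K \<le> 3 / ?K" using K s8 by (intro divide_right_mono) auto
    also have "\<dots> \<le> 3 * r"
    proof -
      have "3 \<le> 3 * r * ?K" using c(1) by (simp only: mult.assoc mult.commute[of r]; linarith)
      then show ?thesis using K by (simp only: pos_divide_le_eq)
    qed
    finally show ?thesis using X by (intro bexI[of _ X]) auto
  qed
  ultimately show ?thesis by blast
qed

text \<open>Disjoint balls of radius \<open>r / 250\<close> inside one of radius
  \<open>5 * r\<close>: the count is at most \<open>(5 * 250) ^ 2\<close>.\<close>

lemma stopped_card:
  assumes r: "r > 0" and U: "bounded U" "diameter U \<le> r"
  shows "finite (stopped r U) \<and> card (stopped r U) \<le> 1562500"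
proof (rule finite_if_finite_subsets_card_bdd)
  fix G assume G: "G \<subseteq> stopped r U" "finite G"
  show "card G \<le> 1562500"
  proof (cases "G = {}")
    case False
    have "\<forall>ws\<in>G. \<exists>q. ball q (r / 250) \<subseteq> odisc [] ws \<and> (\<exists>X\<in>U. dist q X \<le> 3 * r)"
      using G(1) stopped_ball[OF r] by blast
    then obtain q where q: "\<And>ws. ws \<in> G \<Longrightarrow> ball (q ws) (r / 250) \<subseteq> odisc [] ws"
      "\<And>ws. ws \<in> G \<Longrightarrow> \<exists>X\<in>U. dist (q ws) X \<le> 3 * r" by metis
    obtain a where a: "a \<in> U" using False q(2) by blast
    have sub: "ball (q ws) (r / 250) \<subseteq> ball a (5 * r)" if ws: "ws \<in> G" for ws
    proof
      fix y assume y: "y \<in> ball (q ws) (r / 250)"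
      obtain X where X: "X \<in> U" "dist (q ws) X \<le> 3 * r" using q(2)[OF ws] by blast
      have "dist a X \<le> r" using diameter_bounded_bound[OF U(1) a X(1)] U(2) by linarith
      moreover have "dist a y \<le> dist a X + dist X (q ws) + dist (q ws) y"
        using dist_triangle[of a y X] dist_triangle[of X y "q ws"] by linarith
      moreover have "dist (q ws) y < r / 250" using y by simp
      ultimately have "dist a y < 5 * r" using X(2) r by (simp add: dist_commute)
      then show "y \<in> ball a (5 * r)" by simp
    qed
    have dis: "disjoint_family_on (\<lambda>ws. ball (q ws) (r / 250)) G"
      unfolding disjoint_family_on_def
    proof (intro ballI impI)
      fix v w assume "v \<in> G" "w \<in> G" "v \<noteq> w"
      then show "ball (q v) (r / 250) \<inter> ball (q w) (r / 250) = {}"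
        using q(1) stopped_disjoint[OF r, of v U w] G(1) by blast
    qed
    have "real (card G) \<le> ((5 * r) / (r / 250))\<^sup>2"
      using r by (intro card_disjoint_balls[OF G(2) _ _ sub dis]) auto
    also have "\<dots> = 1562500" using r by (simp add: power2_eq_square)
    finally show ?thesis by simp
  qed simp
qed

section \<open>An infinite branch avoiding the stopped words\<close>

abbreviation weightL :: "letter list \<Rightarrow> real" where
  "weightL ws \<equiv> FL (pt ws) (zL ws)"

lemma weightL_nonneg: "weightL ws \<ge> 0"
  by (simp add: FL_def)

lemma stopped_weight:
  assumes r: "r > 0" and U: "bounded U" "diameter U \<le> r"
  shows "(\<Sum>ws\<in>stopped r U. weightL ws) \<le> 1562500 * r powr (73 / 55)"
proof -
  have "weightL ws \<le> r powr (73 / 55)" if ws: "ws \<in> stopped r U" for ws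
  proof -
    have ad: "admitted ws" and c: "1 \<le> curv ws * r" using ws tree_admitted by (auto simp: stopped_def)
    have "1 / r \<le> curv ws" using c r by (simp only: pos_divide_le_eq)
    then have "curv ws powr (- (73 / 55)) \<le> (1 / r) powr (- (73 / 55))"
      using r by (intro powr_mono2') auto
    also have "\<dots> = r powr (73 / 55)" using r by (simp add: powr_divide powr_minus_divide)
    finally show ?thesis using admitted_curv(3)[OF ad] by linarith
  qed
  then have "(\<Sum>ws\<in>stopped r U. weightL ws) \<le> (\<Sum>ws\<in>stopped r U. r powr (73 / 55))"
    by (intro sum_mono)
  also have "\<dots> = real (card (stopped r U)) * r powr (73 / 55)" by simp
  also have "\<dots> \<le> 1562500 * r powr (73 / 55)"
    using stopped_card[OF r U] by (intro mult_right_mono) auto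
  finally show ?thesis .
qed

text \<open>\<open>m ws\<close> is the mass of stopped descendants. It is at least the sum over the
  children, whose descendants are disjoint, while \<open>weightL\<close> is at most that sum; so a
  word with \<open>m\<close> below its weight has a child of the same kind, and no such word is
  stopped.\<close>

lemma avoiding_branch:
  fixes r :: "nat \<Rightarrow> real" and U :: "nat \<Rightarrow> (real^2) set"
  assumes r: "\<And>k. r k > 0" and U: "\<And>k. bounded (U k)" "\<And>k. diameter (U k) \<le> r k"
    and less: "(\<Sum>k. ennreal (1562500 * r k powr (73 / 55))) < ennreal (weightL [N3, N4, N5])"
  shows "\<exists>f. f 0 = [N3, N4, N5] \<and> (\<forall>n. tree (f n) \<and> (\<exists>x. f (Suc n) = x # f n)) \<and>
    (\<forall>n k. f n \<notin> stopped (r k) (U k))"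
proof -
  define E where "E = (\<lambda>k ws. {v \<in> stopped (r k) (U k). \<exists>zs. v = zs @ ws})"
  define m where "m = (\<lambda>ws. \<Sum>k. ennreal (\<Sum>v\<in>E k ws. weightL v))"
  define good where "good = (\<lambda>ws. tree ws \<and> m ws < ennreal (weightL ws))"
  have fin: "finite (E k ws)" for k ws
    using stopped_card[OF r[of k] U(1)[of k] U(2)[of k]] unfolding E_def by simp
  have "m [N3, N4, N5] \<le> (\<Sum>k. ennreal (1562500 * r k powr (73 / 55)))"
    unfolding m_def
  proof (intro suminf_le ennreal_leI)
    fix k
    have "(\<Sum>v\<in>E k [N3, N4, N5]. weightL v) \<le> (\<Sum>v\<in>stopped (r k) (U k). weightL v)"
      using stopped_card[OF r[of k] U(1)[of k] U(2)[of k]] weightL_nonneg by (intro sum_mono2) (auto simp: E_def)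
    also have "\<dots> \<le> 1562500 * r k powr (73 / 55)" by (rule stopped_weight[OF r[of k] U(1)[of k] U(2)[of k]])
    finally show "(\<Sum>v\<in>E k [N3, N4, N5]. weightL v) \<le> 1562500 * r k powr (73 / 55)" .
  qed auto
  then have good0: "good [N3, N4, N5]" using less tree.root by (simp add: good_def)
  have not_stopped: "ws \<notin> stopped (r k) (U k)" if "good ws" for ws k
  proof
    assume "ws \<in> stopped (r k) (U k)"
    then have "ws \<in> E k ws" by (simp add: E_def)
    then have "weightL ws \<le> (\<Sum>v\<in>E k ws. weightL v)"
      using fin weightL_nonneg by (intro member_le_sum) auto
    then have "ennreal (weightL ws) \<le> ennreal (\<Sum>v\<in>E k ws. weightL v)" by (rule ennreal_leI)
    also have "\<dots> \<le> m ws"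
      unfolding m_def using sum_le_suminf[of "\<lambda>k. ennreal (\<Sum>v\<in>E k ws. weightL v)" "{k}"]
      by (simp only: summableI finite.intros sum.insert sum.empty finite.emptyI empty_iff add_0_right zero_le simp_thms)
    finally show False using that by (simp only: good_def not_less[symmetric] simp_thms)
  qed
  have step: "\<exists>x. good (x # ws)" if g: "good ws" for ws
  proof (rule ccontr)
    assume none: "\<not> (\<exists>x. good (x # ws))"
    let ?A = "{x. admitted (x # ws)}"
    have tw: "tree ws" using g by (simp add: good_def)
    have "ennreal (weightL ws) \<le> ennreal (\<Sum>x\<in>?A. weightL (x # ws))"
      using FL_step[OF tree_admitted[OF tw]] by (rule ennreal_leI)
    also have "\<dots> = (\<Sum>x\<in>?A. ennreal (weightL (x # ws)))"
      by (rule sum_ennreal[symmetric]) (rule weightL_nonneg)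
    also have "\<dots> \<le> (\<Sum>x\<in>?A. m (x # ws))"
    proof (rule sum_mono)
      fix x assume "x \<in> ?A"
      then have "tree (x # ws)" using tw by (auto intro: tree.child)
      then show "ennreal (weightL (x # ws)) \<le> m (x # ws)" using none by (auto simp: good_def not_less)
    qed
    also have "\<dots> = (\<Sum>k. \<Sum>x\<in>?A. ennreal (\<Sum>v\<in>E k (x # ws). weightL v))"
      unfolding m_def by (rule suminf_sum[symmetric]) (rule summableI)
    also have "\<dots> \<le> m ws"
      unfolding m_def
    proof (intro suminf_le)
      fix k
      have "(\<Sum>x\<in>?A. ennreal (\<Sum>v\<in>E k (x # ws). weightL v)) =
          ennreal (\<Sum>x\<in>?A. \<Sum>v\<in>E k (x # ws). weightL v)"
        by (rule sum_ennreal) (intro sum_nonneg weightL_nonneg)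
      also have "(\<Sum>x\<in>?A. \<Sum>v\<in>E k (x # ws). weightL v) = (\<Sum>v\<in>(\<Union>x\<in>?A. E k (x # ws)). weightL v)"
        by (rule sum.UNION_disjoint[symmetric]) (auto simp: fin, auto simp: E_def)
      also have "\<dots> \<le> (\<Sum>v\<in>E k ws. weightL v)"
      proof (rule sum_mono2[OF fin])
        show "(\<Union>x\<in>?A. E k (x # ws)) \<subseteq> E k ws"
        proof
          fix v assume "v \<in> (\<Union>x\<in>?A. E k (x # ws))"
          then obtain x zs where "v \<in> stopped (r k) (U k)" "v = zs @ x # ws" by (auto simp: E_def)
          then show "v \<in> E k ws" by (auto simp: E_def intro!: exI[of _ "zs @ [x]"])
        qed
      qed (rule weightL_nonneg)
      finally show "(\<Sum>x\<in>?A. ennreal (\<Sum>v\<in>E k (x # ws). weightL v)) \<le> ennreal (\<Sum>v\<in>E k ws. weightL v)"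
        by (simp add: ennreal_leI)
    qed auto
    finally show False using g by (simp only: good_def not_less[symmetric] simp_thms)
  qed
  then obtain h where h: "\<And>ws. good ws \<Longrightarrow> good (h ws # ws)" by metis
  define f where "f = rec_nat [N3, N4, N5] (\<lambda>_ ws. h ws # ws)"
  have f: "f 0 = [N3, N4, N5]" "f (Suc n) = h (f n) # f n" for n by (simp_all add: f_def)
  have gf: "good (f n)" for n by (induction n) (simp_all add: f good0 h)
  show ?thesis
    using gf not_stopped f by (intro exI[of _ f]) (auto simp: good_def)
qed

section \<open>The limit point of a branch\<close>

lemma closed_residual: "closed mallows_residual"
proof -
  have e: "mallows_residual = (\<Inter>us. \<Inter>e\<in>seeds. {X. 0 \<le> mpair (lift X) (act (rev us) e)})"
    by (auto simp: residual_iff mpair_act)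
  have "closed {X. 0 \<le> mpair (lift X) v}" for v
    unfolding mpair_lift by (intro closed_Collect_le continuous_intros)
  then show ?thesis unfolding e by (intro closed_INT ballI)
qed

text \<open>The discs are nested compact balls of radii tending to zero, with centres in the closed
  residual set.\<close>

lemma branch_limit:
  assumes f: "\<And>n. tree (f n)" "\<And>n. \<exists>x. f (Suc n) = x # f n"
  shows "\<exists>X\<in>mallows_residual. \<forall>n. X \<in> disc [] (f n)" "curv (f n) \<ge> 4 * real n"
proof -
  have form: "\<exists>c us. f n = c # us \<and> valid (c # us)" for n
    using tree_admitted[OF f(1)[of n]] by (cases "f n") (auto simp: admitted_def)
  have ch: "curv (f (Suc n)) \<ge> curv (f n) + 4 \<and> disc [] (f (Suc n)) \<subseteq> disc [] (f n)" for n
  proof -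
    obtain c us where c: "f n = c # us" using form by blast
    obtain x where x: "f (Suc n) = x # c # us" using f(2)[of n] c by auto
    then have v: "valid (x # c # us)" using form[of "Suc n"] by auto
    show ?thesis unfolding x unfolding c using curv_child(1)[OF v] disc_child(1)[OF v] by blast
  qed
  have curv: "curv (f n) \<ge> 4 * real n" for n
  proof (induction n)
    case 0
    show ?case using admitted_curv(1)[OF tree_admitted[OF f(1)[of 0]]] by simp
  next
    case (Suc n)
    then show ?case using ch[of n] by simp
  qed
  then show "curv (f n) \<ge> 4 * real n" .
  have pos: "curv (f n) > 0" for n by (rule admitted_curv(1)[OF tree_admitted[OF f(1)]])
  have "\<exists>q\<in>mallows_residual. disc [] (f n) = cball q (sqrt 8 / curv (f n))" for n
  proof -
    obtain c us where c: "f n = c # us" "valid (c # us)" using form by blast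
    show ?thesis using disc_cball[of "[]", OF _ c(2)] unfolding c(1) list.sel by auto
  qed
  then obtain q where q: "\<And>n. q n \<in> mallows_residual" "\<And>n. disc [] (f n) = cball (q n) (sqrt 8 / curv (f n))"
    by metis
  have "\<Inter> (range (\<lambda>n. disc [] (f n))) \<noteq> {}"
  proof (rule compact_nest)
    show "compact (disc [] (f n))" for n unfolding q(2) by simp
    show "disc [] (f n) \<noteq> {}" for n
    proof -
      have "0 \<le> sqrt 8 / curv (f n)" using pos[of n] by (intro divide_nonneg_pos) auto
      then have "q n \<in> disc [] (f n)" unfolding q(2) by (simp only: centre_in_cball)
      then show ?thesis by blast
    qed
    show "disc [] (f n) \<subseteq> disc [] (f m)" if "m \<le> n" for m n
      using lift_Suc_antimono_le[of "\<lambda>n. disc [] (f n)", OF _ that] ch by blast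
  qed
  then obtain X where X: "\<And>n. X \<in> disc [] (f n)" by auto
  have "X \<in> mallows_residual"
  proof (rule closed_approachable[OF closed_residual, THEN iffD1], intro allI impI)
    fix e :: real assume e: "e > 0"
    obtain n where n: "sqrt 8 / e < real n" using reals_Archimedean2 by blast
    have "sqrt 8 / e > 0" using e by simp
    then have n0: "real n > 0" using n by linarith
    have "sqrt 8 / e < curv (f n)" using n n0 curv[of n] by linarith
    then have "sqrt 8 / curv (f n) < e"
      using e pos[of n] by (simp only: pos_divide_less_eq mult.commute)
    moreover have "dist (q n) X \<le> sqrt 8 / curv (f n)" using X[of n] unfolding q(2) by simp
    ultimately have "dist (q n) X < e" by linarith
    then show "\<exists>y\<in>mallows_residual. dist y X < e" using q(1) by blast
  qed
  then show "\<exists>X\<in>mallows_residual. \<forall>n. X \<in> disc [] (f n)" using X by blast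
qed

text \<open>The branch begins below curvature \<open>1 / r k\<close> and its curvature is unbounded.
  If \<open>U k\<close> contained the limit point, the first word past the threshold would be
  stopped.\<close>

lemma no_thin_cover:
  fixes r :: "nat \<Rightarrow> real" and U :: "nat \<Rightarrow> (real^2) set"
  assumes r: "\<And>k. r k > 0" "\<And>k. curv [N3, N4, N5] * r k < 1"
    and U: "\<And>k. bounded (U k)" "\<And>k. diameter (U k) \<le> r k" "mallows_residual \<subseteq> (\<Union>k. U k)"
  shows "ennreal (weightL [N3, N4, N5]) \<le> (\<Sum>k. ennreal (1562500 * r k powr (73 / 55)))"
proof (rule ccontr)
  assume "\<not> ?thesis"
  then have less: "(\<Sum>k. ennreal (1562500 * r k powr (73 / 55))) < ennreal (weightL [N3, N4, N5])"
    by (simp only: not_le)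
  obtain f where f: "f 0 = [N3, N4, N5]" "\<And>n. tree (f n)" "\<And>n. \<exists>x. f (Suc n) = x # f n"
    "\<And>n k. f n \<notin> stopped (r k) (U k)"
    using avoiding_branch[OF r(1) U(1,2) less] by blast
  obtain X where X: "X \<in> mallows_residual" "\<And>n. X \<in> disc [] (f n)"
    using branch_limit(1)[of f, OF f(2,3)] by blast
  obtain k where k: "X \<in> U k" using X(1) U(3) by blast
  obtain n where "1 / r k < real n" using reals_Archimedean2 by blast
  then have "1 / r k \<le> curv (f n)" using branch_limit(2)[of f, OF f(2,3), of n] by linarith
  then have n: "1 \<le> curv (f n) * r k" using r(1)[of k] by (simp only: pos_divide_le_eq)
  define N where "N = (LEAST n. 1 \<le> curv (f n) * r k)"
  have N: "1 \<le> curv (f N) * r k" unfolding N_def by (rule LeastI[of _ n]) (rule n)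
  have "N \<noteq> 0" using N f(1) r(2)[of k] by (metis not_less)
  then obtain M where M: "N = Suc M" using not0_implies_Suc by blast
  have "\<not> 1 \<le> curv (f M) * r k" using not_less_Least[of M "\<lambda>n. 1 \<le> curv (f n) * r k"] M by (simp add: N_def)
  then have M': "curv (f M) * r k < 1" by linarith
  obtain x where x: "f N = x # f M" using f(3)[of M] M by blast
  have "f N \<in> stopped (r k) (U k)"
    unfolding stopped_def using f(2)[of N] f(2)[of M] N M' X(2)[of N] k x by auto
  then show False using f(4) by blast
qed

lemma residual_positive:
  assumes t: "0 \<le> t" "t \<le> 73 / 55"
  shows "hausdorff_measure t mallows_residual \<noteq> 0"
proof
  assume null: "hausdorff_measure t mallows_residual = 0"
  let ?s = "73 / 55 :: real" and ?F = "weightL [N3, N4, N5]" and ?c = "curv [N3, N4, N5]"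
  have adm: "admitted [N3, N4, N5]" by (rule tree_admitted[OF tree.root])
  have F: "?F > 0" using admitted_total(1,2)[OF adm] unfolding FL_def by simp
  have c: "?c > 0" by (rule admitted_curv(1)[OF adm])
  \<comment> \<open>The first term keeps the stopped mass, at most \<open>1562500 * 2 * e\<close>,
    below the root weight; the second keeps every \<open>r n\<close> below the reciprocal of the
    root curvature.\<close>
  define e where "e = min (?F / 6250000) (?c powr (- ?s) / 4)"
  have e: "e > 0" "4 * 1562500 * e \<le> ?F" "4 * e \<le> ?c powr (- ?s)" using F c by (auto simp: e_def)
  \<comment> \<open>Mesh 1 suffices: diameters at most 1 allow the exponent \<open>t\<close> to be
    raised to \<open>73 / 55\<close>.\<close>
  have "hausdorff_premeasure t 1 mallows_residual \<le> hausdorff_measure t mallows_residual"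
    unfolding hausdorff_measure_def by (intro SUP_upper) auto
  then have "hausdorff_premeasure t 1 mallows_residual < ennreal e" using null e by simp
  then obtain U where U: "mallows_residual \<subseteq> (\<Union>n. U n)" "\<And>n. bounded (U n)" "\<And>n. diameter (U n) \<le> 1"
    "(\<Sum>n. hausdorff_gauge t (U n)) < ennreal e"
    unfolding hausdorff_premeasure_def INF_less_iff by blast
  define a where "a = (\<lambda>n. diameter (U n) powr ?s)"
  have a0: "a n \<ge> 0" for n by (simp add: a_def)
  have ag: "ennreal (a n) \<le> hausdorff_gauge t (U n)" for n
  proof (cases "U n = {}")
    case True then show ?thesis by (simp add: a_def)
  next
    case ne: False
    have d: "0 \<le> diameter (U n)" by (rule diameter_ge_0[OF U(2)])
    show ?thesis
    proof (cases "t = 0")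
      case True
      have "a n \<le> 1 powr ?s" unfolding a_def using d U(3) by (intro powr_mono2) auto
      then show ?thesis using ne True by (simp add: hausdorff_gauge_def)
    next
      case False
      have "a n \<le> diameter (U n) powr t" unfolding a_def using d U(3)[of n] t by (intro powr_mono') auto
      then show ?thesis using ne False by (simp add: hausdorff_gauge_def ennreal_leI)
    qed
  qed
  \<comment> \<open>The geometric term makes \<open>r n\<close> positive even when
    \<open>U n\<close> has diameter 0.\<close>
  define g where "g = (\<lambda>n. a n + e * (1 / 2) ^ Suc n)"
  define r where "r = (\<lambda>n. g n powr (1 / ?s))"
  have suma: "(\<Sum>n. ennreal (a n)) < ennreal e"
    using suminf_le[OF ag summableI summableI] U(4) by (rule order.strict_trans1)
  have sumh: "(\<Sum>n. ennreal (e * (1 / 2) ^ Suc n)) = ennreal e"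
  proof -
    have "(\<lambda>n. e * (1 / 2) ^ Suc n) sums (e * 1)" by (intro sums_mult power_half_series)
    then show ?thesis using e by (subst suminf_ennreal_eq[of _ e]) auto
  qed
  have g0: "g n > 0" for n using a0[of n] e by (simp add: g_def add_nonneg_pos)
  have sumg: "(\<Sum>n. ennreal (g n)) < ennreal (2 * e)"
  proof -
    have "(\<Sum>n. ennreal (g n)) = (\<Sum>n. ennreal (a n) + ennreal (e * (1 / 2) ^ Suc n))"
      using a0 e by (simp add: g_def)
    also have "\<dots> = (\<Sum>n. ennreal (a n)) + ennreal e"
      unfolding sumh[symmetric] by (rule suminf_add[symmetric]) (rule summableI)+
    also have "\<dots> < ennreal e + ennreal e" using suma by (simp add: ennreal_add_left_cancel_less add.commute)
    finally show ?thesis using e by (simp flip: ennreal_plus)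
  qed
  have rs: "r n powr ?s = g n" for n using g0[of n] by (simp add: r_def powr_powr)
  have r0: "r n > 0" for n using g0[of n] by (simp add: r_def)
  have dr: "diameter (U n) \<le> r n" for n
  proof -
    have d: "0 \<le> diameter (U n)" by (rule diameter_ge_0[OF U(2)])
    then have "diameter (U n) = a n powr (1 / ?s)" by (simp add: a_def powr_powr)
    also have "\<dots> \<le> g n powr (1 / ?s)" using a0[of n] e by (intro powr_mono2) (auto simp: g_def)
    finally show ?thesis by (simp add: r_def)
  qed
  have cr: "?c * r n < 1" for n
  proof (rule ccontr)
    assume "\<not> ?c * r n < 1"
    then have "1 / ?c \<le> r n" using c by (simp only: not_less pos_divide_le_eq mult.commute)
    then have "(1 / ?c) powr ?s \<le> r n powr ?s" using c by (intro powr_mono2) auto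
    moreover have "(1 / ?c) powr ?s = ?c powr (- ?s)"
      by (simp only: powr_divide powr_minus_divide powr_one_eq_one)
    ultimately have "4 * e \<le> g n" using e(3) unfolding rs by linarith
    moreover have "ennreal (g n) \<le> (\<Sum>n. ennreal (g n))"
      using sum_le_suminf[OF summableI, of "{n}" "\<lambda>n. ennreal (g n)"] by simp
    then have "ennreal (g n) < ennreal (2 * e)" using sumg by (rule order.strict_trans1)
    then have "g n < 2 * e" using g0[of n] by (simp add: ennreal_less_iff less_imp_le)
    ultimately show False using e(1) by linarith
  qed
  have "ennreal ?F \<le> (\<Sum>k. ennreal (1562500 * r k powr ?s))"
    by (rule no_thin_cover[OF r0 cr U(2) dr U(1)])
  also have "\<dots> = ennreal 1562500 * (\<Sum>k. ennreal (g k))"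
    unfolding rs by (subst ennreal_suminf_cmult[symmetric]) (simp add: ennreal_mult' del: ennreal_suminf_cmult)
  also have "\<dots> \<le> ennreal 1562500 * ennreal (2 * e)" using sumg by (intro mult_left_mono) auto
  also have "\<dots> = ennreal (1562500 * (2 * e))" using e by (simp add: ennreal_mult')
  finally have "?F \<le> 1562500 * (2 * e)" using e by (subst (asm) ennreal_le_iff) auto
  then show False using e by linarith
qed

theorem dim_lower: "ereal 1.327266 < hausdorff_dim mallows_residual"
proof -
  have "ereal (73 / 55) \<le> hausdorff_dim mallows_residual"
    unfolding hausdorff_dim_def
  proof (rule INF_greatest)
    fix t assume "t \<in> {t. 0 \<le> t \<and> hausdorff_measure t mallows_residual = 0}"
    then have "\<not> t \<le> 73 / 55" using residual_positive by blast
    then show "ereal (73 / 55) \<le> ereal t" by simp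
  qed
  moreover have "ereal 1.327266 < ereal (73 / 55)" by simp
  ultimately show ?thesis by (rule order.strict_trans2[rotated])
qed

section \<open>The dimension of the residual set\<close>

theorem mainTheorem1:
  shows "ereal 1.327266 < hausdorff_dim mallows_residual \<and> hausdorff_dim mallows_residual < ereal 1.348771"
  using dim_lower dim_upper by blast

end
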